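(* Let $\mathbb{P}^{2m+1}$ be endowed with a contact structure induced by a constant symplectic form on $\mathbb{C}^{2m+2}$. If $X\subset\mathbb{P}^{2m+1}$ is a smooth hypersurface of degree $d\ge 3$, then the maximal number of pairwise disjoint involutive $m$-planes in $X$ is at most $(d-1)^{m+1}+1$. Moreover, when $m=1$ (i.e. $X$ is a surface in $\mathbb{P}^3$) and $d\ge 6$, the bound is sharp.
   Context: We work over $\mathbb{C}$, with $m\ge 1$. A constant symplectic form $\sigma=\sum_{i,j}\lambda_{ij}\,dx_i\wedge dx_j$ on $\mathbb{C}^{2m+2}$ induces a contact structure on $\mathbb{P}^{2m+1}$ defined by the contact form $\omega=i_R\sigma\in H^0(\mathbb{P}^{2m+1},\Omega^1_{\mathbb{P}^{2m+1}}(2))$, where $R=\sum_i x_i\frac{\partial}{\partial x_i}$ is the radial vector field and $i_R$ is interior product with $R$. An $m$-plane is a linearly embedded $\mathbb{P}^m\subset\mathbb{P}^{2m+1}$. It is involutive if the pull-back of $\omega$ to it vanishes identically; equivalently, it is the projectivization of a Lagrangian subspace of $(\mathbb{C}^{2m+2},\sigma)$. For $m=1$ the involutive $m$-planes are the involutive lines in $\mathbb{P}^3$, and the bound reads $(d-1)^2+1$. *)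

theory Defs
  imports "HOL-Analysis.Analysis" "HOL-Library.Poly_Mapping"
begin

(* Polynomials over the complex numbers in variables indexed by 'n:
   finitely supported maps from exponent vectors to coefficients. *)
type_synonym 'n cpoly = "('n \<Rightarrow>\<^sub>0 nat) \<Rightarrow>\<^sub>0 complex"

definition poly_eval :: "'n::finite cpoly \<Rightarrow> complex ^ 'n \<Rightarrow> complex" where
  "poly_eval F x =
     (\<Sum>\<alpha>\<in>Poly_Mapping.keys F.
        Poly_Mapping.lookup F \<alpha> * (\<Prod>i\<in>UNIV. (x $ i) ^ Poly_Mapping.lookup \<alpha> i))"

definition homogeneous :: "nat \<Rightarrow> 'n::finite cpoly \<Rightarrow> bool" where
  "homogeneous d F \<longleftrightarrow>
     (\<forall>\<alpha>\<in>Poly_Mapping.keys F. (\<Sum>i\<in>UNIV. Poly_Mapping.lookup \<alpha> i) = d)"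

(* Formal partial derivative. Subtraction of exponents truncates, but only in
   terms where the exponent of the variable, hence the coefficient, is 0. *)
definition partial_deriv :: "'n \<Rightarrow> 'n::finite cpoly \<Rightarrow> 'n cpoly" where
  "partial_deriv i F =
     (\<Sum>\<alpha>\<in>Poly_Mapping.keys F.
        Poly_Mapping.single (\<alpha> - Poly_Mapping.single i 1)
          (of_nat (Poly_Mapping.lookup \<alpha> i) * Poly_Mapping.lookup F \<alpha>))"

(* The projectivization of a linear subspace W. A point of projective space is
   a one-dimensional subspace, so P(W) is a set of sets of vectors and
   Proj UNIV is the projective space of dimension CARD('n) - 1. *)
definition Proj :: "(complex ^ 'n) set \<Rightarrow> (complex ^ 'n) set set" where
  "Proj W = {p. vec.subspace p \<and> vec.dim p = 1 \<and> p \<subseteq> W}"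

definition zero_locus :: "'n::finite cpoly \<Rightarrow> (complex ^ 'n) set set" where
  "zero_locus F = {p \<in> Proj UNIV. \<forall>x\<in>p. poly_eval F x = 0}"

(* Jacobian criterion: at no point of X do all partial derivatives of the
   equation vanish. In particular the equation has no multiple factor, so d is
   the degree of X as a variety. *)
definition smooth_hypersurface :: "nat \<Rightarrow> (complex ^ 'n::finite) set set \<Rightarrow> bool" where
  "smooth_hypersurface d X \<longleftrightarrow>
     (\<exists>F. F \<noteq> 0 \<and> homogeneous d F \<and> X = zero_locus F \<and>
        (\<forall>p\<in>X. \<forall>x\<in>p. x \<noteq> 0 \<longrightarrow> (\<exists>i. poly_eval (partial_deriv i F) x \<noteq> 0)))"

definition m_plane :: "nat \<Rightarrow> (complex ^ 'n) set set \<Rightarrow> bool" where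
  "m_plane m \<Lambda> \<longleftrightarrow> (\<exists>W. vec.subspace W \<and> vec.dim W = m + 1 \<and> \<Lambda> = Proj W)"

(* The constant 2-form sum_{i,j} lam_ij dx_i \<and> dx_j; the matrix lam need not be
   antisymmetric. *)
definition two_form :: "complex ^ 'n ^ 'n \<Rightarrow> complex ^ 'n::finite \<Rightarrow> complex ^ 'n \<Rightarrow> complex" where
  "two_form lam u v = (\<Sum>i\<in>UNIV. \<Sum>j\<in>UNIV. lam $ i $ j * (u $ i * v $ j - u $ j * v $ i))"

(* A constant form is closed, so symplectic means nondegenerate. *)
definition symplectic :: "complex ^ 'n ^ 'n::finite \<Rightarrow> bool" where
  "symplectic lam \<longleftrightarrow> (\<forall>u. u \<noteq> 0 \<longrightarrow> (\<exists>v. two_form lam u v \<noteq> 0))"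

definition radial_field :: "complex ^ 'n \<Rightarrow> complex ^ 'n" where
  "radial_field x = x"

(* The 1-form i_R \<sigma>, evaluated at the point x on the tangent vector v.
   Sections of the twisted cotangent sheaf \<Omega>^1(2) are homogeneous 1-forms on
   the affine cone that annihilate the radial field. *)
definition contact_form :: "complex ^ 'n ^ 'n \<Rightarrow> complex ^ 'n::finite \<Rightarrow> complex ^ 'n \<Rightarrow> complex" where
  "contact_form lam x v = two_form lam (radial_field x) v"

(* \<Union>\<Lambda> is the affine cone over \<Lambda>; for \<Lambda> = Proj W it is the linear space W, which
   is also its own tangent space at each point. So this says that the pull-back
   of the contact form to \<Lambda> vanishes identically. *)
definition involutive :: "complex ^ 'n ^ 'n \<Rightarrow> (complex ^ 'n::finite) set set \<Rightarrow> bool" where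
  "involutive lam \<Lambda> \<longleftrightarrow> (\<forall>x\<in>\<Union>\<Lambda>. \<forall>v\<in>\<Union>\<Lambda>. contact_form lam x v = 0)"

definition disjoint_involutive_planes ::
    "complex ^ 'n ^ 'n \<Rightarrow> nat \<Rightarrow> (complex ^ 'n::finite) set set \<Rightarrow> (complex ^ 'n) set set set \<Rightarrow> bool" where
  "disjoint_involutive_planes lam m X S \<longleftrightarrow>
     (\<forall>\<Lambda>\<in>S. m_plane m \<Lambda> \<and> involutive lam \<Lambda> \<and> \<Lambda> \<subseteq> X) \<and> pairwise disjnt S"

end

theory Submission
  imports Defs "HOL-Complex_Analysis.Conformal_Mappings"
begin

text \<open>
The bound is a count of fixed points. Let \<open>F\<close> be the equation of the hypersurface, \<open>e = d - 1\<close>,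
\<open>n = m + 1\<close>, and let \<open>H\<close> be the Hamiltonian vector field of \<open>F\<close>, so that \<open>\<sigma>(H(x), v) = dF(x)(v)\<close>. The
components of \<open>H\<close> are forms of degree \<open>e\<close>, and smoothness says that they have no common zero
besides the origin. If the cone \<open>L\<close> over an involutive plane lies in \<open>{F = 0}\<close>, then \<open>dF(x)\<close>
vanishes on \<open>L\<close> for every \<open>x\<close> in \<open>L\<close>, so \<open>H(x)\<close> is \<open>\<sigma>\<close>-orthogonal to \<open>L\<close> and lies in \<open>L\<close>, because \<open>L\<close> is
Lagrangian (\<open>lagrangian_maximal\<close>). Hence \<open>H\<close> restricts to all these cones. With multiplicity, the
equation \<open>H(x) = x\<close> has \<open>e\<^sup>2\<^sup>n\<close> solutions in the whole space and \<open>e\<^sup>n\<close> solutions in each \<open>L\<close>; the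
origin is a simple solution. The cones over disjoint planes meet in the origin only, so \<open>k\<close> of them
satisfy \<open>1 + k (e\<^sup>n - 1) \<le> e\<^sup>2\<^sup>n\<close>, that is \<open>k \<le> e\<^sup>n + 1\<close>.

The difficulty is that solutions may be multiple, that the invariant spaces do not survive a
perturbation of \<open>F\<close>, and that a solution in \<open>L\<close> has two multiplicities, of which the one in \<open>L\<close> has to
be the smaller. The proof works with the proper polynomial map \<open>G(x) = H(x) - x\<close>. Its critical values
lie in a proper algebraic hypersurface (\<open>discriminant_exists\<close>), which does not disconnect complex
space, so all regular values have the same number of preimages (\<open>card_fibre_constant\<close>); a homotopy
from \<open>H\<close> to the map that raises each coordinate to the power \<open>e\<close> shows that the number is \<open>e\<close> to the
dimension of the space (\<open>fixed_point_count\<close>). For a linear form \<open>f\<close>, the polynomial with the roots \<open>f(x)\<close>,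
where \<open>x\<close> runs over the fibre of \<open>G\<close> above \<open>c\<close>, extends continuously from regular values \<open>c\<close> to all small
\<open>c\<close>, and keeps its degree and its roots (\<open>characteristic_polynomials\<close>). On the other hand, each \<open>L\<close>
contains arbitrarily small \<open>c\<close> above which \<open>L\<close> alone contains \<open>e\<^sup>n\<close> points
(\<open>invariant_subspace_count\<close>). As \<open>c\<close> tends to 0, these points tend to fixed points in \<open>L\<close>, and each
limit contributes its multiplicity in \<open>L\<close> to the root \<open>f(x)\<close> of the polynomial at \<open>c = 0\<close>. Choosing \<open>f\<close>
injective on all the points involved and adding up gives \<open>invariant_subspaces_bound\<close>.

For sharpness, the surface \<open>A\<^sup>e B + B\<^sup>e C + C\<^sup>e D + D\<^sup>e A = 0\<close>, studied by Rams, contains for each of the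
\<open>e\<^sup>2 + 1\<close> numbers \<open>\<alpha>\<close> with \<open>\<alpha> ^ (e\<^sup>2 + 1) = (-1) ^ d\<close> the line \<open>C = \<alpha> A\<close>, \<open>D = - B / \<alpha>\<^sup>e\<close>. These lines are pairwise
skew, and they are isotropic for \<open>dA \<and> dC + dB \<and> dD\<close>, since \<open>A\<close> and \<open>C\<close> are proportional on each
of them, and so are \<open>B\<close> and \<open>D\<close>. By \<open>darboux_basis\<close>, every symplectic form on a four-dimensional
space has this shape in suitable coordinates.
\<close>

(* In this text the dollar sign selects vector components. *)
no_notation fps_nth (infixl "$" 75)

section \<open>Underdetermined linear systems\<close>

text \<open>More unknowns than equations, on arbitrary finite index sets: the proof is Gaussian elimination of one equation and one unknown.\<close>
lemma underdetermined_system: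
  fixes m :: "'b \<Rightarrow> 'a \<Rightarrow> 'f::field"
  assumes "finite A" "finite B" "card A < card B"
  shows "\<exists>y. (\<exists>b\<in>B. y b \<noteq> 0) \<and> (\<forall>a\<in>A. (\<Sum>b\<in>B. y b * m b a) = 0)"
  using assms
proof (induction A arbitrary: B m rule: finite_induct)
  case empty
  then have "B \<noteq> {}" by auto
  then show ?case by (intro exI[of _ "\<lambda>_. 1"]) auto
next
  case (insert a A)
  show ?case
  proof (cases "\<forall>b\<in>B. m b a = 0")
    case True
    obtain y where "\<exists>b\<in>B. y b \<noteq> 0" "\<forall>a\<in>A. (\<Sum>b\<in>B. y b * m b a) = 0"
      using insert.IH[of B m] insert.prems insert.hyps by auto
    then show ?thesis using True by (intro exI[of _ y]) auto
  next
    case False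
    then obtain b0 where b0: "b0 \<in> B" "m b0 a \<noteq> 0" by blast
    define B' where "B' = B - {b0}"
    define m' where "m' = (\<lambda>b a'. m b a' - m b a / m b0 a * m b0 a')"
    have B: "B = insert b0 B'" "b0 \<notin> B'" "finite B'"
      using b0 insert.prems by (auto simp: B'_def)
    have "card A < card B'" using insert.prems insert.hyps B by auto
    from insert.IH[OF B(3) this, of m'] obtain y' where
      y': "\<exists>b\<in>B'. y' b \<noteq> 0" "\<forall>a\<in>A. (\<Sum>b\<in>B'. y' b * m' b a) = 0" by blast
    define y where "y = y'(b0 := - (\<Sum>b\<in>B'. y' b * (m b a / m b0 a)))"
    have sum: "(\<Sum>b\<in>B. y b * m b c) = (\<Sum>b\<in>B'. y' b * m' b c)" for c
    proof -
      have "(\<Sum>b\<in>B. y b * m b c) = y b0 * m b0 c + (\<Sum>b\<in>B'. y b * m b c)"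
        using B by simp
      also have "(\<Sum>b\<in>B'. y b * m b c) = (\<Sum>b\<in>B'. y' b * m b c)"
        using B by (intro sum.cong) (auto simp: y_def)
      finally show ?thesis
        by (simp add: y_def m'_def right_diff_distrib sum_subtractf sum_distrib_right mult.assoc)
    qed
    have "m' b a = 0" for b using b0 by (simp add: m'_def)
    then have "\<forall>c\<in>insert a A. (\<Sum>b\<in>B. y b * m b c) = 0"
      unfolding sum using y'(2) by simp
    moreover have "\<exists>b\<in>B. y b \<noteq> 0" using y'(1) B by (auto simp: y_def)
    ultimately show ?thesis by blast
  qed
qed

section \<open>Polynomial functions and polynomial maps\<close>

inductive polyfun :: "(complex ^ 'k \<Rightarrow> complex) \<Rightarrow> bool" where
  polyfun_const: "polyfun (\<lambda>x. c)"
| polyfun_coord: "polyfun (\<lambda>x. x $ i)"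
| polyfun_add: "polyfun f \<Longrightarrow> polyfun g \<Longrightarrow> polyfun (\<lambda>x. f x + g x)"
| polyfun_mult: "polyfun f \<Longrightarrow> polyfun g \<Longrightarrow> polyfun (\<lambda>x. f x * g x)"

named_theorems polyfun_intros
declare polyfun_const [polyfun_intros] polyfun_coord [polyfun_intros]
  polyfun_add [polyfun_intros] polyfun_mult [polyfun_intros]

lemma polyfun_uminus [polyfun_intros]: "polyfun f \<Longrightarrow> polyfun (\<lambda>x. - f x)"
  using polyfun_mult[OF polyfun_const[of "-1"]] by simp

lemma polyfun_diff [polyfun_intros]:
  "polyfun f \<Longrightarrow> polyfun g \<Longrightarrow> polyfun (\<lambda>x. f x - g x)"
  using polyfun_add[OF _ polyfun_uminus] by simp

lemma polyfun_sum [polyfun_intros]: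
  "(\<And>i. i \<in> I \<Longrightarrow> polyfun (f i)) \<Longrightarrow> polyfun (\<lambda>x. \<Sum>i\<in>I. f i x)"
  by (induction I rule: infinite_finite_induct) (auto intro: polyfun_intros)

lemma polyfun_prod [polyfun_intros]:
  "(\<And>i. i \<in> I \<Longrightarrow> polyfun (f i)) \<Longrightarrow> polyfun (\<lambda>x. \<Prod>i\<in>I. f i x)"
  by (induction I rule: infinite_finite_induct) (auto intro: polyfun_intros)

lemma polyfun_power [polyfun_intros]: "polyfun f \<Longrightarrow> polyfun (\<lambda>x. f x ^ n)"
  by (induction n) (auto intro: polyfun_intros)

lemma polyfun_compose:
  assumes "polyfun f" "\<And>i. polyfun (\<lambda>x. g x $ i)"
  shows "polyfun (\<lambda>x. f (g x))"
  using assms(1) by induction (auto intro: polyfun_intros assms(2))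

lemma polyfun_det:
  fixes A :: "complex ^ 'k \<Rightarrow> complex ^ 'k ^ 'k::finite"
  assumes "\<And>i j. polyfun (\<lambda>x. A x $ i $ j)"
  shows "polyfun (\<lambda>x. det (A x))"
  unfolding det_def by (intro polyfun_intros assms)

lemma polyfun_continuous [continuous_intros]: "polyfun f \<Longrightarrow> continuous_on S f"
  by (induction rule: polyfun.induct) (auto intro!: continuous_intros)

lemma polyfun_on_line:
  assumes "polyfun f"
  shows "\<exists>q. \<forall>t. f (a + t *s b) = poly q t"
  using assms
proof induction
  case (polyfun_const c)
  then show ?case by (intro exI[of _ "[:c:]"]) auto
next
  case (polyfun_coord i)
  then show ?case by (intro exI[of _ "[:a $ i, b $ i:]"]) auto
next
  case (polyfun_add f g)
  then show ?case by (metis poly_add)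
next
  case (polyfun_mult f g)
  then show ?case by (metis poly_mult)
qed

lemma polyfun_line_zeros_finite:
  assumes "polyfun f" "f (a + t0 *s b) \<noteq> 0"
  shows "finite {t. f (a + t *s b) = 0}"
proof -
  obtain q where q: "\<And>t. f (a + t *s b) = poly q t" using polyfun_on_line[OF assms(1)] by blast
  then have "q \<noteq> 0" using assms(2) by auto
  then show ?thesis unfolding q by (rule poly_roots_finite)
qed

lemma line_tendsto:
  fixes a b :: "complex ^ 'k::finite"
  shows "((\<lambda>t. a + t *s b) \<longlongrightarrow> a + t0 *s b) (at t0)"
  by (intro vec_tendstoI) (auto intro!: tendsto_intros)

text \<open>On the complex line through the given point and a point where the polynomial does not vanish, it has finitely many zeros.\<close>
lemma polyfun_nonzero_near:
  fixes f :: "complex ^ 'k::finite \<Rightarrow> complex"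
  assumes "polyfun f" "f x0 \<noteq> 0" "open U" "x \<in> U"
  shows "\<exists>y\<in>U. f y \<noteq> 0"
proof -
  define b where "b = x0 - x"
  have fin: "finite {t. f (x + t *s b) = 0}"
    using assms(1,2) by (intro polyfun_line_zeros_finite[of f x 1]) (auto simp: b_def)
  have "\<forall>\<^sub>F t in at 0. x + t *s b \<in> U"
    using topological_tendstoD[OF line_tendsto[of x b 0] assms(3)] assms(4) by simp
  moreover have "\<forall>\<^sub>F t in at 0. f (x + t *s b) \<noteq> 0"
    using islimpt_finite[OF fin, of 0] by (simp add: islimpt_iff_eventually)
  ultimately have "\<forall>\<^sub>F t in at 0. x + t *s b \<in> U \<and> f (x + t *s b) \<noteq> 0"
    by (rule eventually_conj)
  then have "\<exists>t. x + t *s b \<in> U \<and> f (x + t *s b) \<noteq> 0"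
    using eventually_happens at_neq_bot by blast
  then show ?thesis by blast
qed

lemma polyfun_has_derivative:
  fixes f :: "complex ^ 'k::finite \<Rightarrow> complex"
  assumes "polyfun f"
  shows "\<exists>D. (\<forall>i. polyfun (D i)) \<and> (\<forall>x. (f has_derivative (\<lambda>h. \<Sum>i\<in>UNIV. D i x * h $ i)) (at x))"
  using assms
proof induction
  case (polyfun_const c)
  show ?case by (intro exI[of _ "\<lambda>_ _. 0"]) (auto intro: polyfun_intros)
next
  case (polyfun_coord j)
  have "((\<lambda>x. x $ j) has_derivative (\<lambda>h. h $ j)) (at x)" for x :: "complex ^ 'k"
    by (rule bounded_linear.has_derivative[OF bounded_linear_vec_nth]) simp
  moreover have "(\<Sum>i\<in>UNIV. (if i = j then 1 else 0) * h $ i) = h $ j" for h :: "complex ^ 'k"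
    by (simp add: if_distrib[of "\<lambda>x. x * _"] cong: if_cong)
  ultimately show ?case
    by (intro exI[of _ "\<lambda>i _. if i = j then 1 else 0"]) (auto intro: polyfun_intros)
next
  case (polyfun_add f g)
  then obtain D E where
    "\<And>i. polyfun (D i)" "\<And>x. (f has_derivative (\<lambda>h. \<Sum>i\<in>UNIV. D i x * h $ i)) (at x)"
    "\<And>i. polyfun (E i)" "\<And>x. (g has_derivative (\<lambda>h. \<Sum>i\<in>UNIV. E i x * h $ i)) (at x)"
    by blast
  then show ?case
    by (intro exI[of _ "\<lambda>i x. D i x + E i x"])
      (auto intro!: polyfun_intros derivative_eq_intros simp: ring_distribs sum.distrib)
next
  case (polyfun_mult f g)
  then obtain D E where DE:
    "\<And>i. polyfun (D i)" "\<And>x. (f has_derivative (\<lambda>h. \<Sum>i\<in>UNIV. D i x * h $ i)) (at x)"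
    "\<And>i. polyfun (E i)" "\<And>x. (g has_derivative (\<lambda>h. \<Sum>i\<in>UNIV. E i x * h $ i)) (at x)"
    by blast
  then show ?case using polyfun_mult.hyps
    by (intro exI[of _ "\<lambda>i x. f x * E i x + D i x * g x"])
      (auto intro!: polyfun_intros has_derivative_mult[THEN has_derivative_eq_rhs]
         simp: ring_distribs sum.distrib sum_distrib_left sum_distrib_right mult_ac)
qed

lemma has_derivative_vecI:
  fixes f :: "'a::real_normed_vector \<Rightarrow> 'b::euclidean_space ^ 'k::finite"
  assumes "\<And>i. ((\<lambda>x. f x $ i) has_derivative (\<lambda>h. f' h $ i)) (at x)"
  shows "(f has_derivative f') (at x)"
  by (subst has_derivative_componentwise_within)
     (auto simp: Basis_vec_def inner_axis intro!: derivative_eq_intros assms)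

lemma line_has_derivative:
  fixes x v :: "complex ^ 'k::finite"
  shows "((\<lambda>t. x + t *s v) has_derivative (\<lambda>\<tau>. \<tau> *s v)) (at t0)"
  by (rule has_derivative_vecI) (auto intro!: derivative_eq_intros)

text \<open>\<open>A x\<close> is the Jacobian matrix of \<open>G\<close> at \<open>x\<close>. Its entries are required to be polynomial functions, so
that the Jacobian determinant is one.\<close>
definition polymap :: "(complex ^ 'k::finite \<Rightarrow> complex ^ 'k) \<Rightarrow> (complex ^ 'k \<Rightarrow> complex ^ 'k ^ 'k) \<Rightarrow> bool" where
  "polymap G A \<longleftrightarrow> (\<forall>i. polyfun (\<lambda>x. G x $ i)) \<and> (\<forall>i j. polyfun (\<lambda>x. A x $ i $ j)) \<and>
     (\<forall>x. (G has_derivative (\<lambda>h. A x *v h)) (at x))"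

lemma polymap_exists:
  fixes G :: "complex ^ 'k::finite \<Rightarrow> complex ^ 'k"
  assumes "\<And>i. polyfun (\<lambda>x. G x $ i)"
  shows "\<exists>A. polymap G A"
proof -
  obtain D where D: "\<And>j i. polyfun (D j i)"
     "\<And>j x. ((\<lambda>x. G x $ j) has_derivative (\<lambda>h. \<Sum>i\<in>UNIV. D j i x * h $ i)) (at x)"
    using polyfun_has_derivative[OF assms] by metis
  define A where "A = (\<lambda>x. \<chi> j i. D j i x)"
  have "(G has_derivative (\<lambda>h. A x *v h)) (at x)" for x
    by (rule has_derivative_vecI) (use D in \<open>auto simp: A_def matrix_vector_mult_def\<close>)
  then show ?thesis using assms D(1) unfolding polymap_def
    by (intro exI[of _ A]) (auto simp: A_def)
qed

lemma polymap_continuous: "polymap G A \<Longrightarrow> continuous_on S G"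
  by (rule has_derivative_continuous_on[of S G "\<lambda>x h. A x *v h"])
     (auto simp: polymap_def intro: has_derivative_at_withinI)

definition regular_value ::
    "(complex ^ 'k::finite \<Rightarrow> complex ^ 'k) \<Rightarrow> (complex ^ 'k \<Rightarrow> complex ^ 'k ^ 'k) \<Rightarrow> complex ^ 'k \<Rightarrow> bool" where
  "regular_value G A c \<longleftrightarrow> (\<forall>x. G x = c \<longrightarrow> det (A x) \<noteq> 0)"

section \<open>The discriminant hypersurface of a polynomial map\<close>

definition box_exps :: "nat \<Rightarrow> ('k \<Rightarrow> nat) set" where
  "box_exps D = {\<alpha>. \<forall>i. \<alpha> i \<le> D}"

definition monom_fun :: "('k \<Rightarrow> nat) \<Rightarrow> complex ^ 'k::finite \<Rightarrow> complex" where
  "monom_fun \<alpha> x = (\<Prod>i\<in>UNIV. (x $ i) ^ \<alpha> i)"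

lemma box_exps_PiE: "box_exps D = PiE UNIV (\<lambda>_. {..D})"
  by (auto simp: box_exps_def PiE_UNIV_domain)

lemma finite_box_exps [simp]: "finite (box_exps D :: ('k::finite \<Rightarrow> nat) set)"
  unfolding box_exps_PiE by (intro finite_PiE) auto

lemma card_box_exps: "card (box_exps D :: ('k::finite \<Rightarrow> nat) set) = (D + 1) ^ CARD('k)"
  unfolding box_exps_PiE by (subst card_PiE) auto

lemma monom_fun_add: "monom_fun (\<lambda>i. \<alpha> i + \<beta> i) x = monom_fun \<alpha> x * monom_fun \<beta> x"
  by (simp add: monom_fun_def power_add prod.distrib)

lemma polyfun_monom_fun [polyfun_intros]: "polyfun (monom_fun \<alpha>)"
  unfolding monom_fun_def by (intro polyfun_intros)

text \<open>The degree is bounded in each variable separately; the exponents then form a box, which is easy to count.\<close>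
definition poly_degree_le :: "nat \<Rightarrow> (complex ^ 'k::finite \<Rightarrow> complex) \<Rightarrow> bool" where
  "poly_degree_le D f \<longleftrightarrow> (\<exists>a. \<forall>x. f x = (\<Sum>\<alpha>\<in>box_exps D. a \<alpha> * monom_fun \<alpha> x))"

lemma poly_degree_leI:
  "(\<And>x. f x = (\<Sum>\<alpha>\<in>box_exps D. a \<alpha> * monom_fun \<alpha> x)) \<Longrightarrow> poly_degree_le D f"
  unfolding poly_degree_le_def by blast

lemma poly_degree_le_mono:
  assumes "poly_degree_le D f" "D \<le> D'"
  shows "poly_degree_le D' f"
proof -
  obtain a where a: "\<And>x. f x = (\<Sum>\<alpha>\<in>box_exps D. a \<alpha> * monom_fun \<alpha> x)"
    using assms(1) by (auto simp: poly_degree_le_def)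
  have sub: "box_exps D \<subseteq> box_exps D'"
    using assms(2) by (auto simp: box_exps_def intro: order_trans)
  have "f x = (\<Sum>\<alpha>\<in>box_exps D'. (if \<alpha> \<in> box_exps D then a \<alpha> else 0) * monom_fun \<alpha> x)" for x
    unfolding a by (rule sum.mono_neutral_cong_left[OF _ sub]) auto
  then show ?thesis by (rule poly_degree_leI)
qed

lemma poly_degree_le_const: "poly_degree_le 0 (\<lambda>x. c)"
proof -
  have "box_exps 0 = {\<lambda>_::'a. 0}" by (auto simp: box_exps_def)
  then show ?thesis
    unfolding poly_degree_le_def by (intro exI[of _ "\<lambda>_. c"]) (auto simp: monom_fun_def)
qed

lemma poly_degree_le_coord: "poly_degree_le 1 (\<lambda>x. x $ i)"
proof -
  define \<epsilon> where "\<epsilon> = (\<lambda>j. if j = i then 1 else 0 :: nat)"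
  have mem: "\<epsilon> \<in> box_exps 1" by (auto simp: box_exps_def \<epsilon>_def)
  have "x $ i = (\<Sum>\<alpha>\<in>box_exps 1. (if \<alpha> = \<epsilon> then 1 else 0) * monom_fun \<alpha> x)"
    for x :: "complex ^ 'a"
  proof -
    have "(\<Sum>\<alpha>\<in>box_exps 1. (if \<alpha> = \<epsilon> then 1 else 0) * monom_fun \<alpha> x)
        = (\<Sum>\<alpha>\<in>box_exps 1. if \<alpha> = \<epsilon> then monom_fun \<epsilon> x else 0)"
      by (intro sum.cong) auto
    also have "\<dots> = monom_fun \<epsilon> x" using mem by simp
    also have "\<dots> = (\<Prod>j\<in>UNIV. if j = i then x $ i else 1)"
      unfolding monom_fun_def by (intro prod.cong) (auto simp: \<epsilon>_def)
    finally show ?thesis by simp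
  qed
  then show ?thesis by (rule poly_degree_leI)
qed

lemma poly_degree_le_add:
  assumes "poly_degree_le D f" "poly_degree_le D g"
  shows "poly_degree_le D (\<lambda>x. f x + g x)"
proof -
  obtain a b where "\<And>x. f x = (\<Sum>\<alpha>\<in>box_exps D. a \<alpha> * monom_fun \<alpha> x)"
    "\<And>x. g x = (\<Sum>\<alpha>\<in>box_exps D. b \<alpha> * monom_fun \<alpha> x)"
    using assms by (auto simp: poly_degree_le_def)
  then show ?thesis unfolding poly_degree_le_def
    by (intro exI[of _ "\<lambda>\<alpha>. a \<alpha> + b \<alpha>"]) (simp add: ring_distribs sum.distrib)
qed

lemma poly_degree_le_mult:
  fixes f g :: "complex ^ 'k::finite \<Rightarrow> complex"
  assumes "poly_degree_le D f" "poly_degree_le E g"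
  shows "poly_degree_le (D + E) (\<lambda>x. f x * g x)"
proof -
  obtain a b where ab: "\<And>x. f x = (\<Sum>\<alpha>\<in>box_exps D. a \<alpha> * monom_fun \<alpha> x)"
    "\<And>x. g x = (\<Sum>\<alpha>\<in>box_exps E. b \<alpha> * monom_fun \<alpha> x)"
    using assms by (auto simp: poly_degree_le_def)
  define S :: "(('k \<Rightarrow> nat) \<times> ('k \<Rightarrow> nat)) set" where "S = box_exps D \<times> box_exps E"
  define s :: "('k \<Rightarrow> nat) \<times> ('k \<Rightarrow> nat) \<Rightarrow> 'k \<Rightarrow> nat" where "s = (\<lambda>(\<alpha>,\<beta>). \<lambda>i. \<alpha> i + \<beta> i)"
  define c where "c = (\<lambda>\<gamma>. \<Sum>p\<in>{p\<in>S. s p = \<gamma>}. a (fst p) * b (snd p))"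
  have "f x * g x = (\<Sum>\<gamma>\<in>box_exps (D + E). c \<gamma> * monom_fun \<gamma> x)" for x
  proof -
    have "f x * g x = (\<Sum>p\<in>S. a (fst p) * b (snd p) * monom_fun (s p) x)"
      by (simp add: ab S_def s_def sum_product sum.cartesian_product monom_fun_add split_def mult_ac)
    also have "\<dots> = (\<Sum>\<gamma>\<in>box_exps (D + E). \<Sum>p\<in>{p\<in>S. s p = \<gamma>}.
                      a (fst p) * b (snd p) * monom_fun (s p) x)"
    proof (rule sum.group[symmetric])
      show "s ` S \<subseteq> box_exps (D + E)"
        by (auto simp: S_def s_def box_exps_def intro: add_mono)
    qed (simp_all add: S_def)
    also have "\<dots> = (\<Sum>\<gamma>\<in>box_exps (D + E). c \<gamma> * monom_fun \<gamma> x)"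
      by (intro sum.cong refl) (simp add: c_def sum_distrib_right)
    finally show ?thesis .
  qed
  then show ?thesis by (rule poly_degree_leI)
qed

lemma poly_degree_le_prod:
  assumes "finite I" "\<And>i. i \<in> I \<Longrightarrow> poly_degree_le D (f i)"
  shows "poly_degree_le (D * card I) (\<lambda>x. \<Prod>i\<in>I. f i x)"
  using assms
proof (induction I rule: finite_induct)
  case empty
  then show ?case by (simp add: poly_degree_le_const)
next
  case (insert i I)
  then show ?case using poly_degree_le_mult[of D "f i" "D * card I" "\<lambda>x. \<Prod>i\<in>I. f i x"] by simp
qed

lemma polyfun_degree: 
  assumes "polyfun f" shows "\<exists>D. poly_degree_le D f"
  using assms
proof induction
  case (polyfun_add f g)
  then obtain D E where "poly_degree_le D f" "poly_degree_le E g" by blast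
  then have "poly_degree_le (max D E) (\<lambda>x. f x + g x)"
    by (intro poly_degree_le_add) (auto elim: poly_degree_le_mono)
  then show ?case by blast
qed (blast intro: poly_degree_le_const poly_degree_le_coord poly_degree_le_mult)+

text \<open>There is one polynomial more than there are variables. With \<open>M = CARD('k)\<close>, products of the \<open>g i\<close> with exponents at most \<open>s\<close> are
about \<open>s\<close> to the power \<open>M + 1\<close> many, but they lie in a space of dimension about a constant times \<open>s\<close> to
the power \<open>M\<close>. In place of monomials in the \<open>g i\<close> the lemma uses the numerators of the Lagrange
interpolation polynomials on the grid of points with coordinates 0, ..., \<open>s\<close>. A combination of these
with a nonzero coefficient is visibly a nonzero polynomial, since it can be evaluated at a grid point.\<close>
lemma algebraic_dependence_count:
  fixes g :: "'k::finite option \<Rightarrow> complex ^ 'k \<Rightarrow> complex"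
  assumes "\<And>i. polyfun (g i)"
  shows "\<exists>s y. (\<exists>\<beta>\<in>box_exps s. y \<beta> \<noteq> 0) \<and>
     (\<forall>x. (\<Sum>\<beta>\<in>box_exps s. y \<beta> * (\<Prod>i\<in>UNIV. \<Prod>m\<in>{..s} - {\<beta> i}. g i x - of_nat m)) = 0)"
proof -
  obtain D' where D': "\<And>i. poly_degree_le (D' i) (g i)" using polyfun_degree[OF assms] by metis
  define D where "D = Max (range D')"
  have D: "poly_degree_le D (g i)" for i
    by (rule poly_degree_le_mono[OF D']) (simp add: D_def)
  define M where "M = CARD('k)"
  \<comment> \<open>large enough for the count \<open>(D s (M + 1) + 1) ^ M < (s + 1) ^ (M + 1)\<close>\<close>
  define s where "s = (D * (M + 1) + 1) ^ M"
  define u where "u = (\<lambda>\<beta> x. \<Prod>i\<in>UNIV. \<Prod>m\<in>{..s} - {\<beta> i}. g i x - of_nat m)"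
  have u: "poly_degree_le (D * s * (M + 1)) (u \<beta>)" if "\<beta> \<in> box_exps s" for \<beta>
  proof -
    have *: "poly_degree_le (D * s) (\<lambda>x. \<Prod>m\<in>{..s} - {\<beta> i}. g i x - of_nat m)" for i
    proof -
      have "poly_degree_le (D * card ({..s} - {\<beta> i})) (\<lambda>x. \<Prod>m\<in>{..s} - {\<beta> i}. g i x + (- of_nat m))"
        by (intro poly_degree_le_prod poly_degree_le_add D)
           (auto intro: poly_degree_le_mono[OF poly_degree_le_const])
      moreover have "card ({..s} - {\<beta> i}) = s" using that by (simp add: box_exps_def)
      ultimately show ?thesis by simp
    qed
    have "poly_degree_le (D * s * card (UNIV :: 'k option set)) (u \<beta>)"
      unfolding u_def by (intro poly_degree_le_prod *) auto
    then show ?thesis by (simp add: M_def)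
  qed
  then have "\<forall>\<beta>\<in>box_exps s. \<exists>a. \<forall>x. u \<beta> x = (\<Sum>\<alpha>\<in>box_exps (D * s * (M + 1)). a \<alpha> * monom_fun \<alpha> x)"
    unfolding poly_degree_le_def by blast
  then obtain m where m: "\<And>\<beta> x. \<beta> \<in> box_exps s \<Longrightarrow>
      u \<beta> x = (\<Sum>\<alpha>\<in>box_exps (D * s * (M + 1)). m \<beta> \<alpha> * monom_fun \<alpha> x)" by metis
  have "card (box_exps (D * s * (M + 1)) :: ('k \<Rightarrow> nat) set) = (D * s * (M + 1) + 1) ^ M"
    by (simp add: card_box_exps M_def)
  also have "\<dots> \<le> ((D * (M + 1) + 1) * (s + 1)) ^ M"
    by (intro power_mono) (auto simp: algebra_simps)
  also have "\<dots> = s * (s + 1) ^ M" unfolding power_mult_distrib by (simp only: s_def[symmetric])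
  also have "\<dots> < (s + 1) ^ (M + 1)" by simp
  also have "\<dots> = card (box_exps s :: ('k option \<Rightarrow> nat) set)" by (simp add: card_box_exps M_def)
  finally obtain y where y: "\<exists>\<beta>\<in>box_exps s. y \<beta> \<noteq> 0"
    "\<And>\<alpha>. \<alpha> \<in> box_exps (D * s * (M + 1)) \<Longrightarrow> (\<Sum>\<beta>\<in>box_exps s. y \<beta> * m \<beta> \<alpha>) = 0"
    using underdetermined_system[of "box_exps (D * s * (M + 1))" "box_exps s" m] by auto
  have "(\<Sum>\<beta>\<in>box_exps s. y \<beta> * u \<beta> x) = 0" for x
  proof -
    have "(\<Sum>\<beta>\<in>box_exps s. y \<beta> * u \<beta> x)
       = (\<Sum>\<beta>\<in>box_exps s. \<Sum>\<alpha>\<in>box_exps (D * s * (M + 1)). y \<beta> * m \<beta> \<alpha> * monom_fun \<alpha> x)"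
      by (intro sum.cong refl) (simp add: m sum_distrib_left mult.assoc)
    also have "\<dots> = (\<Sum>\<alpha>\<in>box_exps (D * s * (M + 1)). (\<Sum>\<beta>\<in>box_exps s. y \<beta> * m \<beta> \<alpha>) * monom_fun \<alpha> x)"
      by (subst sum.swap) (simp add: sum_distrib_right)
    also have "\<dots> = 0" using y(2) by simp
    finally show ?thesis .
  qed
  then show ?thesis using y(1) unfolding u_def by blast
qed

text \<open>The preceding relation, sorted by powers of the last polynomial.\<close>
lemma algebraic_dependence:
  fixes G :: "complex ^ 'k::finite \<Rightarrow> complex ^ 'k" and J :: "complex ^ 'k \<Rightarrow> complex"
  assumes "\<And>i. polyfun (\<lambda>x. G x $ i)" "polyfun J"
  shows "\<exists>q (d::nat). (\<forall>l. polyfun (q l)) \<and> (\<exists>l\<le>d. \<exists>c. q l c \<noteq> 0) \<and>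
     (\<forall>x. (\<Sum>l\<le>d. q l (G x) * J x ^ l) = 0)"
proof -
  define g where "g = (\<lambda>i x. case i of None \<Rightarrow> J x | Some i \<Rightarrow> G x $ i)"
  have "polyfun (g i)" for i using assms by (cases i) (auto simp: g_def)
  then obtain s y where y: "\<exists>\<beta>\<in>box_exps s. y \<beta> \<noteq> 0"
    "\<And>x. (\<Sum>\<beta>\<in>box_exps s. y \<beta> * (\<Prod>i\<in>UNIV. \<Prod>m\<in>{..s} - {\<beta> i}. g i x - of_nat m)) = 0"
    using algebraic_dependence_count[of g] by blast
  \<comment> \<open>the same relation as a polynomial in the last variable\<close>
  define \<Phi> where "\<Phi> = (\<lambda>\<beta> c. \<Prod>i\<in>(UNIV::'k set). \<Prod>m\<in>{..s} - {\<beta> (Some i)}. c $ i - complex_of_nat m)"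
  define \<Lambda> where "\<Lambda> = (\<lambda>j. \<Prod>m\<in>{..s} - {j}. [:- complex_of_nat m, 1:])"
  define Q where "Q = (\<lambda>c. \<Sum>\<beta>\<in>box_exps s. smult (y \<beta> * \<Phi> \<beta> c) (\<Lambda> (\<beta> None)))"
  define q where "q = (\<lambda>l c. coeff (Q c) l)"
  define d where "d = s"
  have \<Lambda>: "poly (\<Lambda> j) z = (\<Prod>m\<in>{..s} - {j}. z - of_nat m)" for j z
    by (simp add: \<Lambda>_def poly_prod)
  have deg: "degree (Q c) \<le> d" for c
  proof -
    have "degree (\<Lambda> (\<beta> None)) \<le> d" if "\<beta> \<in> box_exps s" for \<beta> :: "'k option \<Rightarrow> nat"
    proof -
      have "degree (\<Lambda> (\<beta> None)) \<le> (\<Sum>m\<in>{..s} - {\<beta> None}. degree [:- complex_of_nat m, 1:])"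
        unfolding \<Lambda>_def by (rule order_trans[OF degree_prod_sum_le]) auto
      also have "\<dots> = s" using that by (simp add: box_exps_def)
      finally show ?thesis by (simp add: d_def)
    qed
    then show ?thesis unfolding Q_def
      by (intro degree_sum_le) (auto intro: order_trans[OF degree_smult_le])
  qed
  have Q: "poly (Q c) z = (\<Sum>\<beta>\<in>box_exps s. y \<beta> * \<Phi> \<beta> c * (\<Prod>m\<in>{..s} - {\<beta> None}. z - of_nat m))" for c z
    by (simp add: Q_def poly_sum \<Lambda>)
  have split: "(\<Prod>i\<in>UNIV. h i) = h None * (\<Prod>i\<in>UNIV. h (Some i))" for h :: "'k option \<Rightarrow> complex"
    by (simp add: UNIV_option_conv prod.reindex)
  have root: "poly (Q (G x)) (J x) = 0" for x
    using y(2)[of x] by (simp add: Q split g_def \<Phi>_def mult_ac)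
  then have rel: "(\<Sum>l\<le>d. q l (G x) * J x ^ l) = 0" for x
  proof -
    have "(\<Sum>l\<le>d. q l (G x) * J x ^ l) = (\<Sum>l\<le>degree (Q (G x)). q l (G x) * J x ^ l)"
      by (rule sum.mono_neutral_right) (use deg in \<open>auto simp: q_def coeff_eq_0\<close>)
    also have "\<dots> = poly (Q (G x)) (J x)" by (simp add: poly_altdef q_def)
    finally show ?thesis using root by simp
  qed
  have "polyfun (q l)" for l
    unfolding q_def Q_def coeff_sum coeff_smult \<Phi>_def by (intro polyfun_intros)
  moreover have "\<exists>l\<le>d. \<exists>c. q l c \<noteq> 0"
  proof -
    obtain \<beta>0 where \<beta>0: "\<beta>0 \<in> box_exps s" "y \<beta>0 \<noteq> 0" using y(1) by blast
    \<comment> \<open>evaluating at a grid point isolates one coefficient\<close>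
    define c where "c = (\<chi> i. complex_of_nat (\<beta>0 (Some i)))"
    have vanish: "\<Phi> \<beta> c * (\<Prod>m\<in>{..s} - {\<beta> None}. of_nat (\<beta>0 None) - complex_of_nat m) = 0"
      if neq: "\<beta> \<noteq> \<beta>0" for \<beta>
    proof -
      have "(\<Prod>m\<in>{..s} - {k}. of_nat l - complex_of_nat m) = 0" if "l \<noteq> k" "l \<le> s" for l k
        using that by (intro prod_zero) auto
      moreover obtain j where "\<beta>0 j \<noteq> \<beta> j" using neq by (metis ext)
      moreover have "\<beta>0 j \<le> s" for j using \<beta>0 by (simp add: box_exps_def)
      ultimately show ?thesis
        by (cases j) (auto simp: \<Phi>_def c_def)
    qed
    have "poly (Q c) (of_nat (\<beta>0 None)) =
       y \<beta>0 * (\<Phi> \<beta>0 c * (\<Prod>m\<in>{..s} - {\<beta>0 None}. of_nat (\<beta>0 None) - of_nat m))"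
    proof -
      have "poly (Q c) (of_nat (\<beta>0 None)) = (\<Sum>\<beta>\<in>box_exps s. if \<beta> = \<beta>0 then
       y \<beta>0 * (\<Phi> \<beta>0 c * (\<Prod>m\<in>{..s} - {\<beta>0 None}. of_nat (\<beta>0 None) - of_nat m)) else 0)"
        unfolding Q mult.assoc by (intro sum.cong refl) (use vanish in auto)
      then show ?thesis using \<beta>0 by simp
    qed
    also have "\<dots> \<noteq> 0" using \<beta>0(2) by (auto simp: \<Phi>_def c_def)
    finally have "Q c \<noteq> 0" by auto
    then have "q (degree (Q c)) c \<noteq> 0" by (simp add: q_def)
    then show ?thesis using deg by blast
  qed
  ultimately show ?thesis using rel by blast
qed

lemma invertible_iff_ker:
  fixes A :: "complex ^ 'k ^ 'k::finite"
  shows "det A \<noteq> 0 \<longleftrightarrow> (\<forall>h. A *v h = 0 \<longrightarrow> h = 0)"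
  by (metis invertible_det_nz invertible_left_inverse matrix_left_invertible_ker)

text \<open>Where the Jacobian determinant does not vanish the map is open, so its image lies in no hypersurface.\<close>
lemma polymap_image_nonzero:
  assumes G: "polymap G A" "det (A x0) \<noteq> 0" and q: "polyfun q" "q c \<noteq> 0"
  shows "\<exists>x. q (G x) \<noteq> 0"
proof -
  obtain B where B: "A x0 ** B = mat 1"
    using G(2) by (meson invertible_det_nz invertible_right_inverse)
  have "G x0 \<in> interior (G ` UNIV)"
  proof (rule sussmann_open_mapping[of UNIV G x0 "\<lambda>h. A x0 *v h" "\<lambda>h. B *v h" UNIV])
    show "continuous_on UNIV G"
      using G(1) has_derivative_continuous_on[of UNIV G "\<lambda>x h. A x *v h"] by (auto simp: polymap_def)
    show "(G has_derivative (*v) (A x0)) (at x0)" using G(1) by (simp add: polymap_def)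
    show "(*v) (A x0) \<circ> (*v) B = id"
      by (auto simp: fun_eq_iff matrix_vector_mul_assoc B)
  qed auto
  then show ?thesis
    using polyfun_nonzero_near[OF q, of "interior (range G)" "G x0"] interior_subset by blast
qed

text \<open>Critical values satisfy a polynomial equation. The Jacobian determinant \<open>J\<close> is algebraic over the
components of \<open>G\<close>. In a relation \<open>\<Sum> q l (G x) * J x ^ l = 0\<close> drop the terms that vanish identically
and divide by the lowest remaining power of \<open>J\<close>; at a point with \<open>J x = 0\<close> only one term of the quotient
is left, and it is a polynomial in the value \<open>G x\<close>.\<close>
lemma discriminant_exists:
  assumes G: "polymap G A" "det (A x0) \<noteq> 0"
  obtains p x1 where "polyfun p" "p (G x1) \<noteq> 0" "\<And>c. p c \<noteq> 0 \<Longrightarrow> regular_value G A c"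
proof -
  define J where "J = (\<lambda>x. det (A x))"
  have J: "polyfun J" unfolding J_def using G(1) by (intro polyfun_det) (auto simp: polymap_def)
  have Gi: "polyfun (\<lambda>x. G x $ i)" for i using G(1) by (auto simp: polymap_def)
  obtain q d where q: "\<And>l. polyfun (q l)" "\<exists>l\<le>d. \<exists>c. q l c \<noteq> 0"
     "\<And>x. (\<Sum>l\<le>d. q l (G x) * J x ^ l) = 0"
    using algebraic_dependence[OF Gi J] by metis
  define P where "P = (\<lambda>l. l \<le> d \<and> (\<exists>x. q l (G x) \<noteq> 0))"
  have ex: "\<exists>l. P l" unfolding P_def using q(1,2) polymap_image_nonzero[OF G] by blast
  define l0 where "l0 = (LEAST l. P l)"
  have l0: "P l0" unfolding l0_def using ex by (rule LeastI_ex)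
  have less: "q l (G x) = 0" if "l < l0" for l x
    using not_less_Least[of l P] that l0 by (auto simp: l0_def P_def)
  define R where "R = (\<lambda>x. \<Sum>l\<le>d - l0. q (l + l0) (G x) * J x ^ l)"
  have polR: "polyfun R" unfolding R_def by (intro polyfun_intros J polyfun_compose[OF q(1)] Gi)
  have JR: "J x ^ l0 * R x = 0" for x
  proof -
    have "J x ^ l0 * R x = (\<Sum>l\<in>{..d - l0}. q (l + l0) (G x) * J x ^ (l + l0))"
      by (simp add: R_def sum_distrib_left power_add mult_ac)
    also have "\<dots> = (\<Sum>l\<in>{l0..d}. q l (G x) * J x ^ l)"
      using l0 by (intro sum.reindex_bij_witness[of _ "\<lambda>l. l - l0" "\<lambda>l. l + l0"]) (auto simp: P_def)
    also have "\<dots> = (\<Sum>l\<le>d. q l (G x) * J x ^ l)"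
      by (rule sum.mono_neutral_left) (auto simp: less)
    finally show ?thesis using q(3) by simp
  qed
  have R0: "R x = 0" for x
  proof (rule ccontr)
    assume "R x \<noteq> 0"
    moreover have "open {x. R x \<noteq> 0}"
      using polyfun_continuous[OF polR, of UNIV] by (simp add: open_Collect_neq)
    ultimately obtain y where "R y \<noteq> 0" "J y \<noteq> 0"
      using polyfun_nonzero_near[OF J, of x0 "{x. R x \<noteq> 0}" x] G(2) by (auto simp: J_def)
    with JR[of y] show False by simp
  qed
  have "q l0 (G x) = 0" if "det (A x) = 0" for x
  proof -
    have "R x = (\<Sum>l\<le>d - l0. if l = 0 then q l0 (G x) else 0)"
      unfolding R_def using that by (intro sum.cong) (auto simp: J_def)
    then show ?thesis using R0[of x] by simp
  qed
  then have "regular_value G A c" if "q l0 c \<noteq> 0" for c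
    using that unfolding regular_value_def by blast
  moreover obtain x1 where "q l0 (G x1) \<noteq> 0" using l0 by (auto simp: P_def)
  ultimately show thesis by (intro that[OF q(1)])
qed

lemma regular_values_dense:
  assumes G: "polymap G A" "det (A x0) \<noteq> 0" and U: "open U" "c \<in> U"
  obtains c' where "c' \<in> U" "regular_value G A c'"
proof -
  obtain p x1 where p: "polyfun p" "p (G x1) \<noteq> 0" "\<And>c. p c \<noteq> 0 \<Longrightarrow> regular_value G A c"
    using discriminant_exists[OF G] by blast
  show thesis using polyfun_nonzero_near[OF p(1,2) U] p(3) that by blast
qed

section \<open>Fibres over regular values\<close>

lemma finite_separated:
  fixes F :: "'a::metric_space set"
  assumes "finite F"
  obtains \<delta> where "\<delta> > 0" "\<And>x y. x \<in> F \<Longrightarrow> y \<in> F \<Longrightarrow> x \<noteq> y \<Longrightarrow> \<delta> \<le> dist x y"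
proof -
  have "\<forall>x. \<exists>d>0. \<forall>y\<in>F. y \<noteq> x \<longrightarrow> d \<le> dist x y"
    using finite_set_avoid[OF assms] by blast
  then obtain d where d: "\<And>x. d x > 0" "\<And>x y. y \<in> F \<Longrightarrow> y \<noteq> x \<Longrightarrow> d x \<le> dist x y" by metis
  define \<delta> where "\<delta> = Min (insert 1 (d ` F))"
  have "\<delta> > 0" using assms d(1) by (auto simp: \<delta>_def)
  moreover have "\<delta> \<le> d x" if "x \<in> F" for x using that assms by (auto simp: \<delta>_def)
  ultimately show ?thesis using d(2) by (intro that[of \<delta>]) (auto, metis order_trans)
qed

lemma local_homeomorphism:
  fixes \<Phi> :: "'a::euclidean_space \<Rightarrow> 'a"
  assumes der: "\<And>x. (\<Phi> has_derivative \<Phi>' x) (at x)"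
    and cont: "\<And>v. continuous_on UNIV (\<lambda>x. \<Phi>' x v)" and inj: "inj (\<Phi>' x)"
  obtains U V g where "open U" "x \<in> U" "open V" "homeomorphism U V \<Phi> g"
proof -
  have blin: "bounded_linear (\<Phi>' x)" for x using der by (rule has_derivative_bounded_linear)
  then have "linear (\<Phi>' x)" by (rule bounded_linear.linear)
  then obtain h where h: "linear h" "h \<circ> \<Phi>' x = id" using inj linear_injective_left_inverse by blast
  have comp: "Blinfun h o\<^sub>L Blinfun (\<Phi>' x) = id_blinfun"
    using h(2) by (intro blinfun_eqI)
      (use linear_conv_bounded_linear[of h] in \<open>simp add: bounded_linear_Blinfun_apply h(1) blin fun_eq_iff\<close>)
  have contB: "continuous_on UNIV (\<lambda>x. Blinfun (\<Phi>' x))"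
    by (rule continuous_on_blinfun_componentwise) (simp add: bounded_linear_Blinfun_apply blin cont)
  have derB: "(\<Phi> has_derivative blinfun_apply (Blinfun (\<Phi>' x))) (at x)" for x
    by (simp add: bounded_linear_Blinfun_apply blin der)
  show thesis
  proof (rule inverse_function_theorem[OF open_UNIV derB contB UNIV_I comp])
    fix U V g g'
    assume "open U" "x \<in> U" "open V" "homeomorphism U V \<Phi> g"
    then show thesis by (rule that)
  qed
qed

text \<open>Near each of the finitely many points of the fibre, \<open>\<Phi>\<close> has a local inverse; by properness, points
over nearby values cannot appear anywhere else. The functions \<open>g x\<close> are the local inverses.\<close>
lemma fibre_locally_constant:
  fixes \<Phi> :: "'a::euclidean_space \<Rightarrow> 'a"
  assumes der: "\<And>x. (\<Phi> has_derivative \<Phi>' x) (at x)"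
    and cont: "\<And>v. continuous_on UNIV (\<lambda>x. \<Phi>' x v)"
    and \<epsilon>0: "\<epsilon>0 > 0" "bounded {x. dist (\<Phi> x) b0 \<le> \<epsilon>0}"
    and reg: "\<And>x. \<Phi> x = b0 \<Longrightarrow> inj (\<Phi>' x)"
  shows "finite {x. \<Phi> x = b0}"
    and "\<exists>\<epsilon>>0. \<exists>g. (\<forall>x. \<Phi> x = b0 \<longrightarrow> g x b0 = x \<and> continuous_on (ball b0 \<epsilon>) (g x)) \<and>
           (\<forall>b\<in>ball b0 \<epsilon>. inj_on (\<lambda>x. g x b) {x. \<Phi> x = b0} \<and>
               {x. \<Phi> x = b} = (\<lambda>x. g x b) ` {x. \<Phi> x = b0})"
proof -
  define F where "F = {x. \<Phi> x = b0}"
  have contPhi: "continuous_on S \<Phi>" for S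
    using has_derivative_continuous_on[of S \<Phi> \<Phi>'] der has_derivative_at_withinI by blast
  have "\<exists>U V g. open U \<and> x \<in> U \<and> open V \<and> homeomorphism U V \<Phi> g" if "x \<in> F" for x
  proof -
    have "inj (\<Phi>' x)" using that reg by (auto simp: F_def)
    then show ?thesis by (rule local_homeomorphism[OF der cont]) blast
  qed
  then obtain U V g where UVg: "\<And>x. x \<in> F \<Longrightarrow> open (U x)" "\<And>x. x \<in> F \<Longrightarrow> x \<in> U x"
    "\<And>x. x \<in> F \<Longrightarrow> open (V x)" "\<And>x. x \<in> F \<Longrightarrow> homeomorphism (U x) (V x) \<Phi> (g x)" by metis
  have inv: "g x (\<Phi> y) = y" if "x \<in> F" "y \<in> U x" for x y
    using UVg(4)[OF that(1)] that(2) by (auto simp: homeomorphism_def)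
  have "closed (\<Phi> -` {b0})" using contPhi[of UNIV] by (rule closed_vimage[OF closed_singleton])
  then have "closed F" unfolding F_def vimage_def by simp
  moreover have "bounded F" by (rule bounded_subset[OF \<epsilon>0(2)]) (use \<epsilon>0(1) in \<open>simp add: F_def subset_iff\<close>)
  ultimately have "compact F" by (simp add: compact_eq_bounded_closed)
  then obtain T where T: "T \<subseteq> F" "finite T" "F \<subseteq> (\<Union>x\<in>T. U x)"
    using compactE_image[of F F U] UVg(1,2) by blast
  have "F \<subseteq> T"
  proof
    fix y assume y: "y \<in> F"
    then obtain x where x: "x \<in> T" "y \<in> U x" using T by blast
    have "x \<in> F" using x(1) T(1) by blast
    then have "g x (\<Phi> y) = y" "g x (\<Phi> x) = x" using inv x(2) UVg(2) by simp_all
    moreover have "\<Phi> y = \<Phi> x" using x(1) y T(1) unfolding F_def by auto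
    ultimately have "y = x" by metis
    then show "y \<in> T" using x(1) by blast
  qed
  then have fin: "finite F" using T finite_subset by blast
  then show "finite {x. \<Phi> x = b0}" by (simp add: F_def)
  obtain \<delta> where \<delta>: "\<delta> > 0" "\<And>x y. x \<in> F \<Longrightarrow> y \<in> F \<Longrightarrow> x \<noteq> y \<Longrightarrow> \<delta> \<le> dist x y"
    using finite_separated[OF fin] by blast
  define W where "W = (\<lambda>x. ball x (\<delta>/2) \<inter> U x)"
  have W: "open (W x)" "x \<in> W x" "W x \<subseteq> U x" if "x \<in> F" for x
    using UVg(1,2)[OF that] \<delta>(1) by (simp_all add: W_def open_Int)
  have Wdisj: "x = y" if "x \<in> F" "y \<in> F" "z \<in> W x" "z \<in> W y" for x y z
  proof (rule ccontr)
    assume "x \<noteq> y"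
    then have "\<delta> \<le> dist x y" using \<delta>(2) that by blast
    moreover have "dist x z < \<delta>/2" "dist y z < \<delta>/2" using that by (auto simp: W_def)
    ultimately show False using dist_triangle2[of x y z] by linarith
  qed
  have PhiW: "open (\<Phi> ` W x)" if "x \<in> F" for x
  proof -
    have "openin (top_of_set (V x)) (\<Phi> ` W x)"
      by (rule homeomorphism_imp_open_map[OF UVg(4)[OF that]])
         (use W[OF that] UVg(1)[OF that] in \<open>simp add: openin_open_eq\<close>)
    then show ?thesis using UVg(3)[OF that] openin_open_eq by blast
  qed
  have "open (\<Inter>x\<in>F. \<Phi> ` W x)" using fin PhiW by (rule open_INT[OF _ ballI])
  moreover have "b0 \<in> (\<Inter>x\<in>F. \<Phi> ` W x)" 
  proof
    fix x assume "x \<in> F"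
    then show "b0 \<in> \<Phi> ` W x" using W(2)[of x] by (simp add: F_def rev_image_eqI)
  qed
  ultimately obtain \<epsilon>1 where \<epsilon>1: "\<epsilon>1 > 0" "ball b0 \<epsilon>1 \<subseteq> (\<Inter>x\<in>F. \<Phi> ` W x)"
    by (rule openE)
  define K where "K = {x. dist (\<Phi> x) b0 \<le> \<epsilon>0} - (\<Union>x\<in>F. W x)"
  have "closed (\<Phi> -` cball b0 \<epsilon>0)" using contPhi[of UNIV] by (rule closed_vimage[OF closed_cball])
  then have "closed {x. dist (\<Phi> x) b0 \<le> \<epsilon>0}" unfolding vimage_def by (simp add: dist_commute)
  then have "compact {x. dist (\<Phi> x) b0 \<le> \<epsilon>0}" using \<epsilon>0 by (simp add: compact_eq_bounded_closed)
  then have "compact K" unfolding K_def using W(1) by (intro compact_diff) auto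
  have "\<exists>\<epsilon>2>0. \<forall>x\<in>K. dist (\<Phi> x) b0 \<ge> \<epsilon>2"
  proof (cases "K = {}")
    case False
    have "continuous_on K (\<lambda>x. dist (\<Phi> x) b0)" by (rule continuous_on_dist[OF contPhi continuous_on_const])
    then obtain x where x: "x \<in> K" "\<forall>y\<in>K. dist (\<Phi> x) b0 \<le> dist (\<Phi> y) b0"
      using continuous_attains_inf[OF \<open>compact K\<close> False] by blast
    have "x \<notin> F" using x(1) W(2) unfolding K_def by blast
    then have "dist (\<Phi> x) b0 > 0" by (simp add: F_def)
    then show ?thesis using x(2) by blast
  next
    case True
    then show ?thesis by (intro exI[of _ 1]) simp
  qed
  then obtain \<epsilon>2 where \<epsilon>2: "\<epsilon>2 > 0" "\<And>x. x \<in> K \<Longrightarrow> dist (\<Phi> x) b0 \<ge> \<epsilon>2" by blast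
  define \<epsilon> where "\<epsilon> = min \<epsilon>0 (min \<epsilon>1 \<epsilon>2)"
  have near: "\<exists>x\<in>F. y \<in> W x" if "dist (\<Phi> y) b0 < \<epsilon>" for y
    using that \<epsilon>2(2)[of y] by (force simp: K_def \<epsilon>_def)
  have gW: "g x b \<in> W x \<and> \<Phi> (g x b) = b" if "b \<in> ball b0 \<epsilon>" "x \<in> F" for x b
  proof -
    have "b \<in> \<Phi> ` W x" using that \<epsilon>1(2) by (auto simp: \<epsilon>_def)
    then obtain w where w: "w \<in> W x" "b = \<Phi> w" by blast
    then have "g x b = w" using inv[of x w] W(3)[of x] that(2) by auto
    then show ?thesis using w by simp
  qed
  have "\<epsilon> > 0" using \<epsilon>0 \<epsilon>1 \<epsilon>2 by (simp add: \<epsilon>_def)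
  moreover have "g x b0 = x" if "\<Phi> x = b0" for x
    using inv[of x x] that UVg(2) by (auto simp: F_def)
  moreover have "continuous_on (ball b0 \<epsilon>) (g x)" if "x \<in> F" for x
  proof (rule continuous_on_subset)
    show "continuous_on (V x) (g x)" using UVg(4)[OF that] by (simp add: homeomorphism_def)
    have "\<Phi> ` W x \<subseteq> V x" using UVg(4)[OF that] W(3)[OF that] by (auto simp: homeomorphism_def)
    moreover have "ball b0 \<epsilon> \<subseteq> \<Phi> ` W x" using \<epsilon>1(2) that by (auto simp: \<epsilon>_def)
    ultimately show "ball b0 \<epsilon> \<subseteq> V x" by blast
  qed
  moreover have "inj_on (\<lambda>x. g x b) F" if "b \<in> ball b0 \<epsilon>" for b
  proof (rule inj_onI)
    fix x y assume "x \<in> F" "y \<in> F" "g x b = g y b"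
    then show "x = y" using gW[OF that, of x] gW[OF that, of y] Wdisj[of x y "g x b"] by simp
  qed
  moreover have "{x. \<Phi> x = b} = (\<lambda>x. g x b) ` F" if b: "b \<in> ball b0 \<epsilon>" for b
  proof (intro equalityI subsetI)
    fix y assume y: "y \<in> {x. \<Phi> x = b}"
    then obtain x where "x \<in> F" "y \<in> W x" using near[of y] b by (auto simp: dist_commute)
    then have "g x (\<Phi> y) = y" using inv[of x y] W(3)[of x] by blast
    then have "y = g x b" using y by simp
    then show "y \<in> (\<lambda>x. g x b) ` F" using \<open>x \<in> F\<close> by blast
  qed (use gW[OF b] in auto)
  ultimately have "\<epsilon> > 0 \<and> (\<forall>x. \<Phi> x = b0 \<longrightarrow> g x b0 = x \<and> continuous_on (ball b0 \<epsilon>) (g x)) \<and>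
           (\<forall>b\<in>ball b0 \<epsilon>. inj_on (\<lambda>x. g x b) F \<and> {x. \<Phi> x = b} = (\<lambda>x. g x b) ` F)"
    unfolding F_def mem_Collect_eq by (intro conjI ballI allI impI)
  then show "\<exists>\<epsilon>>0. \<exists>g. (\<forall>x. \<Phi> x = b0 \<longrightarrow> g x b0 = x \<and> continuous_on (ball b0 \<epsilon>) (g x)) \<and>
           (\<forall>b\<in>ball b0 \<epsilon>. inj_on (\<lambda>x. g x b) {x. \<Phi> x = b0} \<and>
               {x. \<Phi> x = b} = (\<lambda>x. g x b) ` {x. \<Phi> x = b0})"
    unfolding F_def by blast
qed

lemma polymap_jacobian:
  assumes "polymap G A"
  shows "(G has_derivative (*v) (A x)) (at x)" "continuous_on UNIV (\<lambda>x. A x *v v)"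
    "det (A x) \<noteq> 0 \<Longrightarrow> inj ((*v) (A x))"
proof -
  show "(G has_derivative (*v) (A x)) (at x)" using assms by (simp add: polymap_def)
  show "continuous_on UNIV (\<lambda>x. A x *v v)"
    unfolding matrix_vector_mult_def using assms
    by (intro continuous_on_vec_lambda polyfun_continuous polyfun_intros) (simp add: polymap_def)
  show "inj ((*v) (A x))" if "det (A x) \<noteq> 0"
    using that unfolding invertible_iff_ker by (simp only: vec.inj_iff_eq_0)
qed

lemma polymap_sections:
  assumes G: "polymap G A" and proper: "\<And>R. bounded {x. norm (G x) \<le> R}" and reg: "regular_value G A c"
  shows "finite {x. G x = c}"
    and "\<exists>\<epsilon>>0. \<exists>g. (\<forall>x. G x = c \<longrightarrow> g x c = x \<and> continuous_on (ball c \<epsilon>) (g x)) \<and>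
           (\<forall>b\<in>ball c \<epsilon>. inj_on (\<lambda>x. g x b) {x. G x = c} \<and>
               {x. G x = b} = (\<lambda>x. g x b) ` {x. G x = c})"
proof -
  note 1 = polymap_jacobian(1)[OF G] and 2 = polymap_jacobian(2)[OF G]
  have "bounded {x. dist (G x) c \<le> 1}"
  proof (rule bounded_subset[OF proper[of "1 + norm c"]], intro subsetI CollectI, unfold mem_Collect_eq)
    fix x assume "dist (G x) c \<le> 1"
    then show "norm (G x) \<le> 1 + norm c"
      using norm_triangle_sub[of "G x" c] by (simp add: dist_norm)
  qed
  note 3 = this
  have "inj ((*v) (A x))" if "G x = c" for x
    using reg that polymap_jacobian(3)[OF G] unfolding regular_value_def by blast
  note 4 = this
  show "finite {x. G x = c}" by (rule fibre_locally_constant(1)[OF 1 2 _ 3 4]) simp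
  show "\<exists>\<epsilon>>0. \<exists>g. (\<forall>x. G x = c \<longrightarrow> g x c = x \<and> continuous_on (ball c \<epsilon>) (g x)) \<and>
           (\<forall>b\<in>ball c \<epsilon>. inj_on (\<lambda>x. g x b) {x. G x = c} \<and>
               {x. G x = b} = (\<lambda>x. g x b) ` {x. G x = c})"
    by (rule fibre_locally_constant(2)[OF 1 2 _ 3 4]) simp
qed

lemma polymap_card_locally_constant:
  assumes G: "polymap G A" and proper: "\<And>R. bounded {x. norm (G x) \<le> R}" and reg: "regular_value G A c"
  obtains \<epsilon> where "\<epsilon> > 0" "\<And>b. b \<in> ball c \<epsilon> \<Longrightarrow> card {x. G x = b} = card {x. G x = c}"
proof -
  obtain \<epsilon> g where "\<epsilon> > 0" "\<And>b. b \<in> ball c \<epsilon> \<Longrightarrow> inj_on (\<lambda>x. g x b) {x. G x = c} \<and>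
               {x. G x = b} = (\<lambda>x. g x b) ` {x. G x = c}"
    using polymap_sections(2)[OF assms] by blast
  then have "card {x. G x = b} = card {x. G x = c}" if "b \<in> ball c \<epsilon>" for b
    using that card_image[of "\<lambda>x. g x b" "{x. G x = c}"] by presburger
  with \<open>\<epsilon> > 0\<close> show thesis by (rule that)
qed

text \<open>Two values off the discriminant hypersurface are joined by a complex line that meets the
hypersurface in finitely many points. The plane minus finitely many points is connected, and the
number of preimages is locally constant. A regular value on the discriminant hypersurface has
neighbours off it.\<close>
lemma card_fibre_constant:
  assumes G: "polymap G A" "det (A x0) \<noteq> 0" and proper: "\<And>R. bounded {x. norm (G x) \<le> R}"
  shows "\<exists>r. \<forall>c. regular_value G A c \<longrightarrow> card {x. G x = c} = r"
proof -
  obtain p x1 where p: "polyfun p" "p (G x1) \<noteq> 0" and reg: "\<And>c. p c \<noteq> 0 \<Longrightarrow> regular_value G A c"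
    using discriminant_exists[OF G] by blast
  note loc = polymap_card_locally_constant[OF G(1) proper]
  have eq: "card {x. G x = a} = card {x. G x = b}" if ab: "p a \<noteq> 0" "p b \<noteq> 0" for a b
  proof -
    define l where "l = (\<lambda>t. a + t *s (b - a))"
    define Z where "Z = {t. p (l t) = 0}"
    have "finite Z" unfolding Z_def l_def
      by (rule polyfun_line_zeros_finite[OF p(1), of a 0]) (use ab in simp)
    have l: "l 0 = a" "l 1 = b" by (auto simp: l_def)
    have lc: "continuous_on UNIV l"
      unfolding l_def continuous_on_def using line_tendsto by blast
    have "(\<lambda>t. card {x. G x = l t}) constant_on (UNIV - Z)"
    proof (rule locally_constant_imp_constant)
      show "connected (UNIV - Z)"
        using \<open>finite Z\<close> by (intro connected_open_diff_countable) (auto simp: countable_finite)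
      fix t assume t: "t \<in> UNIV - Z"
      then have "regular_value G A (l t)" using reg by (simp add: Z_def)
      then obtain \<epsilon> where \<epsilon>: "\<epsilon> > 0" "\<And>c. c \<in> ball (l t) \<epsilon> \<Longrightarrow> card {x. G x = c} = card {x. G x = l t}"
        by (rule loc) blast
      have "open (l -` ball (l t) \<epsilon>)" using lc by (simp add: continuous_on_open_vimage)
      then show "\<exists>T. openin (top_of_set (UNIV - Z)) T \<and> t \<in> T \<and>
           (\<forall>x\<in>T. card {y. G y = l x} = card {y. G y = l t})"
        using t \<epsilon>(1) by (intro exI[of _ "(UNIV - Z) \<inter> (l -` ball (l t) \<epsilon>)"] conjI ballI \<epsilon>(2))
          (simp_all add: openin_open_Int)
    qed
    moreover have "0 \<in> UNIV - Z" "1 \<in> UNIV - Z" using ab l by (auto simp: Z_def)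
    ultimately show ?thesis using l unfolding constant_on_def by metis
  qed
  have "card {x. G x = c} = card {x. G x = G x1}" if c: "regular_value G A c" for c
  proof -
    obtain \<epsilon> where \<epsilon>: "\<epsilon> > 0" "\<And>b. b \<in> ball c \<epsilon> \<Longrightarrow> card {x. G x = b} = card {x. G x = c}"
      by (rule loc[OF c]) blast
    obtain b where "b \<in> ball c \<epsilon>" "p b \<noteq> 0"
      using polyfun_nonzero_near[OF p(1,2), of "ball c \<epsilon>" c] \<epsilon>(1) by auto
    then show ?thesis using \<epsilon>(2) eq[OF _ p(2)] by metis
  qed
  then show ?thesis by blast
qed

lemma local_injectivity:
  assumes G: "polymap G A" "det (A x0) \<noteq> 0"
  obtains U where "open U" "x0 \<in> U" "inj_on G U"
proof (rule local_homeomorphism[OF polymap_jacobian(1,2)[OF G(1)] polymap_jacobian(3)[OF G]])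
  fix U V g
  assume "open U" "x0 \<in> U" and hom: "homeomorphism U V G g"
  moreover have "inj_on G U" using hom unfolding homeomorphism_def by (metis inj_on_inverseI)
  ultimately show thesis by (intro that)
qed

section \<open>Homogeneous maps and their degenerations\<close>

lemma norm_vector_smult: "norm (c *s x) = norm c * norm (x :: complex ^ 'k::finite)"
  by (simp add: norm_vec_def norm_mult L2_set_right_distrib)

definition deg_exps :: "nat \<Rightarrow> ('k::finite \<Rightarrow> nat) set" where
  "deg_exps e = {\<alpha>. (\<Sum>i\<in>UNIV. \<alpha> i) = e}"

lemma finite_deg_exps [simp]: "finite (deg_exps e :: ('k::finite \<Rightarrow> nat) set)"
proof (rule finite_subset[OF _ finite_box_exps[of e]], rule subsetI)
  fix \<alpha> :: "'k \<Rightarrow> nat" assume "\<alpha> \<in> deg_exps e"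
  then show "\<alpha> \<in> box_exps e"
    using member_le_sum[of _ UNIV \<alpha>] by (auto simp: deg_exps_def box_exps_def)
qed

lemma monom_fun_smult: "monom_fun \<alpha> (t *s x) = t ^ (\<Sum>i\<in>UNIV. \<alpha> i) * monom_fun \<alpha> x"
  by (simp add: monom_fun_def power_mult_distrib prod.distrib power_sum)

text \<open>Comparing the coefficients of \<open>t\<close> in \<open>f (t *s x)\<close> leaves only the monomials of degree \<open>e\<close>.\<close>
lemma homogeneous_expansion:
  fixes f :: "complex ^ 'k::finite \<Rightarrow> complex"
  assumes "polyfun f" and hom: "\<And>t x. f (t *s x) = t ^ e * f x"
  shows "\<exists>a. \<forall>x. f x = (\<Sum>\<alpha>\<in>deg_exps e. a \<alpha> * monom_fun \<alpha> x)"
proof -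
  obtain D where "poly_degree_le D f" using polyfun_degree[OF assms(1)] by blast
  then obtain a where a: "\<And>x. f x = (\<Sum>\<alpha>\<in>box_exps D. a \<alpha> * monom_fun \<alpha> x)"
    by (auto simp: poly_degree_le_def)
  have "f x = (\<Sum>\<alpha>\<in>deg_exps e. (if \<alpha> \<in> box_exps D then a \<alpha> else 0) * monom_fun \<alpha> x)" for x
  proof -
    define q where "q = (\<Sum>\<alpha>\<in>box_exps D. Polynomial.monom (a \<alpha> * monom_fun \<alpha> x) (\<Sum>i\<in>UNIV. \<alpha> i))"
    have "poly q t = poly (Polynomial.monom (f x) e) t" for t
    proof -
      have "poly q t = f (t *s x)"
        unfolding a q_def by (simp add: poly_sum poly_monom monom_fun_smult mult_ac)
      then show ?thesis by (simp add: hom poly_monom mult.commute)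
    qed
    then have "q = Polynomial.monom (f x) e" by (metis poly_eq_poly_eq_iff ext)
    then have "f x = coeff q e" by simp
    also have "\<dots> = (\<Sum>\<alpha>\<in>box_exps D. if \<alpha> \<in> deg_exps e then a \<alpha> * monom_fun \<alpha> x else 0)"
      unfolding q_def coeff_sum by (intro sum.cong) (auto simp: deg_exps_def)
    also have "\<dots> = (\<Sum>\<alpha>\<in>box_exps D \<inter> deg_exps e. a \<alpha> * monom_fun \<alpha> x)"
      by (simp add: sum.inter_restrict)
    also have "\<dots> = (\<Sum>\<alpha>\<in>deg_exps e. (if \<alpha> \<in> box_exps D then a \<alpha> else 0) * monom_fun \<alpha> x)"
      by (rule sum.mono_neutral_cong_left) auto
    finally show ?thesis .
  qed
  then show ?thesis by (intro exI allI)
qed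

text \<open>Eigenvectors for distinct eigenvalues are linearly independent.\<close>
lemma finite_eigenvalues:
  fixes M :: "'g \<Rightarrow> 'g \<Rightarrow> complex"
  assumes "finite \<Gamma>"
  shows "finite {\<kappa>. \<exists>v. (\<exists>\<gamma>\<in>\<Gamma>. v \<gamma> \<noteq> 0) \<and> (\<forall>\<gamma>\<in>\<Gamma>. (\<Sum>\<gamma>'\<in>\<Gamma>. M \<gamma> \<gamma>' * v \<gamma>') = \<kappa> * v \<gamma>)}"
    (is "finite ?E")
proof (rule ccontr)
  assume "infinite ?E"
  then obtain B where B: "B \<subseteq> ?E" "finite B" "card B = Suc (card \<Gamma>)"
    using infinite_arbitrarily_large by blast
  then have "\<forall>\<kappa>\<in>B. \<exists>v. (\<exists>\<gamma>\<in>\<Gamma>. v \<gamma> \<noteq> 0) \<and> (\<forall>\<gamma>\<in>\<Gamma>. (\<Sum>\<gamma>'\<in>\<Gamma>. M \<gamma> \<gamma>' * v \<gamma>') = \<kappa> * v \<gamma>)"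
    by blast
  from bchoice[OF this] obtain v where v': "\<forall>\<kappa>\<in>B. (\<exists>\<gamma>\<in>\<Gamma>. v \<kappa> \<gamma> \<noteq> 0) \<and>
      (\<forall>\<gamma>\<in>\<Gamma>. (\<Sum>\<gamma>'\<in>\<Gamma>. M \<gamma> \<gamma>' * v \<kappa> \<gamma>') = \<kappa> * v \<kappa> \<gamma>)"
    by (rule exE)
  have v: "\<exists>\<gamma>\<in>\<Gamma>. v \<kappa> \<gamma> \<noteq> 0"
    "\<gamma> \<in> \<Gamma> \<Longrightarrow> (\<Sum>\<gamma>'\<in>\<Gamma>. M \<gamma> \<gamma>' * v \<kappa> \<gamma>') = \<kappa> * v \<kappa> \<gamma>" if "\<kappa> \<in> B" for \<kappa> \<gamma>
    using v' that by simp_all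
  obtain y \<mu> where y: "\<mu> \<in> B" "y \<mu> \<noteq> 0" "\<And>\<gamma>. \<gamma> \<in> \<Gamma> \<Longrightarrow> (\<Sum>\<kappa>\<in>B. y \<kappa> * v \<kappa> \<gamma>) = 0"
    using underdetermined_system[OF assms B(2), of v] B(3) by auto
  have pow: "(\<Sum>\<kappa>\<in>B. y \<kappa> * \<kappa> ^ k * v \<kappa> \<gamma>) = 0" if "\<gamma> \<in> \<Gamma>" for k \<gamma>
    using that
  proof (induction k arbitrary: \<gamma>)
    case 0
    then show ?case using y(3) by simp
  next
    case (Suc k)
    have "(\<Sum>\<kappa>\<in>B. y \<kappa> * \<kappa> ^ Suc k * v \<kappa> \<gamma>)
        = (\<Sum>\<kappa>\<in>B. \<Sum>\<gamma>'\<in>\<Gamma>. M \<gamma> \<gamma>' * (y \<kappa> * \<kappa> ^ k * v \<kappa> \<gamma>'))"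
    proof (rule sum.cong[OF refl])
      fix \<kappa> assume "\<kappa> \<in> B"
      then have "y \<kappa> * \<kappa> ^ Suc k * v \<kappa> \<gamma> = y \<kappa> * \<kappa> ^ k * (\<Sum>\<gamma>'\<in>\<Gamma>. M \<gamma> \<gamma>' * v \<kappa> \<gamma>')"
        using v(2) Suc.prems by simp
      then show "y \<kappa> * \<kappa> ^ Suc k * v \<kappa> \<gamma> = (\<Sum>\<gamma>'\<in>\<Gamma>. M \<gamma> \<gamma>' * (y \<kappa> * \<kappa> ^ k * v \<kappa> \<gamma>'))"
        by (simp add: sum_distrib_left mult_ac)
    qed
    also have "\<dots> = (\<Sum>\<gamma>'\<in>\<Gamma>. M \<gamma> \<gamma>' * (\<Sum>\<kappa>\<in>B. y \<kappa> * \<kappa> ^ k * v \<kappa> \<gamma>'))"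
      by (subst sum.swap) (simp add: sum_distrib_left)
    also have "\<dots> = 0" using Suc.IH by simp
    finally show ?case .
  qed
  \<comment> \<open>a polynomial vanishing at all the other eigenvalues isolates one term\<close>
  define q where "q = (\<Prod>\<kappa>\<in>B - {\<mu>}. [:- \<kappa>, 1:])"
  have q: "poly q \<kappa> = (\<Prod>\<nu>\<in>B - {\<mu>}. \<kappa> - \<nu>)" for \<kappa>
    by (simp add: q_def poly_prod)
  have "(\<Sum>\<kappa>\<in>B. y \<kappa> * poly q \<kappa> * v \<kappa> \<gamma>) = 0" if "\<gamma> \<in> \<Gamma>" for \<gamma>
  proof -
    have "(\<Sum>\<kappa>\<in>B. y \<kappa> * poly q \<kappa> * v \<kappa> \<gamma>)
        = (\<Sum>\<kappa>\<in>B. \<Sum>k\<le>degree q. coeff q k * (y \<kappa> * \<kappa> ^ k * v \<kappa> \<gamma>))"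
      by (intro sum.cong refl) (simp add: poly_altdef sum_distrib_left sum_distrib_right mult_ac)
    also have "\<dots> = (\<Sum>k\<le>degree q. coeff q k * (\<Sum>\<kappa>\<in>B. y \<kappa> * \<kappa> ^ k * v \<kappa> \<gamma>))"
      by (subst sum.swap) (simp add: sum_distrib_left)
    also have "\<dots> = 0" using pow[OF that] by simp
    finally show ?thesis .
  qed
  moreover have "(\<Sum>\<kappa>\<in>B. y \<kappa> * poly q \<kappa> * v \<kappa> \<gamma>) = y \<mu> * poly q \<mu> * v \<mu> \<gamma>" for \<gamma>
  proof -
    have "poly q \<kappa> = 0" if "\<kappa> \<in> B - {\<mu>}" for \<kappa>
      unfolding q using that B(2) by (intro prod_zero) auto
    then have "(\<Sum>\<kappa>\<in>B. y \<kappa> * poly q \<kappa> * v \<kappa> \<gamma>)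
        = (\<Sum>\<kappa>\<in>B. if \<kappa> = \<mu> then y \<mu> * poly q \<mu> * v \<mu> \<gamma> else 0)"
      by (intro sum.cong) auto
    then show ?thesis using B(2) y(1) by simp
  qed
  moreover have "poly q \<mu> \<noteq> 0" unfolding q using B(2) by auto
  ultimately have "\<forall>\<gamma>\<in>\<Gamma>. v \<mu> \<gamma> = 0" using y(2) by auto
  then show False using v(1)[OF y(1)] by blast
qed

text \<open>Such maps are those that induce a morphism of projective space to itself.\<close>
definition nondegenerate_homogeneous :: "nat \<Rightarrow> (complex ^ 'k::finite \<Rightarrow> complex ^ 'k) \<Rightarrow> bool" where
  "nondegenerate_homogeneous e H \<longleftrightarrow> (\<forall>i. polyfun (\<lambda>x. H x $ i)) \<and> (\<forall>t x. H (t *s x) = t ^ e *s H x) \<and>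
     (\<forall>x. H x = 0 \<longrightarrow> x = 0)"

text \<open>In the pencil joining \<open>H\<close> to the power map, only finitely many members have a nontrivial common zero.
Every monomial of the large degree \<open>T\<close> is divisible by the \<open>e\<close>-th power of a variable. Multiplying the
equation that belongs to this variable by the cofactor expresses, at a common zero, \<open>s\<close> times the monomial
through monomials of the same degree: the vector of all these monomials is an eigenvector of a
matrix that does not depend on \<open>s\<close>, with eigenvalue \<open>s / (s - 1)\<close>.\<close>
lemma degenerate_parameters_finite:
  fixes H :: "complex ^ 'k::finite \<Rightarrow> complex ^ 'k"
  assumes H: "nondegenerate_homogeneous e H" and e: "e \<ge> 1"
  shows "finite {s. \<exists>x. x \<noteq> 0 \<and> (\<forall>i. (1 - s) * H x $ i + s * (x $ i) ^ e = 0)}" (is "finite ?Z")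
proof -
  have "\<exists>a. \<forall>x. H x $ i = (\<Sum>\<alpha>\<in>deg_exps e. a \<alpha> * monom_fun \<alpha> x)" for i
    by (rule homogeneous_expansion) (use H in \<open>auto simp: nondegenerate_homogeneous_def\<close>)
  then obtain h where h: "\<And>i x. H x $ i = (\<Sum>\<alpha>\<in>deg_exps e. h i \<alpha> * monom_fun \<alpha> x)" by metis
  \<comment> \<open>in this degree some exponent is at least \<open>e\<close>\<close>
  define T where "T = CARD('k) * e"
  define \<Gamma> where "\<Gamma> = (deg_exps T :: ('k \<Rightarrow> nat) set)"
  have "\<exists>i. e \<le> \<gamma> i" if "\<gamma> \<in> \<Gamma>" for \<gamma>
  proof (rule ccontr)
    assume "\<nexists>i. e \<le> \<gamma> i"
    then have "(\<Sum>i\<in>UNIV. \<gamma> i) < (\<Sum>i\<in>(UNIV::'k set). e)" by (intro sum_strict_mono) (auto simp: not_le)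
    then show False using that by (simp add: \<Gamma>_def deg_exps_def T_def)
  qed
  then obtain \<iota> where \<iota>: "\<And>\<gamma>. \<gamma> \<in> \<Gamma> \<Longrightarrow> e \<le> \<gamma> (\<iota> \<gamma>)" by metis
  define \<rho> where "\<rho> = (\<lambda>\<gamma> i. if i = \<iota> \<gamma> then \<gamma> i - e else \<gamma> i)"
  have \<rho>: "monom_fun \<gamma> x = (x $ \<iota> \<gamma>) ^ e * monom_fun (\<rho> \<gamma>) x" if "\<gamma> \<in> \<Gamma>" for \<gamma> x
  proof -
    have "monom_fun \<gamma> x = monom_fun (\<lambda>i. (if i = \<iota> \<gamma> then e else 0) + \<rho> \<gamma> i) x"
      using \<iota>[OF that] by (intro arg_cong[where f = "\<lambda>\<alpha>. monom_fun \<alpha> x"]) (auto simp: \<rho>_def)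
    also have "\<dots> = (\<Prod>i\<in>UNIV. if i = \<iota> \<gamma> then x $ \<iota> \<gamma> ^ e else 1) * monom_fun (\<rho> \<gamma>) x"
      unfolding monom_fun_add by (simp add: monom_fun_def if_distrib[of "power _"] cong: if_cong)
    finally show ?thesis by simp
  qed
  have \<rho>sum: "(\<Sum>i\<in>UNIV. \<rho> \<gamma> i) + e = T" if "\<gamma> \<in> \<Gamma>" for \<gamma>
  proof -
    have "(\<Sum>i\<in>UNIV. \<rho> \<gamma> i) + (\<Sum>i\<in>UNIV. if i = \<iota> \<gamma> then e else 0) = (\<Sum>i\<in>UNIV. \<gamma> i)"
      unfolding sum.distrib[symmetric] using \<iota>[OF that] by (intro sum.cong) (auto simp: \<rho>_def)
    then show ?thesis using that by (simp add: \<Gamma>_def deg_exps_def)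
  qed
  define M where "M = (\<lambda>\<gamma> \<gamma>'. \<Sum>\<alpha>\<in>{\<alpha>\<in>deg_exps e. (\<lambda>i. \<rho> \<gamma> i + \<alpha> i) = \<gamma>'}. h (\<iota> \<gamma>) \<alpha>)"
  have M: "monom_fun (\<rho> \<gamma>) x * H x $ \<iota> \<gamma> = (\<Sum>\<gamma>'\<in>\<Gamma>. M \<gamma> \<gamma>' * monom_fun \<gamma>' x)" if "\<gamma> \<in> \<Gamma>" for \<gamma> x
  proof -
    have "monom_fun (\<rho> \<gamma>) x * H x $ \<iota> \<gamma>
        = (\<Sum>\<alpha>\<in>deg_exps e. h (\<iota> \<gamma>) \<alpha> * monom_fun (\<lambda>i. \<rho> \<gamma> i + \<alpha> i) x)"
      by (simp add: h sum_distrib_left monom_fun_add mult_ac)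
    also have "\<dots> = (\<Sum>\<gamma>'\<in>\<Gamma>. \<Sum>\<alpha>\<in>{\<alpha>\<in>deg_exps e. (\<lambda>i. \<rho> \<gamma> i + \<alpha> i) = \<gamma>'}.
                      h (\<iota> \<gamma>) \<alpha> * monom_fun (\<lambda>i. \<rho> \<gamma> i + \<alpha> i) x)"
    proof (rule sum.group[symmetric])
      show "(\<lambda>\<alpha> i. \<rho> \<gamma> i + \<alpha> i) ` deg_exps e \<subseteq> \<Gamma>"
        using \<rho>sum[OF that] by (auto simp: \<Gamma>_def deg_exps_def sum.distrib)
    qed (simp_all add: \<Gamma>_def)
    also have "\<dots> = (\<Sum>\<gamma>'\<in>\<Gamma>. M \<gamma> \<gamma>' * monom_fun \<gamma>' x)"
      by (intro sum.cong refl) (simp add: M_def sum_distrib_right)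
    finally show ?thesis .
  qed
  define E where "E = {\<kappa>. \<exists>v. (\<exists>\<gamma>\<in>\<Gamma>. v \<gamma> \<noteq> 0) \<and> (\<forall>\<gamma>\<in>\<Gamma>. (\<Sum>\<gamma>'\<in>\<Gamma>. M \<gamma> \<gamma>' * v \<gamma>') = \<kappa> * v \<gamma>)}"
  have "finite E" unfolding E_def by (rule finite_eigenvalues) (simp add: \<Gamma>_def)
  moreover have "?Z \<subseteq> insert 1 ((\<lambda>\<kappa>. \<kappa> / (\<kappa> - 1)) ` E)"
  proof
    fix s assume "s \<in> ?Z"
    then obtain x where x: "x \<noteq> 0" "\<And>i. (1 - s) * H x $ i + s * (x $ i) ^ e = 0" by blast
    show "s \<in> insert 1 ((\<lambda>\<kappa>. \<kappa> / (\<kappa> - 1)) ` E)"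
    proof (cases "s = 1")
      case False
      define \<kappa> where "\<kappa> = s / (s - 1)"
      have "(\<Sum>\<gamma>'\<in>\<Gamma>. M \<gamma> \<gamma>' * monom_fun \<gamma>' x) = \<kappa> * monom_fun \<gamma> x" if "\<gamma> \<in> \<Gamma>" for \<gamma>
      proof -
        have "H x $ \<iota> \<gamma> = \<kappa> * (x $ \<iota> \<gamma>) ^ e"
          using x(2)[of "\<iota> \<gamma>"] False by(simp add: \<kappa>_def field_simps)
        then show ?thesis unfolding M[OF that, symmetric] \<rho>[OF that, of x] by simp
      qed
      moreover have "\<exists>\<gamma>\<in>\<Gamma>. monom_fun \<gamma> x \<noteq> 0"
      proof -
        obtain j where j: "x $ j \<noteq> 0" using x(1) by (auto simp: vec_eq_iff)
        then have "monom_fun (\<lambda>i. if i = j then T else 0) x \<noteq> 0" by (auto simp: monom_fun_def)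
        then show ?thesis by (intro bexI[of _ "\<lambda>i. if i = j then T else 0"]) (auto simp: \<Gamma>_def deg_exps_def)
      qed
      ultimately have "\<kappa> \<in> E" unfolding E_def mem_Collect_eq by (intro exI[of _ "\<lambda>\<gamma>. monom_fun \<gamma> x"]) auto
      moreover have "s = \<kappa> / (\<kappa> - 1)" using False by (simp add: \<kappa>_def field_simps)
      ultimately show ?thesis by blast
    qed simp
  qed
  ultimately show ?thesis using finite_subset by blast
qed

text \<open>For large \<open>x\<close> the term of degree \<open>e \<ge> 2\<close> dominates. The bound depends on \<open>Q\<close> only through its minimum on
the unit sphere, so it is uniform for nearby maps.\<close>
lemma homogeneous_proper:
  fixes Q :: "complex ^ 'k::finite \<Rightarrow> complex ^ 'k"
  assumes hom: "\<And>t x. Q (t *s x) = t ^ e *s Q x" and e: "e \<ge> 2"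
    and m: "m > 0" "\<And>u. norm u = 1 \<Longrightarrow> m \<le> norm (Q u)" and x: "norm (Q x - x) \<le> R"
  shows "norm x \<le> 1 + (1 + R) / m"
proof (cases "norm x \<ge> 1")
  case True
  define u where "u = complex_of_real (inverse (norm x)) *s x"
  have xu: "x = complex_of_real (norm x) *s u"
  proof -
    have "norm x \<noteq> 0" using True by linarith
    then show ?thesis unfolding u_def vector_smult_assoc of_real_mult[symmetric] by simp
  qed
  have "norm u = 1"
  proof -
    have "norm x \<noteq> 0" using True by linarith
    then show ?thesis unfolding u_def norm_vector_smult norm_of_real by simp
  qed
  have "m * norm x * norm x \<le> m * norm x ^ e"
    using m(1) power_increasing[OF e True] by (simp add: power2_eq_square mult.assoc)
  also have "\<dots> \<le> norm x ^ e * norm (Q u)"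
    using mult_right_mono[OF m(2)[OF \<open>norm u = 1\<close>], of "norm x ^ e"] by (simp add: mult.commute)
  also have "\<dots> = norm (Q (complex_of_real (norm x) *s u))"
    by (simp add: hom norm_vector_smult norm_power)
  also have "\<dots> = norm (Q x)" using xu by simp
  also have "\<dots> \<le> norm x + R" using x norm_triangle_sub[of "Q x" x] by linarith
  also have "\<dots> \<le> (1 + R) * norm x"
    using mult_left_mono[OF True, of R] x norm_ge_zero[of "Q x - x"] by (simp add: algebra_simps)
  finally have "(m * norm x) * norm x \<le> (1 + R) * norm x" .
  then have "m * norm x \<le> 1 + R" by (rule mult_right_le_imp_le) (use True in linarith)
  then have "norm x \<le> (1 + R) / m" using m(1) by (simp add: field_simps)
  then show ?thesis by simp
next
  case False
  have "R \<ge> 0" using x norm_ge_zero order_trans by blast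
  then have "(1 + R) / m \<ge> 0" using m(1) by simp
  then show ?thesis using False by linarith
qed

lemma homogeneous_derivative_zero:
  fixes H :: "complex ^ 'k::finite \<Rightarrow> complex ^ 'k"
  assumes hom: "\<And>t x. H (t *s x) = t ^ e *s H x" and e: "e \<ge> 2" and H: "polymap H A"
  shows "A 0 *v h = 0"
proof -
  have "compact (sphere (0 :: complex ^ 'k) 1)" by simp
  then have "bounded (H ` sphere 0 1)"
    using polymap_continuous[OF H] compact_continuous_image compact_imp_bounded by blast
  then obtain B where B: "B > 0" "\<And>u. norm u = 1 \<Longrightarrow> norm (H u) \<le> B"
    by (auto simp: bounded_pos)
  have H0: "H 0 = 0" using hom[of 0 0] e by (simp add: power_0_left)
  have bound: "norm (H x) \<le> B * norm x * norm x" if "norm x \<le> 1" "x \<noteq> 0" for x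
  proof -
    define u where "u = complex_of_real (inverse (norm x)) *s x"
    have xu: "x = complex_of_real (norm x) *s u"
    proof -
      have "norm x \<noteq> 0" using that by simp
      then show ?thesis unfolding u_def vector_smult_assoc of_real_mult[symmetric] by simp
    qed
    have "norm u = 1" unfolding u_def norm_vector_smult norm_of_real using that by simp
    have "norm (H x) = norm (H (complex_of_real (norm x) *s u))" using xu by simp
    also have "\<dots> = norm x ^ e * norm (H u)" by (simp add: hom norm_vector_smult norm_power)
    also have "\<dots> \<le> norm x ^ 2 * B"
      using power_decreasing[OF e norm_ge_zero that(1)] B(2)[OF \<open>norm u = 1\<close>] by (intro mult_mono) auto
    finally show ?thesis by (simp add: power2_eq_square mult_ac)
  qed
  have "(H has_derivative (\<lambda>_. 0)) (at 0)"
  proof (rule has_derivativeI_sandwich[of 1])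
    fix y :: "complex ^ 'k" assume "y \<noteq> 0" "dist y 0 < 1"
    then show "norm (H y - H 0 - 0) / norm (y - 0) \<le> B * norm y"
      using bound[of y] by (simp add: H0 divide_le_eq)
  next
    show "((\<lambda>y. B * norm y) \<longlongrightarrow> 0) (at 0)" by (intro tendsto_eq_intros) auto
  qed auto
  moreover have "(H has_derivative (\<lambda>h. A 0 *v h)) (at 0)" using H by (simp add: polymap_def)
  ultimately have "(\<lambda>h. A 0 *v h) = (\<lambda>_. 0)" by (rule has_derivative_unique[rotated])
  then show ?thesis by metis
qed

section \<open>The number of fixed points of a homogeneous map\<close>

lemma card_fixed_powers:
  assumes "e \<ge> 2"
  shows "card {z::complex. z ^ e = z} = e" "finite {z::complex. z ^ e = z}"
proof -
  have "{z::complex. z ^ e = z} = insert 0 {z. z ^ (e - 1) = 1}"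
  proof (intro equalityI subsetI)
    fix z :: complex assume "z \<in> {z. z ^ e = z}"
    moreover have "z ^ e = z * z ^ (e - 1)" using assms by (metis Suc_diff_1 less_le_trans pos2 power_Suc)
    ultimately show "z \<in> insert 0 {z. z ^ (e - 1) = 1}" by auto
  next
    fix z :: complex assume "z \<in> insert 0 {z. z ^ (e - 1) = 1}"
    moreover have "z ^ e = z * z ^ (e - 1)" using assms by (metis Suc_diff_1 less_le_trans pos2 power_Suc)
    ultimately show "z \<in> {z. z ^ e = z}" by auto
  qed
  moreover have "card {z::complex. z ^ (e - 1) = 1} = e - 1"
    using assms by (intro card_roots_unity_eq) auto
  moreover have "finite {z::complex. z ^ (e - 1) = 1}"
    using assms by (intro finite_roots_unity) auto
  moreover have "0 \<notin> {z::complex. z ^ (e - 1) = 1}" using assms by (simp add: power_0_left)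
  ultimately show "card {z::complex. z ^ e = z} = e" "finite {z::complex. z ^ e = z}"
    using assms by simp_all
qed

text \<open>Bezout's theorem for \<open>H(x) - x = c\<close>. Along the pencil \<open>Hs s\<close> from \<open>H\<close> (at \<open>s = 0\<close>) to the power map (at
\<open>s = 1\<close>), the generic number \<open>r s\<close> of solutions is defined and locally constant away from the finite
set \<open>Z\<close> of degenerate parameters, hence constant. At \<open>s = 1\<close> the system decouples and \<open>c = 0\<close> is a regular
value.\<close>
lemma fixed_point_count:
  fixes H :: "complex ^ 'k::finite \<Rightarrow> complex ^ 'k"
  assumes H: "nondegenerate_homogeneous e H" and e: "e \<ge> 2"
  obtains A where "polymap (\<lambda>x. H x - x) A" "det (A 0) \<noteq> 0" "\<And>R. bounded {x. norm (H x - x) \<le> R}"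
    "\<And>c. regular_value (\<lambda>x. H x - x) A c \<Longrightarrow> card {x. H x - x = c} = e ^ CARD('k)"
proof -
  have Hpoly: "polyfun (\<lambda>x. H x $ i)" and Hhom: "H (t *s x) = t ^ e *s H x" for i t x
    using H by (auto simp: nondegenerate_homogeneous_def)
  obtain AH where AH: "polymap H AH" using polymap_exists[OF Hpoly] by blast
  define Hs where "Hs = (\<lambda>s x. \<chi> i. (1 - s) * H x $ i + s * (x $ i) ^ e)"
  define G where "G = (\<lambda>s x. Hs s x - x)"
  define As where "As = (\<lambda>s x. \<chi> i j. (1 - s) * AH x $ i $ j + (if i = j then s * (of_nat e * (x $ i) ^ (e - 1)) - 1 else 0))"
  define Z where "Z = {s. \<exists>x. x \<noteq> 0 \<and> (\<forall>i. (1 - s) * H x $ i + s * (x $ i) ^ e = 0)}"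
  have finZ: "finite Z" unfolding Z_def by (rule degenerate_parameters_finite[OF H]) (use e in simp)
  have Hs_hom: "Hs s (t *s x) = t ^ e *s Hs s x" for s t x
    by (simp add: Hs_def vec_eq_iff Hhom power_mult_distrib algebra_simps)
  have Hs_nz: "Hs s x \<noteq> 0" if "s \<notin> Z" "x \<noteq> 0" for s x
    using that by (auto simp: Z_def Hs_def vec_eq_iff)
  have AH_der: "((\<lambda>x. H x $ i) has_derivative (\<lambda>h. \<Sum>j\<in>UNIV. AH x $ i $ j * h $ j)) (at x)" for x i
  proof -
    have "(H has_derivative (\<lambda>h. AH x *v h)) (at x)" using AH by (simp add: polymap_def)
    then have "((\<lambda>x. H x $ i) has_derivative (\<lambda>h. (AH x *v h) $ i)) (at x)"
      by (rule bounded_linear.has_derivative[OF bounded_linear_vec_nth])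
    then show ?thesis by (simp add: matrix_vector_mult_def)
  qed
  have As_mult: "(As s x *v h) $ i = (1 - s) * (\<Sum>j\<in>UNIV. AH x $ i $ j * h $ j)
        + (s * (of_nat e * (x $ i) ^ (e - 1)) - 1) * h $ i" for s x h i
  proof -
    have "(As s x *v h) $ i = (\<Sum>j\<in>UNIV. (1 - s) * (AH x $ i $ j * h $ j)
        + (if i = j then (s * (of_nat e * (x $ i) ^ (e - 1)) - 1) * h $ i else 0))"
      unfolding matrix_vector_mult_def As_def by (simp, intro sum.cong) (auto simp: algebra_simps)
    then show ?thesis by (simp add: sum.distrib sum_distrib_left)
  qed
  \<comment> \<open>the parameter becomes a coordinate, so that solutions can be followed while it varies\<close>
  define \<Phi> where "\<Phi> = (\<lambda>p. (fst p, G (fst p) (snd p)))"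
  define \<Phi>' where "\<Phi>' = (\<lambda>p q. (fst q, \<chi> i. fst q * ((snd p $ i) ^ e - H (snd p) $ i) + (As (fst p) (snd p) *v snd q) $ i))"
  have \<Phi>_der: "(\<Phi> has_derivative \<Phi>' p) (at p)" for p
  proof -
    have H_snd: "((\<lambda>p. H (snd p) $ i) has_derivative (\<lambda>q. \<Sum>j\<in>UNIV. AH (snd p) $ i $ j * snd q $ j)) (at p)"
      for i and p :: "complex \<times> (complex ^ 'k)"
      using has_derivative_compose[OF has_derivative_snd[OF has_derivative_ident] AH_der[of i "snd p"]] .
    have nth_snd: "((\<lambda>p. snd p $ i) has_derivative (\<lambda>q. snd q $ i)) (at p)"
      for i and p :: "complex \<times> (complex ^ 'k)"
      by (rule bounded_linear.has_derivative[OF bounded_linear_vec_nth]) (intro derivative_intros)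
    have "((\<lambda>p. G (fst p) (snd p)) has_derivative
       (\<lambda>q. \<chi> i. fst q * ((snd p $ i) ^ e - H (snd p) $ i) + (As (fst p) (snd p) *v snd q) $ i)) (at p)"
    proof (rule has_derivative_vecI)
      fix i
      show "((\<lambda>p. G (fst p) (snd p) $ i) has_derivative
       (\<lambda>q. (\<chi> i. fst q * ((snd p $ i) ^ e - H (snd p) $ i) + (As (fst p) (snd p) *v snd q) $ i) $ i)) (at p)"
        unfolding G_def Hs_def As_mult
        by (auto intro!: derivative_eq_intros H_snd nth_snd simp: fun_eq_iff algebra_simps)
    qed
    then show ?thesis unfolding \<Phi>_def \<Phi>'_def by (intro has_derivative_Pair derivative_intros)
  qed
  have \<Phi>'_cont: "continuous_on UNIV (\<lambda>p. \<Phi>' p v)" for v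
  proof -
    have Hc: "continuous_on UNIV (\<lambda>p. H (snd p) $ i)" for i
      using continuous_on_compose2[OF polyfun_continuous[OF Hpoly, of UNIV] continuous_on_snd[OF continuous_on_id]] by auto
    have AHc: "continuous_on UNIV (\<lambda>p. AH (snd p) $ i $ j)" for i j
    proof -
      have "polyfun (\<lambda>x. AH x $ i $ j)" using AH by (simp add: polymap_def)
      from continuous_on_compose2[OF polyfun_continuous[OF this, of UNIV] continuous_on_snd[OF continuous_on_id]]
      show ?thesis by auto
    qed
    have xc: "continuous_on UNIV (\<lambda>p. snd p $ i)" for i :: 'k
      by (intro continuous_on_component continuous_on_snd continuous_on_id)
    show ?thesis unfolding \<Phi>'_def As_mult
      by (intro continuous_on_Pair continuous_on_const continuous_on_vec_lambda continuous_on_add continuous_on_mult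
          continuous_on_diff continuous_on_power continuous_on_sum Hc AHc xc continuous_on_fst continuous_on_id)
  qed
  have polyG: "polymap (G s) (As s)" for s
    unfolding polymap_def
  proof (intro conjI allI)
    fix i j x
    show "polyfun (\<lambda>x. G s x $ i)" unfolding G_def Hs_def by (auto intro!: polyfun_intros Hpoly)
    have "polyfun (\<lambda>x. AH x $ i $ j)" using AH by (simp add: polymap_def)
    then show "polyfun (\<lambda>x. As s x $ i $ j)"
      unfolding As_def by (cases "i = j") (auto intro!: polyfun_intros)
    show "(G s has_derivative (\<lambda>h. As s x *v h)) (at x)"
    proof (rule has_derivative_vecI)
      fix i
      have nth: "((\<lambda>x. x $ i) has_derivative (\<lambda>h. h $ i)) (at x)" for x :: "complex ^ 'k"
        by (rule bounded_linear.has_derivative[OF bounded_linear_vec_nth]) simp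
      show "((\<lambda>x. G s x $ i) has_derivative (\<lambda>h. (As s x *v h) $ i)) (at x)"
        unfolding G_def Hs_def As_mult
        by (auto intro!: derivative_eq_intros AH_der nth simp: fun_eq_iff algebra_simps)
    qed
  qed
  have det0: "det (As s 0) \<noteq> 0" for s
  proof -
    have "h = 0" if "As s 0 *v h = 0" for h
    proof -
      have "(AH 0 *v h) $ i = 0" for i using homogeneous_derivative_zero[OF Hhom e AH] by simp
      then have "(\<Sum>j\<in>UNIV. AH 0 $ i $ j * h $ j) = 0" for i by (simp add: matrix_vector_mult_def)
      then have "(As s 0 *v h) $ i = - h $ i" for i
        unfolding As_mult using e by (simp add: power_0_left)
      then show ?thesis using that by (simp add: vec_eq_iff)
    qed
    then show ?thesis by (simp add: invertible_iff_ker)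
  qed
  have near: "\<exists>\<delta>>0. ball s0 \<delta> \<subseteq> - Z \<and> (\<forall>R. bounded {p. fst p \<in> ball s0 \<delta> \<and> norm (G (fst p) (snd p)) \<le> R})"
    if s0: "s0 \<notin> Z" for s0
  proof -
    have "open (- Z)" using finZ finite_imp_closed open_Compl by blast
    then obtain \<delta> where \<delta>: "\<delta> > 0" "cball s0 \<delta> \<subseteq> - Z" using s0 open_contains_cball by blast
    define C where "C = cball s0 \<delta> \<times> sphere (0 :: complex ^ 'k) 1"
    have "compact C" unfolding C_def by (intro compact_Times) auto
    have "continuous_on C (\<lambda>p. Hs (fst p) (snd p))"
    proof -
      have Hc: "continuous_on C (\<lambda>p. H (snd p) $ i)" for i
        using continuous_on_compose2[OF polyfun_continuous[OF Hpoly, of UNIV] continuous_on_snd[OF continuous_on_id]] by auto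
      have xc: "continuous_on C (\<lambda>p. snd p $ i)" for i :: 'k
        by (intro continuous_on_component continuous_on_snd continuous_on_id)
      show ?thesis unfolding Hs_def
        by (intro continuous_on_const continuous_on_vec_lambda continuous_on_add continuous_on_mult
          continuous_on_diff continuous_on_power Hc xc continuous_on_fst continuous_on_id)
    qed
    then have cont: "continuous_on C (\<lambda>p. norm (Hs (fst p) (snd p)))" by (rule continuous_on_norm)
    have "axis undefined 1 \<in> sphere (0 :: complex ^ 'k) 1" by simp
    then have "C \<noteq> {}" using \<delta>(1) by (auto simp: C_def)
    obtain p where p: "p \<in> C" "\<forall>q\<in>C. norm (Hs (fst p) (snd p)) \<le> norm (Hs (fst q) (snd q))"
      using continuous_attains_inf[OF \<open>compact C\<close> \<open>C \<noteq> {}\<close> cont] by blast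
    define m where "m = norm (Hs (fst p) (snd p))"
    have "snd p \<noteq> 0" "fst p \<notin> Z" using p(1) \<delta>(2) by (auto simp: C_def)
    then have "m > 0" using Hs_nz by (simp add: m_def)
    have "bounded {p. fst p \<in> ball s0 \<delta> \<and> norm (G (fst p) (snd p)) \<le> R}" for R
    proof -
      have "norm (snd q) \<le> 1 + (1 + R) / m" if q: "fst q \<in> ball s0 \<delta>" "norm (G (fst q) (snd q)) \<le> R" for q
      proof (rule homogeneous_proper[OF Hs_hom[of "fst q"] e \<open>m > 0\<close>])
        fix u :: "complex ^ 'k" assume "norm u = 1"
        then have "(fst q, u) \<in> C" using q(1) by (auto simp: C_def)
        then show "m \<le> norm (Hs (fst q) u)" using p(2) unfolding m_def by force
      qed (use q(2) in \<open>simp add: G_def\<close>)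
      then have "{p. fst p \<in> ball s0 \<delta> \<and> norm (G (fst p) (snd p)) \<le> R} \<subseteq> ball s0 \<delta> \<times> cball 0 (1 + (1 + R) / m)"
        by auto
      then show ?thesis by (rule bounded_subset[rotated]) (intro bounded_Times bounded_ball bounded_cball)
    qed
    moreover have "ball s0 \<delta> \<subseteq> - Z" using \<delta>(2) ball_subset_cball by blast
    ultimately show ?thesis using \<delta>(1) by blast
  qed
  have proper: "bounded {x. norm (G s x) \<le> R}" if s: "s \<notin> Z" for s R
  proof -
    obtain \<delta> where \<delta>: "\<delta> > 0" "\<And>R. bounded {p. fst p \<in> ball s \<delta> \<and> norm (G (fst p) (snd p)) \<le> R}"
      using near[OF s] by blast
    have "{x. norm (G s x) \<le> R} \<subseteq> snd ` {p. fst p \<in> ball s \<delta> \<and> norm (G (fst p) (snd p)) \<le> R}"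
      using \<delta>(1) by (auto intro!: image_eqI[of _ snd "(s, _)"])
    then show ?thesis using bounded_snd[OF \<delta>(2)] bounded_subset by blast
  qed
  define r where "r = (\<lambda>s. SOME n. \<forall>c. regular_value (G s) (As s) c \<longrightarrow> card {x. G s x = c} = n)"
  have r: "card {x. G s x = c} = r s" if "s \<notin> Z" "regular_value (G s) (As s) c" for s c
    using someI_ex[OF card_fibre_constant[OF polyG det0 proper[OF that(1)]]] that(2)
    unfolding r_def by blast
  have "r constant_on (UNIV - Z)"
  proof (rule locally_constant_imp_constant)
    show "connected (UNIV - Z)"
      using finZ by (intro connected_open_diff_countable) (auto simp: countable_finite)
    fix s0 assume "s0 \<in> UNIV - Z"
    then have s0: "s0 \<notin> Z" by simp
    obtain \<delta> where \<delta>: "\<delta> > 0" "ball s0 \<delta> \<subseteq> - Z"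
      "\<And>R. bounded {p. fst p \<in> ball s0 \<delta> \<and> norm (G (fst p) (snd p)) \<le> R}"
      using near[OF s0] by blast
    obtain c0 where reg0: "regular_value (G s0) (As s0) c0"
      using regular_values_dense[OF polyG det0 open_UNIV UNIV_I] by blast
    have fib: "{p. \<Phi> p = (s, c)} = {s} \<times> {x. G s x = c}" for s c by (auto simp: \<Phi>_def)
    then have cardfib: "card {p. \<Phi> p = (s, c)} = card {x. G s x = c}" for s c
      by (simp add: card_cartesian_product)
    have bnd: "bounded {p. dist (\<Phi> p) (s0, c0) \<le> \<delta> / 2}"
    proof (rule bounded_subset[OF \<delta>(3)[of "norm c0 + \<delta>"]], rule subsetI)
      fix q assume "q \<in> {p. dist (\<Phi> p) (s0, c0) \<le> \<delta> / 2}"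
      then have q: "dist (\<Phi> q) (s0, c0) \<le> \<delta> / 2" by simp
      have "dist (fst q) s0 \<le> \<delta> / 2" using dist_fst_le[of "\<Phi> q" "(s0, c0)"] q by (simp add: \<Phi>_def)
      moreover have "dist (G (fst q) (snd q)) c0 \<le> \<delta> / 2"
        using dist_snd_le[of "\<Phi> q" "(s0, c0)"] q by (simp add: \<Phi>_def)
      moreover have "norm (G (fst q) (snd q)) \<le> norm c0 + dist (G (fst q) (snd q)) c0"
        by (metis dist_norm norm_triangle_sub)
      ultimately show "q \<in> {p. fst p \<in> ball s0 \<delta> \<and> norm (G (fst p) (snd p)) \<le> norm c0 + \<delta>}"
        using \<delta>(1) by (simp add: dist_commute)
    qed
    have inj: "inj (\<Phi>' q)" if "\<Phi> q = (s0, c0)" for q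
    proof -
      have "linear (\<Phi>' q)" using \<Phi>_der has_derivative_linear by blast
      moreover have "v = 0" if v: "\<Phi>' q v = 0" for v
      proof -
        have "fst v = 0" using v by (simp add: \<Phi>'_def prod_eq_iff)
        moreover then have "As (fst q) (snd q) *v snd v = 0"
          using v by (simp add: \<Phi>'_def prod_eq_iff vec_eq_iff)
        moreover have "det (As (fst q) (snd q)) \<noteq> 0"
          using reg0 \<open>\<Phi> q = (s0, c0)\<close> by (auto simp: regular_value_def \<Phi>_def)
        ultimately show ?thesis by (simp add: invertible_iff_ker prod_eq_iff)
      qed
      ultimately show ?thesis by (simp add: linear_injective_0)
    qed
    obtain \<epsilon> g where \<epsilon>: "\<epsilon> > 0" "\<forall>b\<in>ball (s0, c0) \<epsilon>. inj_on (\<lambda>x. g x b) {x. \<Phi> x = (s0, c0)} \<and>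
               {x. \<Phi> x = b} = (\<lambda>x. g x b) ` {x. \<Phi> x = (s0, c0)}"
      using fibre_locally_constant(2)[OF \<Phi>_der \<Phi>'_cont _ bnd inj] \<delta>(1) by auto
    have card_near: "card {p. \<Phi> p = b} = card {p. \<Phi> p = (s0, c0)}" if "b \<in> ball (s0, c0) \<epsilon>" for b
      using \<epsilon>(2) that card_image[of "\<lambda>x. g x b" "{x. \<Phi> x = (s0, c0)}"] by presburger
    have rs: "r s = r s0" if "s \<in> ball s0 (min \<delta> (\<epsilon> / 2))" for s
    proof -
      have s: "s \<notin> Z" using that \<delta>(2) by auto
      have "c0 \<in> ball c0 (\<epsilon> / 2)" using \<epsilon>(1) by simp
      then obtain c where c: "c \<in> ball c0 (\<epsilon> / 2)" "regular_value (G s) (As s) c"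
        using regular_values_dense[OF polyG det0 open_ball] by blast
      from c(2) have "r s = card {p. \<Phi> p = (s, c)}" using r[OF s] by (simp add: cardfib)
      also have "\<dots> = card {p. \<Phi> p = (s0, c0)}"
      proof (rule card_near)
        have "dist (s0, c0) (s, c) \<le> dist s0 s + dist c0 c"
          by (simp add: dist_prod_def sqrt_sum_squares_le_sum)
        then show "(s, c) \<in> ball (s0, c0) \<epsilon>" using that c(1) by simp
      qed
      also have "\<dots> = r s0" using r[OF s0 reg0] by (simp add: cardfib)
      finally show ?thesis .
    qed
    show "\<exists>T. openin (top_of_set (UNIV - Z)) T \<and> s0 \<in> T \<and> (\<forall>x\<in>T. r x = r s0)"
      using s0 \<delta>(1) \<epsilon>(1)
      by (intro exI[of _ "(UNIV - Z) \<inter> ball s0 (min \<delta> (\<epsilon> / 2))"] conjI ballI)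
         (auto intro!: rs openin_open_Int)
  qed
  moreover have Z0: "0 \<notin> Z" using H by (auto simp: Z_def nondegenerate_homogeneous_def vec_eq_iff)
  moreover have Z1: "1 \<notin> Z" using e by (auto simp: Z_def vec_eq_iff)
  ultimately have "r 0 = r 1" unfolding constant_on_def by (metis Diff_iff UNIV_I)
  moreover have "r 1 = e ^ CARD('k)"
  proof -
    have fib1: "G 1 x = 0 \<longleftrightarrow> (\<forall>i. x $ i \<in> {z. z ^ e = z})" for x
      by (simp add: G_def Hs_def vec_eq_iff)
    have "regular_value (G 1) (As 1) 0"
      unfolding regular_value_def invertible_iff_ker
    proof (intro allI impI)
      fix x h assume x: "G 1 x = 0" and h: "As 1 x *v h = 0"
      have "h $ i = 0" for i
      proof -
        have "(of_nat e * (x $ i) ^ (e - 1) - 1) * h $ i = 0" using h As_mult[of 1 x h i] by simp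
        moreover have "of_nat e * (x $ i) ^ (e - 1) - 1 \<noteq> 0"
        proof (cases "x $ i = 0")
          case True
          then show ?thesis using e by (simp add: power_0_left)
        next
          case False
          have "x $ i * (x $ i) ^ (e - 1) = x $ i * 1"
            using x e unfolding fib1 by (simp add: power_eq_if)
          then have "(x $ i) ^ (e - 1) = 1" using False by simp
          moreover have "of_nat e \<noteq> (1::complex)" using e by (metis of_nat_1 of_nat_eq_iff one_le_numeral le_antisym numeral_le_one_iff semiring_norm(69) order_refl)
          ultimately show ?thesis by simp
        qed
        ultimately show ?thesis by simp
      qed
      then show "h = 0" by (simp add: vec_eq_iff)
    qed
    then have "r 1 = card {x. G 1 x = 0}" using r[OF Z1] by simp
    also have "\<dots> = card (PiE UNIV (\<lambda>_::'k. {z::complex. z ^ e = z}))"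
    proof (rule bij_betw_same_card[of vec_nth], rule bij_betwI[of _ _ _ vec_lambda])
      show "vec_nth \<in> {x. G 1 x = 0} \<rightarrow> (\<Pi>\<^sub>E _\<in>UNIV. {z. z ^ e = z})"
        by (auto simp: fib1 PiE_UNIV_domain)
      show "vec_lambda \<in> (\<Pi>\<^sub>E _\<in>UNIV. {z. z ^ e = z}) \<rightarrow> {x. G 1 x = 0}"
        by (auto simp: fib1 PiE_UNIV_domain)
    qed auto
    also have "\<dots> = e ^ CARD('k)" by (subst card_PiE) (auto simp: card_fixed_powers[OF e])
    finally show ?thesis .
  qed
  moreover have "G 0 = (\<lambda>x. H x - x)" by (simp add: G_def Hs_def fun_eq_iff)
  ultimately show thesis
    using that[of "As 0"] polyG[of 0] det0[of 0] proper[OF Z0] r[OF Z0] by simp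
qed

section \<open>Fixed points in an invariant subspace\<close>

lemma polyfun_linear:
  fixes \<phi> :: "complex ^ 'k::finite \<Rightarrow> complex"
  assumes "\<And>x y. \<phi> (x + y) = \<phi> x + \<phi> y" "\<And>t x. \<phi> (t *s x) = t * \<phi> x"
  shows "polyfun \<phi>"
proof -
  have zero: "\<phi> 0 = 0" using assms(2)[of 0 0] by simp
  have sum: "\<phi> (\<Sum>i\<in>I. g i) = (\<Sum>i\<in>I. \<phi> (g i))" if "finite I" for I and g :: "'k \<Rightarrow> complex ^ 'k"
    using that by (induction I rule: finite_induct) (auto simp: zero assms(1))
  have "\<phi> = (\<lambda>x. \<Sum>i\<in>UNIV. x $ i * \<phi> (axis i 1))"
  proof
    fix x
    have "\<phi> x = \<phi> (\<Sum>i\<in>UNIV. x $ i *s axis i 1)" by (simp add: basis_expansion)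
    then show "\<phi> x = (\<Sum>i\<in>UNIV. x $ i * \<phi> (axis i 1))" by (simp add: sum assms(2))
  qed
  moreover have "polyfun (\<lambda>x. \<Sum>i\<in>UNIV. x $ i * \<phi> (axis i 1))" by (intro polyfun_intros)
  ultimately show ?thesis by metis
qed

lemma card_power_minus_id:
  assumes "e \<ge> 2"
  shows "finite {z::complex. z ^ e - z = c}" "card {z::complex. z ^ e - z = c} \<le> e"
proof -
  define q where "q = Polynomial.monom 1 e - [:c, 1:]"
  have "coeff q e = 1" using assms by (cases e) (auto simp: q_def coeff_pCons split: nat.splits)
  then have "q \<noteq> 0" by auto
  have "degree q \<le> e" unfolding q_def
    using assms by (intro degree_diff_le) (auto simp: degree_monom_le)
  have eq: "{z. z ^ e - z = c} = {z. poly q z = 0}" by (auto simp: q_def poly_monom algebra_simps)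
  show "finite {z::complex. z ^ e - z = c}" unfolding eq using \<open>q \<noteq> 0\<close> by (rule poly_roots_finite)
  show "card {z::complex. z ^ e - z = c} \<le> e"
    unfolding eq using card_poly_roots_bound[OF \<open>q \<noteq> 0\<close>] \<open>degree q \<le> e\<close> by linarith
qed

text \<open>Replace \<open>H\<close> by a map \<open>K\<close> that agrees with it on \<open>L\<close> and raises each coordinate of a complement of \<open>L\<close> to the
power \<open>e\<close>. The solutions for \<open>K\<close> are counted by \<open>fixed_point_count\<close>; the equations for the
complement have at most \<open>e\<close> solutions in each coordinate, so at least \<open>e ^ n\<close> solutions remain for the
factor \<open>L\<close>.\<close>
lemma invariant_subspace_count:
  fixes H :: "complex ^ 'k::finite \<Rightarrow> complex ^ 'k"
  assumes H: "nondegenerate_homogeneous e H" and e: "e \<ge> 2"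
    and L: "vec.subspace L" "vec.dim L = n" "\<And>x. x \<in> L \<Longrightarrow> H x \<in> L" and \<rho>: "\<rho> > 0"
  shows "\<exists>c\<in>L. norm c < \<rho> \<and> (\<exists>X\<subseteq>L. finite X \<and> card X = e ^ n \<and> (\<forall>x\<in>X. H x - x = c))"
proof -
  have Hpoly: "polyfun (\<lambda>x. H x $ i)" and Hhom: "H (t *s x) = t ^ e *s H x"
    and Hnz: "H x = 0 \<Longrightarrow> x = 0" for i t x
    using H by (auto simp: nondegenerate_homogeneous_def)
  obtain B where B: "B \<subseteq> L" "vec.independent B" "L \<subseteq> vec.span B" "card B = n"
    using vec.basis_exists[of L] L(2) by metis
  have spanB: "vec.span B = L" using B L(1) vec.span_minimal by blast
  obtain B' where B': "B \<subseteq> B'" "vec.independent B'" "UNIV \<subseteq> vec.span B'"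
    by (rule vec.maximal_independent_subset_extend[OF subset_UNIV B(2)]) blast
  have fin: "finite B'" "finite B" using B'(2) B(2) vec.finiteI_independent by blast+
  have span: "x \<in> vec.span B'" for x using B'(3) by blast
  define D where "D = B' - B"
  have finD: "finite D" using fin by (simp add: D_def)
  have "card B' = CARD('k)"
    using vec.basis_card_eq_dim[OF subset_UNIV B'(3,2)] vec_dim_card by simp
  then have cardD: "card D + n = CARD('k)"
    using B'(1) fin B(4) card_mono[OF fin(1) B'(1)] by (simp add: D_def card_Diff_subset)
  define z where "z = (\<lambda>x b. vec.representation B' x b)"
  have z_add: "z (x + y) b = z x b + z y b" for x y b
    unfolding z_def by (simp add: vec.representation_add[OF B'(2) span span])
  have z_scale: "z (t *s x) b = t * z x b" for t x b
    unfolding z_def by (simp add: vec.representation_scale[OF B'(2) span])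
  have z_diff: "z (x - y) b = z x b - z y b" for x y b
    using z_add[of "x - y" y b] by simp
  have z_sum: "z (\<Sum>i\<in>I. g i) b = (\<Sum>i\<in>I. z (g i) b)" if "finite I" for I b and g :: "complex ^ 'k \<Rightarrow> complex ^ 'k"
    using that by (induction I rule: finite_induct) (use z_scale[of 0 0 b] in \<open>auto simp: z_add\<close>)
  have z_basis: "z b c = (if c = b then 1 else 0)" if "b \<in> B'" for b c
    unfolding z_def vec.representation_basis[OF B'(2) that] ..
  have z_L: "z x d = 0" if "x \<in> L" "d \<in> D" for x d
  proof -
    have "vec.representation B' x = vec.representation B x"
      using vec.representation_extend[OF B'(2) _ B'(1)] that(1) spanB by blast
    then show ?thesis using vec.representation_ne_zero[of B x d] that(2) by (auto simp: z_def D_def)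
  qed
  define \<pi> where "\<pi> = (\<lambda>x. \<Sum>b\<in>B. z x b *s b)"
  define \<kappa> where "\<kappa> = (\<lambda>x. \<Sum>d\<in>D. z x d *s d)"
  have decomp: "x = \<pi> x + \<kappa> x" for x
  proof -
    have "x = (\<Sum>b\<in>B'. z x b *s b)"
      unfolding z_def by (rule vec.sum_representation_eq[OF B'(2) span fin(1) order_refl, symmetric])
    also have "\<dots> = \<pi> x + \<kappa> x"
      unfolding \<pi>_def \<kappa>_def D_def by (simp add: sum.subset_diff[OF B'(1) fin(1)])
    finally show ?thesis .
  qed
  have \<pi>_L: "\<pi> x \<in> L" for x unfolding \<pi>_def
    using B(1) by (intro vec.subspace_sum[OF L(1)] vec.subspace_scale[OF L(1)]) auto
  have \<pi>_add: "\<pi> (x + y) = \<pi> x + \<pi> y" for x y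
    by (simp add: \<pi>_def z_add vec.scale_left_distrib sum.distrib)
  have \<pi>_scale: "\<pi> (t *s x) = t *s \<pi> x" for t x
    by (simp add: \<pi>_def z_scale vec.scale_sum_right)
  have \<pi>_diff: "\<pi> (x - y) = \<pi> x - \<pi> y" for x y using \<pi>_add[of "x - y" y] by simp
  have \<pi>_id: "\<pi> x = x" if "x \<in> L" for x
    using decomp[of x] z_L[OF that] by (simp add: \<kappa>_def)
  have \<pi>_poly: "polyfun (\<lambda>x. \<pi> x $ i)" for i
    by (rule polyfun_linear) (simp_all add: \<pi>_add \<pi>_scale)
  have z_poly: "polyfun (\<lambda>x. z x b)" for b by (rule polyfun_linear) (simp_all add: z_add z_scale)
  \<comment> \<open>\<open>H\<close> on \<open>L\<close>, powers of the coordinates on the complement spanned by \<open>D\<close>\<close>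
  define P where "P = (\<lambda>x. \<Sum>d\<in>D. (z x d) ^ e *s d)"
  define K where "K = (\<lambda>x. H (\<pi> x) + P x)"
  have zP: "z (P x) d = (if d \<in> D then (z x d) ^ e else 0)" for x d
  proof -
    have "z (P x) d = (\<Sum>c\<in>D. (z x c) ^ e * z c d)" by (simp add: P_def z_sum finD z_scale)
    also have "\<dots> = (\<Sum>c\<in>D. if c = d then (z x d) ^ e else 0)"
      by (intro sum.cong) (auto simp: z_basis D_def)
    finally show ?thesis using finD by simp
  qed
  have \<pi>P: "\<pi> (P x) = 0" for x
    unfolding \<pi>_def zP by (simp add: D_def)
  have \<pi>K: "\<pi> (K x) = H (\<pi> x)" for x
    by (simp add: K_def \<pi>_add \<pi>P \<pi>_id L(3)[OF \<pi>_L])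
  have zK: "z (K x) d = (z x d) ^ e" if "d \<in> D" for x d
    using that by (simp add: K_def z_add zP z_L[OF L(3)[OF \<pi>_L]])
  have "nondegenerate_homogeneous e K"
    unfolding nondegenerate_homogeneous_def
  proof (intro conjI allI impI)
    fix i show "polyfun (\<lambda>x. K x $ i)"
      unfolding K_def P_def by (auto intro!: polyfun_intros polyfun_compose[OF Hpoly] \<pi>_poly z_poly)
  next
    fix t x show "K (t *s x) = t ^ e *s K x"
      by (simp add: K_def P_def \<pi>_scale Hhom z_scale power_mult_distrib vec.scale_sum_right vec.scale_right_distrib)
  next
    fix x assume K0: "K x = 0"
    then have "H (\<pi> x) = 0" using \<pi>K[of x] \<pi>_scale[of 0 0] by simp
    then have "\<pi> x = 0" by (rule Hnz)
    moreover have "z x d = 0" if "d \<in> D" for d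
      using zK[OF that, of x] K0 z_scale[of 0 0 d] e by simp
    ultimately show "x = 0" using decomp[of x] by (simp add: \<kappa>_def)
  qed
  then obtain A where A: "polymap (\<lambda>x. K x - x) A" "det (A 0) \<noteq> 0"
    "\<And>c. regular_value (\<lambda>x. K x - x) A c \<Longrightarrow> card {x. K x - x = c} = e ^ CARD('k)"
    by (rule fixed_point_count[OF _ e]) blast
  have cont\<pi>: "continuous_on UNIV \<pi>"
  proof -
    have "continuous_on UNIV (\<lambda>x. \<chi> i. \<pi> x $ i)"
      by (intro continuous_on_vec_lambda polyfun_continuous \<pi>_poly)
    then show ?thesis by simp
  qed
  have "open (\<pi> -` ball 0 \<rho>)" using cont\<pi> by (simp add: continuous_on_open_vimage)
  moreover have "0 \<in> \<pi> -` ball 0 \<rho>" using \<rho> \<pi>_scale[of 0 0] by simp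
  ultimately obtain c where c: "\<pi> c \<in> ball 0 \<rho>" "regular_value (\<lambda>x. K x - x) A c"
    using regular_values_dense[OF A(1,2), of "\<pi> -` ball 0 \<rho>" 0] by auto
  define F where "F = {x. K x - x = c}"
  have cardF: "card F = e ^ CARD('k)" unfolding F_def by (rule A(3)[OF c(2)])
  have finF: "finite F"
  proof (rule card_ge_0_finite)
    show "card F > 0" using cardF e by simp
  qed
  define X0 where "X0 = \<pi> ` F"
  define R where "R = (\<lambda>d. {w. w ^ e - w = z c d})"
  have finR: "finite (R d)" "card (R d) \<le> e" for d
    using card_power_minus_id[OF e] by (simp_all add: R_def)
  have "inj_on (\<lambda>x. (\<pi> x, restrict (z x) D)) F"
  proof (rule inj_onI)
    fix x y assume xy: "(\<pi> x, restrict (z x) D) = (\<pi> y, restrict (z y) D)"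
    then have "z x d = z y d" if "d \<in> D" for d using that by (metis prod.inject restrict_apply)
    then have "\<kappa> x = \<kappa> y" by (simp add: \<kappa>_def)
    then show "x = y" using decomp[of x] decomp[of y] xy by simp
  qed
  moreover have "(\<lambda>x. (\<pi> x, restrict (z x) D)) ` F \<subseteq> X0 \<times> PiE D R"
  proof (intro image_subsetI SigmaI)
    fix x assume x: "x \<in> F"
    then show "\<pi> x \<in> X0" by (simp add: X0_def)
    have "z x d \<in> R d" if "d \<in> D" for d
    proof -
      have "z (K x - x) d = z c d" using x by (simp add: F_def)
      then show ?thesis using that by (simp add: z_diff zK R_def)
    qed
    then show "restrict (z x) D \<in> PiE D R" by auto
  qed
  moreover have finX0: "finite X0" using finF by (simp add: X0_def)
  ultimately have "card F \<le> card (X0 \<times> PiE D R)"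
    using finR(1) finD by (intro card_inj_on_le[of "\<lambda>x. (\<pi> x, restrict (z x) D)"] finite_cartesian_product finite_PiE) auto
  also have "\<dots> = card X0 * (\<Prod>d\<in>D. card (R d))" by (simp add: card_cartesian_product card_PiE finD)
  also have "\<dots> \<le> card X0 * e ^ card D"
    using prod_mono[of D "\<lambda>d. card (R d)" "\<lambda>_. e"] finR(2) by (intro mult_left_mono) auto
  finally have "e ^ n * e ^ card D \<le> card X0 * e ^ card D"
    by (simp add: cardF cardD[symmetric] power_add mult.commute)
  then have "e ^ n \<le> card X0" using e by simp
  then obtain X where X: "X \<subseteq> X0" "card X = e ^ n" "finite X"
    using obtain_subset_with_card_n[of "e ^ n" X0] by auto
  have "x \<in> L \<and> H x - x = \<pi> c" if x: "x \<in> X" for x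
  proof -
    obtain y where y: "y \<in> F" "x = \<pi> y" using x X(1) by (auto simp: X0_def)
    have "\<pi> (K y - y) = \<pi> c" using y(1) by (simp add: F_def)
    then show ?thesis using y(2) \<pi>_L by (simp add: \<pi>_diff \<pi>K)
  qed
  then show ?thesis using X c(1) \<pi>_L by (intro bexI[of _ "\<pi> c"]) auto
qed

section \<open>Characteristic polynomials of the fibres\<close>

lemma bounded_holomorphic_extension:
  fixes \<phi> :: "complex \<Rightarrow> complex"
  assumes "finite Z" "open U" "\<phi> holomorphic_on (U - Z)" "\<And>z. z \<in> U - Z \<Longrightarrow> norm (\<phi> z) \<le> M"
  shows "\<exists>\<psi>. \<psi> holomorphic_on U \<and> (\<forall>z\<in>U - Z. \<psi> z = \<phi> z) \<and> (\<forall>z\<in>U. norm (\<psi> z) \<le> M)"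
  using assms
proof (induction Z arbitrary: U rule: finite_induct)
  case empty
  then show ?case by (intro exI[of _ \<phi>]) auto
next
  case (insert w Z)
  have "U - insert w Z = (U - {w}) - Z" by blast
  then obtain \<psi> where \<psi>: "\<psi> holomorphic_on (U - {w})" "\<And>z. z \<in> U - {w} - Z \<Longrightarrow> \<psi> z = \<phi> z"
    "\<And>z. z \<in> U - {w} \<Longrightarrow> norm (\<psi> z) \<le> M"
    using insert.IH[of "U - {w}"] insert.prems by (auto simp: open_delete)
  show ?case
  proof (cases "w \<in> U")
    case False
    then have "U - {w} = U" by blast
    then show ?thesis using \<psi> by (intro exI[of _ \<psi>]) auto
  next
    case True
    then have int: "w \<in> interior U" using insert.prems(1) by (simp add: interior_open)
    have ev: "\<forall>\<^sub>F z in at w. z \<in> U - {w}"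
      using insert.prems(1) True eventually_at_in_open by blast
    then have "\<forall>\<^sub>F z in at w. norm (\<psi> z) \<le> M" by (rule eventually_mono) (rule \<psi>(3))
    then obtain g where g: "g holomorphic_on U" "\<forall>z\<in>U - {w}. g z = \<psi> z"
      using holomorphic_on_extend_bounded[OF \<psi>(1) int] by blast
    have "norm (g w) \<le> M"
    proof (rule tendsto_upperbound)
      have "isCont g w" using g(1) True insert.prems(1)
        by (meson continuous_on_eq_continuous_at holomorphic_on_imp_continuous_on)
      then show "((\<lambda>z. norm (g z)) \<longlongrightarrow> norm (g w)) (at w)"
        by (simp add: isCont_def tendsto_norm)
      show "\<forall>\<^sub>F z in at w. norm (g z) \<le> M"
        using ev by (rule eventually_mono) (use g(2) \<psi>(3) in metis)
    qed simp
    then have "\<forall>z\<in>U. norm (g z) \<le> M" using g(2) \<psi>(3) by (metis Diff_iff singletonD)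
    moreover have "\<forall>z\<in>U - insert w Z. g z = \<phi> z" using g(2) \<psi>(2) by auto
    ultimately show ?thesis using g(1) by blast
  qed
qed

text \<open>The Schwarz lemma on the disc of radius \<open>R\<close>.\<close>
lemma bounded_holomorphic_lipschitz:
  fixes \<psi> :: "complex \<Rightarrow> complex"
  assumes hol: "\<psi> holomorphic_on ball 0 R" and R: "R > 1" and M: "\<And>z. z \<in> ball 0 R \<Longrightarrow> norm (\<psi> z) \<le> M"
  shows "norm (\<psi> 1 - \<psi> 0) \<le> 2 * (M + 1) / R"
proof -
  have "norm (\<psi> 0) \<le> M" using M[of 0] R by simp
  then have "M \<ge> 0" using norm_ge_zero[of "\<psi> 0"] by linarith
  define g where "g = (\<lambda>z. (\<psi> (of_real R * z) - \<psi> 0) / of_real (2 * (M + 1)))"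
  have mem: "of_real R * z \<in> ball 0 R" if "norm z < 1" for z :: complex
    using that R by (simp add: norm_mult)
  have "(\<psi> \<circ> (\<lambda>z. of_real R * z)) holomorphic_on ball 0 1"
    by (rule holomorphic_on_compose_gen[OF _ hol]) (use mem in \<open>auto intro!: holomorphic_intros\<close>)
  moreover have "complex_of_real (2 * (M + 1)) \<noteq> 0" unfolding of_real_eq_0_iff using \<open>M \<ge> 0\<close> by simp
  ultimately have "g holomorphic_on ball 0 1"
    unfolding g_def o_def by (intro holomorphic_intros)
  moreover have "g 0 = 0" by (simp add: g_def)
  moreover have "norm (g z) < 1" if "norm z < 1" for z
  proof -
    have "norm (\<psi> (of_real R * z) - \<psi> 0) \<le> M + M"
      using M[OF mem[OF that]] M[of 0] R 
        norm_triangle_ineq4[of "\<psi> (of_real R * z)" "\<psi> 0"] by simp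
    then have "norm (g z) \<le> (M + M) / (2 * (M + 1))"
      unfolding g_def norm_divide norm_of_real using \<open>M \<ge> 0\<close> by (intro frac_le) auto
    also have "\<dots> < 1" using \<open>M \<ge> 0\<close> by (simp add: field_simps)
    finally show ?thesis .
  qed
  moreover have "norm (of_real (1 / R) :: complex) < 1" using R unfolding norm_of_real by simp
  ultimately have "norm (g (of_real (1 / R))) \<le> norm (of_real (1 / R) :: complex)"
    by (rule Schwarz_Lemma(1))
  moreover have "of_real R * of_real (1 / R) = (1 :: complex)" using R by (simp flip: of_real_mult)
  ultimately have "norm ((\<psi> 1 - \<psi> 0) / of_real (2 * (M + 1))) \<le> 1 / R"
    using R unfolding g_def norm_of_real by simp
  then have "norm (\<psi> 1 - \<psi> 0) / (2 * (M + 1)) \<le> 1 / R"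
    unfolding norm_divide norm_of_real using \<open>M \<ge> 0\<close> by simp
  then show ?thesis using \<open>M \<ge> 0\<close> by (simp add: pos_divide_le_eq)
qed

text \<open>Lagrange interpolation recovers the coefficients from finitely many values, so pointwise limits of polynomials of bounded degree are polynomials.\<close>
lemma poly_pointwise_limit:
  fixes P :: "nat \<Rightarrow> complex poly" and q :: "complex \<Rightarrow> complex"
  assumes deg: "\<And>n. degree (P n) \<le> m" and S: "finite S"
    and lim: "\<And>T. T \<notin> S \<Longrightarrow> (\<lambda>n. poly (P n) T) \<longlonglongrightarrow> q T"
  obtains \<xi> where "degree \<xi> \<le> m" "\<And>T. (\<lambda>n. poly (P n) T) \<longlonglongrightarrow> poly \<xi> T"
    "\<And>i. (\<lambda>n. coeff (P n) i) \<longlonglongrightarrow> coeff \<xi> i"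
proof -
  have "infinite (- S)" using S finite_compl infinite_UNIV_char_0 by blast
  then obtain N where N: "finite N" "card N = Suc m" "N \<subseteq> - S"
    using infinite_arbitrarily_large by blast
  define L where "L = (\<lambda>t. smult (inverse (\<Prod>u\<in>N - {t}. t - u)) (\<Prod>u\<in>N - {t}. [:- u, 1:]))"
  have L: "poly (L t) v = (if v = t then 1 else 0)" if "t \<in> N" "v \<in> N" for t v
  proof (cases "v = t")
    case True
    then show ?thesis using N(1) by (simp add: L_def poly_prod)
  next
    case False
    then have "(\<Prod>u\<in>N - {t}. v - u) = 0" using that N(1) by (intro prod_zero) auto
    then show ?thesis using False by (simp add: L_def poly_prod)
  qed
  have degL: "degree (L t) \<le> m" if "t \<in> N" for t
  proof -
    have "degree (\<Prod>u\<in>N - {t}. [:- u, 1:]) \<le> m"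
      by (rule order_trans[OF degree_prod_sum_le]) (use N that in auto)
    then show ?thesis unfolding L_def by (rule order_trans[OF degree_smult_le])
  qed
  have expand: "P n = (\<Sum>t\<in>N. smult (poly (P n) t) (L t))" for n
  proof (rule poly_eqI_degree[where A = N])
    fix v assume v: "v \<in> N"
    have "poly (\<Sum>t\<in>N. smult (poly (P n) t) (L t)) v = (\<Sum>t\<in>N. if t = v then poly (P n) v else 0)"
      unfolding poly_sum by (intro sum.cong) (auto simp: L v)
    then show "poly (P n) v = poly (\<Sum>t\<in>N. smult (poly (P n) t) (L t)) v" using N(1) v by simp
  next
    show "degree (P n) < card N" using deg[of n] N(2) by simp
    have "degree (\<Sum>t\<in>N. smult (poly (P n) t) (L t)) \<le> m"
      by (intro degree_sum_le N(1) order_trans[OF degree_smult_le] degL)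
    then show "degree (\<Sum>t\<in>N. smult (poly (P n) t) (L t)) < card N" using N(2) by simp
  qed
  define \<xi> where "\<xi> = (\<Sum>t\<in>N. smult (q t) (L t))"
  have limN: "(\<lambda>n. poly (P n) t) \<longlonglongrightarrow> q t" if "t \<in> N" for t using that N(3) lim by blast
  have 1: "degree \<xi> \<le> m" unfolding \<xi>_def by (intro degree_sum_le N(1) order_trans[OF degree_smult_le] degL)
  have 2: "(\<lambda>n. poly (P n) T) \<longlonglongrightarrow> poly \<xi> T" for T
  proof -
    have "(\<lambda>n. \<Sum>t\<in>N. poly (P n) t * poly (L t) T) \<longlonglongrightarrow> (\<Sum>t\<in>N. q t * poly (L t) T)"
      by (intro tendsto_intros limN)
    moreover have "poly (P n) T = (\<Sum>t\<in>N. poly (P n) t * poly (L t) T)" for n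
      by (subst expand) (simp add: poly_sum)
    ultimately show ?thesis by (simp add: \<xi>_def poly_sum)
  qed
  have 3: "(\<lambda>n. coeff (P n) i) \<longlonglongrightarrow> coeff \<xi> i" for i
  proof -
    have "(\<lambda>n. \<Sum>t\<in>N. poly (P n) t * coeff (L t) i) \<longlonglongrightarrow> (\<Sum>t\<in>N. q t * coeff (L t) i)"
      by (intro tendsto_intros limN)
    moreover have "coeff (P n) i = (\<Sum>t\<in>N. poly (P n) t * coeff (L t) i)" for n
      by (subst expand) (simp add: coeff_sum)
    ultimately show ?thesis by (simp add: \<xi>_def coeff_sum)
  qed
  show thesis by (rule that[OF 1 2 3])
qed

text \<open>For a regular value \<open>c\<close> this is the value at \<open>T\<close> of the characteristic polynomial of multiplication by \<open>f\<close>
on the functions on the fibre.\<close>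
definition fibre_prod :: "(complex ^ 'k::finite \<Rightarrow> complex ^ 'k) \<Rightarrow> (complex ^ 'k \<Rightarrow> complex) \<Rightarrow> complex \<Rightarrow> complex ^ 'k \<Rightarrow> complex" where
  "fibre_prod G f T c = (\<Prod>y\<in>{x. G x = c}. T - f y)"

text \<open>The points of a fibre over a regular value are locally holomorphic functions of the value.\<close>
lemma fibre_prod_holomorphic_on_lines:
  fixes G :: "complex ^ 'k::finite \<Rightarrow> complex ^ 'k"
  assumes G: "polymap G A" and proper: "\<And>R. bounded {x. norm (G x) \<le> R}" and f: "polyfun f"
    and reg: "regular_value G A (a + t0 *s b)"
  shows "(\<lambda>t. fibre_prod G f T (a + t *s b)) field_differentiable (at t0)"
proof -
  define l where "l = (\<lambda>t. a + t *s b)"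
  define F where "F = {x. G x = l t0}"
  obtain \<epsilon> g where \<epsilon>: "\<epsilon> > 0"
    and g1: "\<forall>x. G x = l t0 \<longrightarrow> g x (l t0) = x \<and> continuous_on (ball (l t0) \<epsilon>) (g x)"
    and g2: "\<forall>b\<in>ball (l t0) \<epsilon>. inj_on (\<lambda>x. g x b) {x. G x = l t0} \<and>
               {x. G x = b} = (\<lambda>x. g x b) ` {x. G x = l t0}"
    using polymap_sections(2)[OF G proper reg] unfolding l_def by (elim exE conjE)
  have Gg: "G (g x c) = c" if "x \<in> F" "c \<in> ball (l t0) \<epsilon>" for x c
  proof -
    have "g x c \<in> {x. G x = c}" using g2 that unfolding F_def by blast
    then show ?thesis by simp
  qed
  have fp: "fibre_prod G f T c = (\<Prod>x\<in>F. T - f (g x c))" if "c \<in> ball (l t0) \<epsilon>" for c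
  proof -
    have "inj_on (\<lambda>x. g x c) F" "{x. G x = c} = (\<lambda>x. g x c) ` F"
      using g2 that unfolding F_def by blast+
    then show ?thesis unfolding fibre_prod_def by (simp add: prod.reindex)
  qed
  obtain Df where Df: "\<And>x. (f has_derivative (\<lambda>h. \<Sum>i\<in>UNIV. Df i x * h $ i)) (at x)"
    using polyfun_has_derivative[OF f] by blast
  have lder: "(l has_derivative (\<lambda>\<tau>. \<tau> *s b)) (at t0)"
    unfolding l_def by (rule line_has_derivative)
  have diff1: "(\<lambda>t. f (g x (l t))) field_differentiable (at t0)" if x: "x \<in> F" for x
  proof -
    have gx: "g x (l t0) = x" "continuous_on (ball (l t0) \<epsilon>) (g x)" using x g1 by (auto simp: F_def)
    have "det (A x) \<noteq> 0" using x reg unfolding regular_value_def F_def l_def by simp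
    then obtain B where B: "B ** A x = mat 1" by (meson invertible_det_nz invertible_left_inverse)
    have "(g x has_derivative (\<lambda>h. B *v h)) (at (l t0))"
    proof (rule has_derivative_inverse_basic[where f = G and f' = "\<lambda>h. A x *v h" and T = "ball (l t0) \<epsilon>"])
      show "(G has_derivative (*v) (A x)) (at (g x (l t0)))" using G gx(1) by (simp add: polymap_def)
      show "(*v) B \<circ> (*v) (A x) = id" by (auto simp: fun_eq_iff matrix_vector_mul_assoc B)
      show "continuous (at (l t0)) (g x)"
        using gx(2) \<epsilon> by (simp add: continuous_on_eq_continuous_at)
      show "bounded_linear ((*v) B)" by (rule matrix_vector_mul_bounded_linear)
    qed (use \<epsilon> Gg[OF x] in auto)
    from has_derivative_compose[OF lder this]
    have "((\<lambda>t. g x (l t)) has_derivative (\<lambda>\<tau>. B *v (\<tau> *s b))) (at t0)" .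
    from has_derivative_compose[OF this Df[of "g x (l t0)"]]
    have "((\<lambda>t. f (g x (l t))) has_derivative
        (\<lambda>\<tau>. \<Sum>i\<in>UNIV. Df i (g x (l t0)) * (B *v (\<tau> *s b)) $ i)) (at t0)" .
    then have "((\<lambda>t. f (g x (l t))) has_derivative (*) (\<Sum>i\<in>UNIV. Df i (g x (l t0)) * (B *v b) $ i)) (at t0)"
    proof (rule has_derivative_eq_rhs)
      show "(\<lambda>\<tau>. \<Sum>i\<in>UNIV. Df i (g x (l t0)) * (B *v (\<tau> *s b)) $ i)
        = (*) (\<Sum>i\<in>UNIV. Df i (g x (l t0)) * (B *v b) $ i)"
      by (rule ext) (simp add: vector_scalar_commute sum_distrib_left mult.commute mult.left_commute)
    qed
    then show ?thesis unfolding field_differentiable_def has_field_derivative_def by (rule exI)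
  qed
  have "(\<lambda>t. \<Prod>x\<in>I. T - f (g x (l t))) field_differentiable (at t0)" if "finite I" "I \<subseteq> F" for I
    using that
  proof (induction I rule: finite_induct)
    case empty
    then show ?case by simp
  next
    case (insert x I)
    then have "(\<lambda>t. (T - f (g x (l t))) * (\<Prod>x\<in>I. T - f (g x (l t)))) field_differentiable (at t0)"
      by (intro field_differentiable_mult field_differentiable_diff field_differentiable_const diff1) auto
    then show ?case using insert.hyps by simp
  qed
  moreover have "finite F" unfolding F_def l_def by (rule polymap_sections(1)[OF G proper reg])
  ultimately have "(\<lambda>t. \<Prod>x\<in>F. T - f (g x (l t))) field_differentiable (at t0)" by blast
  then obtain f' where f': "((\<lambda>t. \<Prod>x\<in>F. T - f (g x (l t))) has_field_derivative f') (at t0)"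
    unfolding field_differentiable_def by (rule exE)
  have "continuous_on UNIV l" unfolding l_def continuous_on_def using line_tendsto by blast
  then have "open (l -` ball (l t0) \<epsilon>)" by (simp add: continuous_on_open_vimage)
  then have "((\<lambda>t. fibre_prod G f T (l t)) has_field_derivative f') (at t0)"
    by (rule has_field_derivative_transform_within_open[OF f']) (use fp \<epsilon> in simp_all)
  then show ?thesis unfolding l_def field_differentiable_def by (rule exI)
qed

text \<open>Let \<open>E T c\<close> be the value at \<open>T\<close> of the monic polynomial with roots \<open>f x\<close>, for \<open>x\<close> in the fibre over a value \<open>c\<close>
off the discriminant hypersurface. On a complex line through two such values, \<open>E T\<close> is bounded and
holomorphic off finitely many points, and therefore extends; by the Schwarz lemma it satisfies a
Lipschitz condition with a constant that does not depend on the line. Hence \<open>E T\<close> extends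
continuously across the hypersurface, and limits of monic polynomials of degree \<open>r\<close> are again such.\<close>
lemma characteristic_polynomials:
  fixes G :: "complex ^ 'k::finite \<Rightarrow> complex ^ 'k"
  assumes G: "polymap G A" "det (A x0) \<noteq> 0" and proper: "\<And>R. bounded {x. norm (G x) \<le> R}"
    and card: "\<And>c. regular_value G A c \<Longrightarrow> card {x. G x = c} = r" and f: "polyfun f"
  obtains P where "\<And>c. norm c < 1 \<Longrightarrow> degree (P c) = r" "\<And>c. norm c < 1 \<Longrightarrow> coeff (P c) r = 1"
    "\<And>T. continuous_on (ball 0 1) (\<lambda>c. poly (P c) T)"
    "\<And>x. norm (G x) < 1 \<Longrightarrow> poly (P (G x)) (f x) = 0"
proof -
  obtain p x1 where p: "polyfun p" "p (G x1) \<noteq> 0" and reg: "\<And>c. p c \<noteq> 0 \<Longrightarrow> regular_value G A c"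
    using discriminant_exists[OF G(1,2)] by blast
  have Gcont: "continuous_on S G" for S by (rule polymap_continuous[OF G(1)])
  have fin: "finite {x. G x = c}" if "p c \<noteq> 0" for c
    by (rule polymap_sections(1)[OF G(1) proper reg[OF that]])
  have cardf: "card {x. G x = c} = r" if "p c \<noteq> 0" for c by (rule card[OF reg[OF that]])
  define E where "E = (\<lambda>T c. fibre_prod G f T c)"
  obtain B where B: "B > 0" "\<And>x. norm (G x) \<le> 2 \<Longrightarrow> norm (f x) \<le> B"
  proof -
    have "closed (G -` cball 0 2)" by (rule closed_vimage[OF closed_cball Gcont])
    then have "compact {x. norm (G x) \<le> 2}"
      using proper[of 2] by (simp add: compact_eq_bounded_closed vimage_def)
    then have "bounded (f ` {x. norm (G x) \<le> 2})"
      by (intro compact_imp_bounded compact_continuous_image polyfun_continuous[OF f])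
    then show thesis using that unfolding bounded_pos by blast
  qed
  have Ebound: "norm (E T c) \<le> (norm T + B) ^ r" if "p c \<noteq> 0" "norm c \<le> 2" for T c
  proof -
    have "norm (E T c) = (\<Prod>y\<in>{x. G x = c}. norm (T - f y))"
      unfolding E_def fibre_prod_def by (rule prod_norm[symmetric])
    also have "\<dots> \<le> (\<Prod>y\<in>{x. G x = c}. norm T + B)"
    proof (rule prod_mono)
      fix y assume "y \<in> {x. G x = c}"
      then have "norm (f y) \<le> B" using B(2)[of y] that(2) by simp
      then show "0 \<le> norm (T - f y) \<and> norm (T - f y) \<le> norm T + B"
        using norm_triangle_ineq4[of T "f y"] by simp
    qed
    also have "\<dots> = (norm T + B) ^ r" by (simp add: cardf[OF that(1)])
    finally show ?thesis .
  qed
  define X where "X = {c. p c \<noteq> 0 \<and> norm c < 1}"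
  \<comment> \<open>The line \<open>l\<close> is parametrized so that \<open>a\<close> and \<open>b\<close> are at 0 and 1; it stays in the ball of radius 2
    for parameters up to \<open>1 / \<delta>\<close>.\<close>
  have lip: "norm (E T b - E T a) \<le> 2 * ((norm T + B) ^ r + 1) * norm (b - a)"
    if ab: "a \<in> X" "b \<in> X" "norm (b - a) < 1" for T a b
  proof (cases "a = b")
    case False
    define l where "l = (\<lambda>t. a + t *s (b - a))"
    define \<delta> where "\<delta> = norm (b - a)"
    have \<delta>: "\<delta> > 0" "\<delta> < 1" using False ab(3) by (auto simp: \<delta>_def)
    define Z where "Z = {t. p (l t) = 0}"
    have finZ: "finite Z" unfolding Z_def l_def
      by (rule polyfun_line_zeros_finite[OF p(1), of a 0]) (use ab(1) in \<open>simp add: X_def\<close>)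
    have l2: "norm (l t) \<le> 2" if "t \<in> ball 0 (1 / \<delta>)" for t
    proof -
      have "norm t * \<delta> < 1" using that \<delta>(1) by (simp add: field_simps)
      moreover have "norm (l t) \<le> norm a + norm t * \<delta>"
        unfolding l_def \<delta>_def by (metis norm_triangle_ineq norm_vector_smult)
      ultimately show ?thesis using ab(1) by (simp add: X_def)
    qed
    have hol: "(\<lambda>t. E T (l t)) holomorphic_on (ball 0 (1 / \<delta>) - Z)"
      unfolding holomorphic_on_def
    proof
      fix t assume "t \<in> ball 0 (1 / \<delta>) - Z"
      then have "regular_value G A (a + t *s (b - a))" using reg by (simp add: Z_def l_def)
      from fibre_prod_holomorphic_on_lines[OF G(1) proper f this]
      show "(\<lambda>t. E T (l t)) field_differentiable at t within ball 0 (1 / \<delta>) - Z"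
        unfolding E_def l_def by (rule field_differentiable_at_within)
    qed
    have bnd: "norm (E T (l t)) \<le> (norm T + B) ^ r" if "t \<in> ball 0 (1 / \<delta>) - Z" for t
      by (rule Ebound) (use that l2[of t] in \<open>auto simp: Z_def\<close>)
    obtain \<psi> where \<psi>: "\<psi> holomorphic_on ball 0 (1 / \<delta>)"
       "\<forall>t\<in>ball 0 (1 / \<delta>) - Z. \<psi> t = E T (l t)" "\<forall>t\<in>ball 0 (1 / \<delta>). norm (\<psi> t) \<le> (norm T + B) ^ r"
      using bounded_holomorphic_extension[OF finZ open_ball hol bnd] by blast
    have "norm (\<psi> 1 - \<psi> 0) \<le> 2 * ((norm T + B) ^ r + 1) / (1 / \<delta>)"
      by (rule bounded_holomorphic_lipschitz[OF \<psi>(1)]) (use \<delta> \<psi>(3) in \<open>auto simp: field_simps\<close>)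
    moreover have "\<psi> 0 = E T a" "\<psi> 1 = E T b"
      using \<psi>(2) \<delta> ab by (auto simp: Z_def l_def X_def)
    ultimately show ?thesis by (simp add: \<delta>_def)
  qed simp
  have "uniformly_continuous_on X (E T)" for T
    unfolding uniformly_continuous_on_def
  proof (intro allI impI)
    fix e :: real assume e: "e > 0"
    define C where "C = 2 * ((norm T + B) ^ r + 1)"
    have C: "C > 0" unfolding C_def using B(1) by (intro mult_pos_pos add_nonneg_pos zero_le_power) auto
    show "\<exists>d>0. \<forall>x\<in>X. \<forall>x'\<in>X. dist x' x < d \<longrightarrow> dist (E T x') (E T x) < e"
    proof (intro exI[of _ "min 1 (e / C)"] conjI ballI impI)
      fix a b assume ab: "a \<in> X" "b \<in> X" "dist b a < min 1 (e / C)"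
      then have "norm (E T b - E T a) \<le> C * norm (b - a)"
        unfolding C_def by (intro lip) (auto simp: dist_norm)
      also have "\<dots> < e" using ab(3) C by (simp add: dist_norm field_simps)
      finally show "dist (E T b) (E T a) < e" by (simp add: dist_norm)
    qed (use e C in simp)
  qed
  then have "\<exists>g. uniformly_continuous_on (closure X) g \<and> (\<forall>c\<in>X. E T c = g c)" for T
    using uniformly_continuous_on_extension_on_closure by metis
  then obtain g where g: "\<And>T. uniformly_continuous_on (closure X) (g T)" "\<And>T c. c \<in> X \<Longrightarrow> E T c = g T c"
    by metis
  have cl: "ball 0 1 \<subseteq> closure X"
  proof
    fix c :: "complex ^ 'k" assume c: "c \<in> ball 0 1"
    show "c \<in> closure X" unfolding closure_approachable
    proof (intro allI impI)
      fix e :: real assume "e > 0"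
      then obtain c' where "c' \<in> ball c e \<inter> ball 0 1" "p c' \<noteq> 0"
        using polyfun_nonzero_near[OF p(1,2) open_Int[OF open_ball open_ball], of c c e 0 1] c by auto
      then show "\<exists>y\<in>X. dist y c < e" by (intro bexI[of _ c']) (auto simp: X_def dist_commute)
    qed
  qed
  have gcont: "continuous_on (ball 0 1) (g T)" for T
    using g(1) cl by (meson continuous_on_subset uniformly_continuous_imp_continuous)
  have "\<exists>P. degree P = r \<and> coeff P r = 1 \<and> (\<forall>T. poly P T = g T c)" if c: "norm c < 1" for c
  proof -
    have cc: "c \<in> closure X" using cl c by auto
    then obtain s where s: "\<And>n. s n \<in> X" "s \<longlonglongrightarrow> c" unfolding closure_sequential by blast
    define Q where "Q = (\<lambda>n. \<Prod>y\<in>{x. G x = s n}. [:- f y, 1:])"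
    have sp: "p (s n) \<noteq> 0" for n using s(1) by (simp add: X_def)
    have polyQ: "poly (Q n) T = E T (s n)" for n T
      by (simp add: Q_def poly_prod E_def fibre_prod_def)
    have degQ: "degree (Q n) = r" for n
      unfolding Q_def by (subst degree_prod_eq_sum_degree) (auto simp: cardf[OF sp])
    have leadQ: "coeff (Q n) r = 1" for n
    proof -
      have "lead_coeff (Q n) = 1" unfolding Q_def by (simp add: lead_coeff_prod)
      then show ?thesis by (simp add: degQ)
    qed
    have lim: "(\<lambda>n. poly (Q n) T) \<longlonglongrightarrow> g T c" for T
    proof -
      have "continuous_on (closure X) (g T)" using g(1) uniformly_continuous_imp_continuous by blast
      then have "(\<lambda>n. g T (s n)) \<longlonglongrightarrow> g T c"
        by (rule continuous_on_tendsto_compose[OF _ s(2) cc]) (intro always_eventually allI subsetD[OF closure_subset] s(1))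
      then show ?thesis by (simp add: polyQ g(2)[OF s(1)])
    qed
    obtain P where P: "degree P \<le> r" "\<And>T. (\<lambda>n. poly (Q n) T) \<longlonglongrightarrow> poly P T"
      "\<And>i. (\<lambda>n. coeff (Q n) i) \<longlonglongrightarrow> coeff P i"
      by (rule poly_pointwise_limit[of Q r "{}" "\<lambda>T. g T c"]) (use degQ lim in auto)
    have "coeff P r = 1" using P(3)[of r] by (simp add: leadQ LIMSEQ_const_iff)
    moreover have "degree P = r" using P(1) calculation le_degree[of P r] by simp
    moreover have "poly P T = g T c" for T using LIMSEQ_unique[OF P(2) lim] .
    ultimately show ?thesis by blast
  qed
  then obtain P where P: "\<And>c. norm c < 1 \<Longrightarrow> degree (P c) = r" "\<And>c. norm c < 1 \<Longrightarrow> coeff (P c) r = 1"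
     "\<And>c T. norm c < 1 \<Longrightarrow> poly (P c) T = g T c" by metis
  \<comment> \<open>Over a value \<open>G (y n)\<close> off the hypersurface, one factor of the product at \<open>T = f x\<close> is small and the
    others are bounded.\<close>
  have root: "poly (P (G x)) (f x) = 0" if x: "norm (G x) < 1" for x
  proof -
    have pG: "polyfun (\<lambda>x. p (G x))" using G(1) by (intro polyfun_compose[OF p(1)]) (simp add: polymap_def)
    have "\<exists>y. dist y x < inverse (real (Suc n)) \<and> norm (G y) < 1 \<and> p (G y) \<noteq> 0" for n
    proof -
      have "open (G -` ball 0 1)" by (rule open_vimage[OF open_ball Gcont])
      then have "open (ball x (inverse (real (Suc n))) \<inter> G -` ball 0 1)" by (rule open_Int[OF open_ball])
      moreover have "x \<in> ball x (inverse (real (Suc n))) \<inter> G -` ball 0 1" using x by simp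
      ultimately obtain y where "y \<in> ball x (inverse (real (Suc n))) \<inter> G -` ball 0 1" "p (G y) \<noteq> 0"
        using polyfun_nonzero_near[OF pG p(2)] by blast
      then show ?thesis by (intro exI[of _ y]) (auto simp: dist_commute)
    qed
    then obtain y where y: "\<And>n. dist (y n) x < inverse (real (Suc n))" "\<And>n. norm (G (y n)) < 1"
       "\<And>n. p (G (y n)) \<noteq> 0" by metis
    have "(\<lambda>n. dist (y n) x) \<longlonglongrightarrow> 0"
      by (rule tendsto_sandwich[OF _ _ tendsto_const LIMSEQ_inverse_real_of_nat])
         (use y(1) in \<open>auto intro!: always_eventually less_imp_le simp del: of_nat_Suc\<close>)
    then have yx: "y \<longlonglongrightarrow> x" using tendsto_dist_iff by blast
    have Gy: "(\<lambda>n. G (y n)) \<longlonglongrightarrow> G x"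
      by (rule continuous_on_tendsto_compose[OF Gcont[of UNIV] yx]) auto
    have fy: "(\<lambda>n. f (y n)) \<longlonglongrightarrow> f x"
      by (rule continuous_on_tendsto_compose[OF polyfun_continuous[OF f, of UNIV] yx]) auto
    have lim1: "(\<lambda>n. g (f x) (G (y n))) \<longlonglongrightarrow> g (f x) (G x)"
      by (rule continuous_on_tendsto_compose[OF gcont Gy]) (use x y(2) in auto)
    have bound: "norm (E (f x) (G (y n))) \<le> norm (f x - f (y n)) * (norm (f x) + B + 1) ^ r" for n
    proof -
      define F where "F = {z. G z = G (y n)}"
      have F: "finite F" "y n \<in> F" using fin[OF y(3)] by (auto simp: F_def)
      have "norm (E (f x) (G (y n))) = (\<Prod>z\<in>F. norm (f x - f z))"
        unfolding E_def fibre_prod_def F_def by (rule prod_norm[symmetric])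
      also have "\<dots> = norm (f x - f (y n)) * (\<Prod>z\<in>F - {y n}. norm (f x - f z))"
        using F by (simp add: prod.remove)
      also have "\<dots> \<le> norm (f x - f (y n)) * (\<Prod>z\<in>F - {y n}. norm (f x) + B + 1)"
      proof (intro mult_left_mono prod_mono)
        fix z assume "z \<in> F - {y n}"
        then have "norm (f z) \<le> B" using B(2)[of z] y(2)[of n] by (simp add: F_def)
        then show "0 \<le> norm (f x - f z) \<and> norm (f x - f z) \<le> norm (f x) + B + 1"
          using norm_triangle_ineq4[of "f x" "f z"] by simp
      qed simp
      also have "\<dots> \<le> norm (f x - f (y n)) * (norm (f x) + B + 1) ^ r"
      proof -
        have "card (F - {y n}) \<le> r" using cardf[OF y(3)[of n]] F by (simp add: F_def)
        then have "(norm (f x) + B + 1) ^ card (F - {y n}) \<le> (norm (f x) + B + 1) ^ r"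
          using B(1) by (intro power_increasing) auto
        then show ?thesis by (simp add: mult_left_mono)
      qed
      finally show ?thesis .
    qed
    have "(\<lambda>n. norm (f x - f (y n)) * (norm (f x) + B + 1) ^ r) \<longlonglongrightarrow> norm (f x - f x) * (norm (f x) + B + 1) ^ r"
      by (intro tendsto_intros fy)
    then have "(\<lambda>n. norm (f x - f (y n)) * (norm (f x) + B + 1) ^ r) \<longlonglongrightarrow> 0" by simp
    then have "(\<lambda>n. E (f x) (G (y n))) \<longlonglongrightarrow> 0"
      by (rule Lim_null_comparison[rotated]) (use bound in \<open>auto intro: always_eventually\<close>)
    moreover have "E (f x) (G (y n)) = g (f x) (G (y n))" for n
      by (rule g(2)) (use y in \<open>simp add: X_def\<close>)
    ultimately have "g (f x) (G x) = 0" using LIMSEQ_unique[OF lim1] by simp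
    then show ?thesis using P(3)[OF x] by simp
  qed
  have Pcont: "continuous_on (ball 0 1) (\<lambda>c. poly (P c) T)" for T
    using gcont[of T] by (rule continuous_on_eq) (use P(3) in simp)
  show thesis by (rule that[OF P(1,2) Pcont root])
qed

section \<open>Counting invariant subspaces\<close>

lemma finite_family_subsequence:
  fixes u :: "'j \<Rightarrow> nat \<Rightarrow> 'a::heine_borel"
  assumes "finite J" "\<And>j. j \<in> J \<Longrightarrow> bounded (range (u j))"
  shows "\<exists>p s. strict_mono (s :: nat \<Rightarrow> nat) \<and> (\<forall>j\<in>J. (\<lambda>n. u j (s n)) \<longlonglongrightarrow> p j)"
  using assms
proof (induction J rule: finite_induct)
  case empty
  show ?case by (rule exI, rule exI[of _ id]) (simp add: strict_mono_def)
next
  case (insert j J)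
  then obtain p s where ps: "strict_mono s" "\<And>j. j \<in> J \<Longrightarrow> (\<lambda>n. u j (s n)) \<longlonglongrightarrow> p j" by auto
  have "bounded (range (\<lambda>n. u j (s n)))"
    by (rule bounded_subset[OF insert.prems[of j]]) auto
  then obtain l s' where s': "strict_mono s'" "((\<lambda>n. u j (s n)) \<circ> s') \<longlonglongrightarrow> l"
    using bounded_imp_convergent_subsequence by blast
  have "(\<lambda>n. u i ((s \<circ> s') n)) \<longlonglongrightarrow> (p(j := l)) i" if "i \<in> insert j J" for i
  proof (cases "i = j")
    case True
    then show ?thesis using s'(2) by (simp add: o_def)
  next
    case False
    then show ?thesis using that LIMSEQ_subseq_LIMSEQ[OF ps(2) s'(1), of i] by (simp add: o_def)
  qed
  then show ?case using strict_mono_o[OF ps(1) s'(1)] by blast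
qed

text \<open>Among the linear forms with coefficients 1, \<open>t\<close>, \<open>t\<^sup>2\<close>, ..., only finitely many values of \<open>t\<close> fail to
separate a given pair of points, and there are countably many pairs.\<close>
lemma separating_linear_form:
  fixes Y :: "(complex ^ 'k::finite) set"
  assumes "countable Y"
  obtains f where "polyfun f" "inj_on f Y" "f 0 = 0"
proof -
  obtain h where h: "bij_betw h (UNIV :: 'k set) {0..<CARD('k)}"
    using ex_bij_betw_finite_nat[of "UNIV :: 'k set"] by auto
  define f :: "complex \<Rightarrow> complex ^ 'k \<Rightarrow> complex" where "f = (\<lambda>t x. \<Sum>i\<in>UNIV. x $ i * t ^ h i)"
  have fin: "finite {t. f t x = f t y}" if xy: "x \<noteq> y" for x y
  proof -
    define q where "q = (\<Sum>i\<in>(UNIV :: 'k set). Polynomial.monom (x $ i - y $ i) (h i))"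
    have "poly q t = f t x - f t y" for t
      by (simp add: q_def poly_sum poly_monom f_def left_diff_distrib sum_subtractf)
    then have eq: "{t. f t x = f t y} = {t. poly q t = 0}" by auto
    obtain j where j: "x $ j \<noteq> y $ j" using xy by (auto simp: vec_eq_iff)
    have "coeff q (h j) = (\<Sum>i\<in>UNIV. if i = j then x $ j - y $ j else 0)"
      unfolding q_def coeff_sum by (intro sum.cong refl) (use h in \<open>auto simp: bij_betw_def inj_on_def\<close>)
    then have "q \<noteq> 0" using j by auto
    then show ?thesis unfolding eq by (rule poly_roots_finite)
  qed
  define bad where "bad = (\<Union>(x,y)\<in>{p\<in>Y \<times> Y. fst p \<noteq> snd p}. {t. f t x = f t y})"
  have "countable bad" unfolding bad_def using assms fin by (intro countable_UN countable_subset[OF _ countable_SIGMA[OF assms assms]])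
      (auto intro!: countable_finite)
  then have "bad \<noteq> UNIV" using uncountable_UNIV_complex by auto
  then obtain t where t: "t \<notin> bad" by auto
  have "polyfun (f t)" unfolding f_def by (intro polyfun_intros)
  moreover have "inj_on (f t) Y" 
  proof (rule inj_onI)
    fix x y assume "x \<in> Y" "y \<in> Y" "f t x = f t y"
    then show "x = y" using t by (auto simp: bad_def)
  qed
  moreover have "f t 0 = 0" by (simp add: f_def)
  ultimately show thesis by (rule that)
qed

lemma roots_product_dvd:
  fixes p :: "'a::idom poly"
  assumes "finite J" "inj_on a J" "\<And>j. j \<in> J \<Longrightarrow> poly p (a j) = 0"
  shows "(\<Prod>j\<in>J. [:- a j, 1:]) dvd p"
  using assms
proof (induction J rule: finite_induct)
  case (insert j J)
  then obtain q where q: "p = (\<Prod>j\<in>J. [:- a j, 1:]) * q" by (auto elim: dvdE)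
  have "poly (\<Prod>i\<in>J. [:- a i, 1:]) (a j) \<noteq> 0"
    using insert by (auto simp: poly_prod inj_on_def)
  moreover have "poly p (a j) = 0" using insert.prems by simp
  ultimately have "poly q (a j) = 0" using q by simp
  then have "[:- a j, 1:] dvd q" by (simp add: poly_eq_0_iff_dvd)
  then show ?case using insert.hyps q by (simp add: mult.commute mult_dvd_mono del: mult_pCons_left mult_pCons_right)
qed simp

text \<open>Divide each polynomial by the product of its known linear factors. The quotients converge
at all but finitely many points, hence to a polynomial, and the factorization passes to the limit.\<close>
lemma root_multiplicity_limit:
  fixes P :: "nat \<Rightarrow> complex poly" and \<rho> :: "'l \<Rightarrow> nat \<Rightarrow> complex"
  assumes J: "finite J" and deg: "\<And>n. degree (P n) \<le> r" and nz: "\<And>n. P n \<noteq> 0" "P0 \<noteq> 0"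
    and lim: "\<And>T. (\<lambda>n. poly (P n) T) \<longlonglongrightarrow> poly P0 T"
    and root: "\<And>n j. j \<in> J \<Longrightarrow> poly (P n) (\<rho> j n) = 0" and inj: "\<And>n. inj_on (\<lambda>j. \<rho> j n) J"
    and \<rho>lim: "\<And>j. j \<in> J \<Longrightarrow> \<rho> j \<longlonglongrightarrow> \<sigma> j"
  shows "card {j\<in>J. \<sigma> j = t} \<le> order t P0"
proof -
  define R where "R = (\<lambda>n. \<Prod>j\<in>J. [:- \<rho> j n, 1:])"
  define S where "S = (\<Prod>j\<in>J. [:- \<sigma> j, 1:])"
  have "R n dvd P n" for n
    unfolding R_def by (rule roots_product_dvd[OF J inj root])
  then obtain Q where Q: "\<And>n. P n = R n * Q n" unfolding dvd_def by metis
  have polyR: "poly (R n) T = (\<Prod>j\<in>J. T - \<rho> j n)" for n T by (simp add: R_def poly_prod)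
  have polyS: "poly S T = (\<Prod>j\<in>J. T - \<sigma> j)" for T by (simp add: S_def poly_prod)
  have RS: "(\<lambda>n. poly (R n) T) \<longlonglongrightarrow> poly S T" for T
    unfolding polyR polyS by (intro tendsto_intros \<rho>lim)
  have degQ: "degree (Q n) \<le> r" for n
    using deg[of n] nz(1)[of n] Q[of n] degree_mult_eq[of "R n" "Q n"] by (cases "Q n = 0") auto
  have limQ: "(\<lambda>n. poly (Q n) T) \<longlonglongrightarrow> poly P0 T / poly S T" if T: "T \<notin> \<sigma> ` J" for T
  proof -
    have S0: "poly S T \<noteq> 0" unfolding polyS using T J by auto
    have "(\<lambda>n. poly (P n) T / poly (R n) T) \<longlonglongrightarrow> poly P0 T / poly S T"
      by (intro tendsto_divide lim RS S0)
    moreover have "\<forall>\<^sub>F n in sequentially. poly (P n) T / poly (R n) T = poly (Q n) T"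
      using tendsto_imp_eventually_ne[OF RS S0] by eventually_elim (subst Q, simp)
    ultimately show ?thesis by (rule Lim_transform_eventually)
  qed
  obtain \<xi> where \<xi>: "\<And>T. (\<lambda>n. poly (Q n) T) \<longlonglongrightarrow> poly \<xi> T"
    by (rule poly_pointwise_limit[OF degQ _ limQ]) (use J in auto)
  have "poly P0 T = poly (S * \<xi>) T" for T
  proof (rule LIMSEQ_unique[OF lim])
    have "(\<lambda>n. poly (R n) T * poly (Q n) T) \<longlonglongrightarrow> poly S T * poly \<xi> T" by (intro tendsto_mult RS \<xi>)
    then show "(\<lambda>n. poly (P n) T) \<longlonglongrightarrow> poly (S * \<xi>) T" by (simp flip: Q poly_mult)
  qed
  then have "P0 = S * \<xi>" by (metis poly_eq_poly_eq_iff ext)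
  moreover have "[:- t, 1:] ^ card {j\<in>J. \<sigma> j = t} dvd S"
  proof -
    have "(\<Prod>j\<in>{j\<in>J. \<sigma> j = t}. [:- \<sigma> j, 1:]) dvd S" unfolding S_def by (rule prod_dvd_prod_subset[OF J]) auto
    moreover have "(\<Prod>j\<in>{j\<in>J. \<sigma> j = t}. [:- \<sigma> j, 1:]) = [:- t, 1:] ^ card {j\<in>J. \<sigma> j = t}" by simp
    ultimately show ?thesis by simp
  qed
  ultimately have "[:- t, 1:] ^ card {j\<in>J. \<sigma> j = t} dvd P0" by simp
  then show ?thesis using nz(2) by (simp add: order_divides)
qed

text \<open>The limit argument of the introduction. The points \<open>h \<nu> l\<close> are the solutions in \<open>L\<close> over the value
\<open>c L \<nu>\<close>, which tends to 0, and \<open>p l\<close> is the limit of a subsequence. By local injectivity of \<open>G\<close> at the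
origin at most one of the \<open>p l\<close> is 0; the nonzero ones belong to different fixed points for different
\<open>L\<close>.\<close>
lemma invariant_subspaces_bound:
  fixes H :: "complex ^ 'k::finite \<Rightarrow> complex ^ 'k"
  assumes H: "nondegenerate_homogeneous e H" and e: "e \<ge> 2" and I: "finite I"
    and L: "\<And>L. L \<in> I \<Longrightarrow> vec.subspace L" "\<And>L. L \<in> I \<Longrightarrow> vec.dim L = n"
      "\<And>L x. L \<in> I \<Longrightarrow> x \<in> L \<Longrightarrow> H x \<in> L"
    and disj: "\<And>L L'. L \<in> I \<Longrightarrow> L' \<in> I \<Longrightarrow> L \<noteq> L' \<Longrightarrow> L \<inter> L' \<subseteq> {0}"
  shows "1 + card I * (e ^ n - 1) \<le> e ^ CARD('k)"
proof -
  define G where "G = (\<lambda>x. H x - x)"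
  obtain A where A: "polymap G A" "det (A 0) \<noteq> 0" "\<And>R. bounded {x. norm (G x) \<le> R}"
    "\<And>c. regular_value G A c \<Longrightarrow> card {x. G x = c} = e ^ CARD('k)"
    unfolding G_def by (rule fixed_point_count[OF H e]) blast
  define r where "r = e ^ CARD('k)"
  have card: "card {x. G x = c} = r" if "regular_value G A c" for c using A(4)[OF that] by (simp add: r_def)
  have "H (0 *s 0) = 0 ^ e *s H 0" using H unfolding nondegenerate_homogeneous_def by blast
  then have "H 0 = 0" using e by (simp add: power_0_left)
  then have G0: "G 0 = 0" by (simp add: G_def)
  define Fix where "Fix = {x. G x = 0}"
  have "finite Fix"
  proof -
    have "finite ((\<lambda>x. x $ i) ` Fix)" for i
    proof -
      obtain P where P: "\<And>c. norm c < 1 \<Longrightarrow> degree (P c) = r" "\<And>c. norm c < 1 \<Longrightarrow> coeff (P c) r = 1"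
        "\<And>T. continuous_on (ball 0 1) (\<lambda>c. poly (P c) T)" "\<And>x. norm (G x) < 1 \<Longrightarrow> poly (P (G x)) (x $ i) = 0"
      proof (rule characteristic_polynomials[OF A(1,2,3) card polyfun_coord[of i]])
        fix P
        assume "\<And>c. norm c < 1 \<Longrightarrow> degree (P c) = r" "\<And>c. norm c < 1 \<Longrightarrow> coeff (P c) r = 1"
          "\<And>T. continuous_on (ball 0 1) (\<lambda>c. poly (P c) T)" "\<And>x. norm (G x) < 1 \<Longrightarrow> poly (P (G x)) (x $ i) = 0"
        then show thesis by (rule that)
      qed
      have "P 0 \<noteq> 0" using P(2)[of 0] by auto
      moreover have "(\<lambda>x. x $ i) ` Fix \<subseteq> {t. poly (P 0) t = 0}"
      proof (intro image_subsetI CollectI)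
        fix x assume "x \<in> Fix"
        then show "poly (P 0) (x $ i) = 0" using P(4)[of x] by (simp add: Fix_def)
      qed
      ultimately show ?thesis using poly_roots_finite finite_subset by blast
    qed
    then have "finite (PiE UNIV (\<lambda>i. (\<lambda>x. x $ i) ` Fix))" by (intro finite_PiE) auto
    moreover have "vec_nth ` Fix \<subseteq> PiE UNIV (\<lambda>i. (\<lambda>x. x $ i) ` Fix)" by auto
    ultimately have "finite (vec_nth ` Fix)" using finite_subset by blast
    then show ?thesis by (rule finite_imageD) (simp add: inj_on_def vec_nth_inject)
  qed
  define m where "m = e ^ n"
  define near where "near = (\<lambda>L \<nu> c X. norm c < inverse (real (Suc \<nu>)) \<and> X \<subseteq> L \<and>
       finite X \<and> card X = m \<and> (\<forall>x\<in>X. G x = c))"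
  have "\<exists>c X. near L \<nu> c X" if "L \<in> I" for L \<nu>
  proof -
    have "inverse (real (Suc \<nu>)) > 0" by simp
    from invariant_subspace_count[OF H e L(1,2,3)[OF that] this]
    show ?thesis unfolding near_def G_def m_def by blast
  qed
  then obtain c X where "\<And>L \<nu>. L \<in> I \<Longrightarrow> near L \<nu> (c L \<nu>) (X L \<nu>)" by metis
  then have cX: "norm (c L \<nu>) < inverse (real (Suc \<nu>)) \<and> X L \<nu> \<subseteq> L \<and>
       finite (X L \<nu>) \<and> card (X L \<nu>) = m \<and> (\<forall>x\<in>X L \<nu>. G x = c L \<nu>)" if "L \<in> I" for L \<nu>
    using that unfolding near_def by blast
  \<comment> \<open>\<open>f\<close> has to separate the fixed points and also the solutions over each \<open>c L \<nu>\<close>\<close>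
  define Y where "Y = Fix \<union> (\<Union>L\<in>I. \<Union>\<nu>. X L \<nu>)"
  have "countable Y" unfolding Y_def using \<open>finite Fix\<close> I cX
    by (intro countable_Un countable_UN) (auto intro: countable_finite)
  then obtain f where f: "polyfun f" "inj_on f Y" "f 0 = 0" by (rule separating_linear_form)
  obtain P where P: "\<And>c. norm c < 1 \<Longrightarrow> degree (P c) = r" "\<And>c. norm c < 1 \<Longrightarrow> coeff (P c) r = 1"
    "\<And>T. continuous_on (ball 0 1) (\<lambda>c. poly (P c) T)"
    "\<And>x. norm (G x) < 1 \<Longrightarrow> poly (P (G x)) (f x) = 0"
  proof (rule characteristic_polynomials[OF A(1,2,3) card f(1)])
    fix P
    assume "\<And>c. norm c < 1 \<Longrightarrow> degree (P c) = r" "\<And>c. norm c < 1 \<Longrightarrow> coeff (P c) r = 1"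
      "\<And>T. continuous_on (ball 0 1) (\<lambda>c. poly (P c) T)" "\<And>x. norm (G x) < 1 \<Longrightarrow> poly (P (G x)) (f x) = 0"
    then show thesis by (rule that)
  qed
  have P0: "P 0 \<noteq> 0" using P(2)[of 0] by auto
  define lims where "lims = (\<lambda>L p. (\<forall>l<m. p l \<in> Fix \<inter> L) \<and> card {l. l < m \<and> p l = 0} \<le> 1 \<and>
        (\<forall>t. card {l. l < m \<and> f (p l) = t} \<le> order t (P 0)))"
  have "\<exists>p. lims L p" if LI: "L \<in> I" for L
  proof -
    have "\<exists>h. bij_betw h {0..<m} (X L \<nu>)" for \<nu>
      using ex_bij_betw_nat_finite[of "X L \<nu>"] cX[OF LI, of \<nu>] by auto
    then obtain h where h: "\<And>\<nu>. bij_betw (h \<nu>) {0..<m} (X L \<nu>)" by metis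
    have hX: "h \<nu> l \<in> X L \<nu>" if "l < m" for \<nu> l using h[of \<nu>] that by (auto simp: bij_betw_def)
    have c1: "norm (c L \<nu>) < 1" for \<nu>
    proof -
      have "norm (c L \<nu>) < inverse (real (Suc \<nu>))" using cX[OF LI] by blast
      also have "\<dots> \<le> 1" by (simp add: field_simps)
      finally show ?thesis .
    qed
    have Gh: "G (h \<nu> l) = c L \<nu>" if "l < m" for \<nu> l using hX[OF that] cX[OF LI] by blast
    have "bounded (range (\<lambda>\<nu>. h \<nu> l))" if "l \<in> {..<m}" for l
      by (rule bounded_subset[OF A(3)[of 1]]) (use that Gh c1 in \<open>auto intro: less_imp_le\<close>)
    then obtain p s where ps: "strict_mono (s :: nat \<Rightarrow> nat)" "\<And>l. l < m \<Longrightarrow> (\<lambda>\<nu>. h (s \<nu>) l) \<longlonglongrightarrow> p l"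
      using finite_family_subsequence[of "{..<m}" "\<lambda>l \<nu>. h \<nu> l"] by auto
    have "(\<lambda>\<nu>. c L \<nu>) \<longlonglongrightarrow> 0"
      by (rule Lim_null_comparison[OF _ LIMSEQ_inverse_real_of_nat])
         (use cX[OF LI] in \<open>auto intro!: always_eventually less_imp_le simp del: of_nat_Suc\<close>)
    then have cs: "(\<lambda>\<nu>. c L (s \<nu>)) \<longlonglongrightarrow> 0" using LIMSEQ_subseq_LIMSEQ[OF _ ps(1)] by (auto simp: o_def)
    have Gp: "G (p l) = 0" if "l < m" for l
    proof (rule LIMSEQ_unique)
      show "(\<lambda>\<nu>. G (h (s \<nu>) l)) \<longlonglongrightarrow> G (p l)"
        by (rule continuous_on_tendsto_compose[OF polymap_continuous[OF A(1), of UNIV] ps(2)[OF that]]) auto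
      show "(\<lambda>\<nu>. G (h (s \<nu>) l)) \<longlonglongrightarrow> 0" using cs by (simp add: Gh[OF that])
    qed
    have "closed L"
    proof (rule closed_subspace)
      have "r *\<^sub>R x = complex_of_real r *s x" for r and x :: "complex ^ 'k"
        unfolding vec_eq_iff vector_scaleR_component vector_smult_component by (simp add: scaleR_conv_of_real)
      then show "subspace L"
        using L(1)[OF LI] by (simp add: subspace_def vec.subspace_def)
    qed
    then have pL: "p l \<in> L" if "l < m" for l
      by (rule closed_sequentially[OF _ _ ps(2)[OF that]]) (use hX[OF that] cX[OF LI] in blast)
    have "card {l. l < m \<and> p l = 0} \<le> 1"
    proof (rule ccontr)
      assume "\<not> card {l. l < m \<and> p l = 0} \<le> 1"
      then obtain l l' where ll: "l < m" "p l = 0" "l' < m" "p l' = 0" "l \<noteq> l'"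
        by (auto simp: card_le_Suc0_iff_eq not_le)
      obtain U where U: "open U" "0 \<in> U" "inj_on G U" by (rule local_injectivity[OF A(1,2)])
      have "\<forall>\<^sub>F \<nu> in sequentially. h (s \<nu>) l \<in> U" "\<forall>\<^sub>F \<nu> in sequentially. h (s \<nu>) l' \<in> U"
        using topological_tendstoD[OF ps(2) U(1)] ll U(2) by auto
      then have "\<forall>\<^sub>F \<nu> in sequentially. h (s \<nu>) l \<in> U \<and> h (s \<nu>) l' \<in> U" by (rule eventually_conj)
      then obtain \<nu> where \<nu>: "h (s \<nu>) l \<in> U" "h (s \<nu>) l' \<in> U"
        using eventually_happens'[OF sequentially_bot] by blast
      then have "h (s \<nu>) l = h (s \<nu>) l'" using U(3) Gh ll by (auto simp: inj_on_def)
      then show False using h[of "s \<nu>"] ll by (auto simp: bij_betw_def inj_on_def)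
    qed
    moreover have "card {l. l < m \<and> f (p l) = t} \<le> order t (P 0)" for t
    proof -
      have fcont: "continuous_on UNIV f" by (rule polyfun_continuous[OF f(1)])
      have "card {l \<in> {..<m}. f (p l) = t} \<le> order t (P 0)"
      proof (rule root_multiplicity_limit[where P = "\<lambda>\<nu>. P (c L (s \<nu>))" and r = r and \<rho> = "\<lambda>l \<nu>. f (h (s \<nu>) l)"])
        fix \<nu>
        show "degree (P (c L (s \<nu>))) \<le> r" using P(1)[OF c1] by simp
        show "P (c L (s \<nu>)) \<noteq> 0" using P(2)[OF c1, of "s \<nu>"] by auto
        show "inj_on (\<lambda>l. f (h (s \<nu>) l)) {..<m}"
        proof (rule inj_onI)
          fix l l' assume l: "l \<in> {..<m}" "l' \<in> {..<m}" "f (h (s \<nu>) l) = f (h (s \<nu>) l')"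
          then have "h (s \<nu>) l \<in> Y" "h (s \<nu>) l' \<in> Y" using hX LI by (auto simp: Y_def)
          then have "h (s \<nu>) l = h (s \<nu>) l'" using f(2) l(3) by (auto simp: inj_on_def)
          then show "l = l'" using h[of "s \<nu>"] l by (auto simp: bij_betw_def inj_on_def)
        qed
        fix l assume l: "l \<in> {..<m}"
        then show "poly (P (c L (s \<nu>))) (f (h (s \<nu>) l)) = 0"
          using P(4)[of "h (s \<nu>) l"] Gh[of l "s \<nu>"] c1 by simp
      next
        fix T
        show "(\<lambda>\<nu>. poly (P (c L (s \<nu>))) T) \<longlonglongrightarrow> poly (P 0) T"
          by (rule continuous_on_tendsto_compose[OF P(3) cs]) (use c1 in auto)
      next
        fix l assume "l \<in> {..<m}"
        then show "(\<lambda>\<nu>. f (h (s \<nu>) l)) \<longlonglongrightarrow> f (p l)"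
          by (intro continuous_on_tendsto_compose[OF fcont ps(2)]) auto
      qed (use P0 in auto)
      then show ?thesis by simp
    qed
    ultimately have "lims L p" using Gp pL by (auto simp: Fix_def lims_def)
    then show ?thesis by (intro exI[of _ p])
  qed
  then obtain p where p0: "\<And>L. L \<in> I \<Longrightarrow> lims L (p L)" by metis
  have p: "\<And>L l. L \<in> I \<Longrightarrow> l < m \<Longrightarrow> p L l \<in> Fix \<inter> L"
    "\<And>L. L \<in> I \<Longrightarrow> card {l. l < m \<and> p L l = 0} \<le> 1"
    "\<And>L t. L \<in> I \<Longrightarrow> card {l. l < m \<and> f (p L l) = t} \<le> order t (P 0)"
    using p0 unfolding lims_def by blast+
  define W where "W = (\<lambda>L. {l. l < m \<and> p L l \<noteq> 0})"
  have W: "m - 1 \<le> card (W L)" if "L \<in> I" for L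
  proof -
    have "W L = {..<m} - {l. l < m \<and> p L l = 0}" by (auto simp: W_def)
    then have "card (W L) = m - card {l. l < m \<and> p L l = 0}" by (simp add: card_Diff_subset subset_eq)
    then show ?thesis using p(2)[OF that] by simp
  qed
  have fFix: "inj_on f Fix" using f(2) by (rule inj_on_subset) (simp add: Y_def)
  have zeroFix: "0 \<in> Fix" using G0 by (simp add: Fix_def)
  have "1 + card I * (m - 1) \<le> 1 + (\<Sum>L\<in>I. card (W L))"
    using sum_mono[of I "\<lambda>_. m - 1" "\<lambda>L. card (W L)"] W by simp
  also have "(\<Sum>L\<in>I. card (W L)) = (\<Sum>L\<in>I. \<Sum>x\<in>Fix - {0}. card {l\<in>W L. p L l = x})"
  proof (rule sum.cong[OF refl])
    fix L assume "L \<in> I"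
    then have "p L ` W L \<subseteq> Fix - {0}" using p(1) by (auto simp: W_def)
    then show "card (W L) = (\<Sum>x\<in>Fix - {0}. card {l\<in>W L. p L l = x})"
      using sum.group[of "W L" "Fix - {0}" "p L" "\<lambda>_. 1::nat"] \<open>finite Fix\<close> by (simp add: W_def)
  qed
  also have "\<dots> = (\<Sum>x\<in>Fix - {0}. \<Sum>L\<in>I. card {l\<in>W L. p L l = x})" by (rule sum.swap)
  also have "\<dots> \<le> (\<Sum>x\<in>Fix - {0}. order (f x) (P 0))"
  proof (rule sum_mono)
    fix x assume x: "x \<in> Fix - {0}"
    have zero: "card {l\<in>W L. p L l = x} = 0" if "L \<in> I" "x \<notin> L" for L
    proof -
      have "{l\<in>W L. p L l = x} = {}" using p(1) that by (auto simp: W_def)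
      then show ?thesis by (simp only: card.empty)
    qed
    show "(\<Sum>L\<in>I. card {l\<in>W L. p L l = x}) \<le> order (f x) (P 0)"
    proof (cases "\<exists>L\<in>I. x \<in> L")
      case True
      then obtain L where LI: "L \<in> I" "x \<in> L" by blast
      have notin: "x \<notin> L'" if "L' \<in> I - {L}" for L' using disj[of L L'] that LI x by auto
      have "card {l\<in>W L'. p L' l = x} = 0" if "L' \<in> I - {L}" for L'
        by (rule zero[OF _ notin[OF that]]) (use that in blast)
      then have "(\<Sum>L\<in>I - {L}. card {l\<in>W L. p L l = x}) = 0" by (intro sum.neutral ballI)
      then have "(\<Sum>L\<in>I. card {l\<in>W L. p L l = x}) = card {l\<in>W L. p L l = x}"
        unfolding sum.remove[OF I LI(1)] by simp
      also have "\<dots> \<le> card {l. l < m \<and> f (p L l) = f x}"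
        by (intro card_mono) (auto simp: W_def)
      also have "\<dots> \<le> order (f x) (P 0)" by (rule p(3)[OF LI(1)])
      finally show ?thesis .
    next
      case False
      then have "(\<Sum>L\<in>I. card {l\<in>W L. p L l = x}) = 0"
        by (intro sum.neutral ballI zero) auto
      then show ?thesis by (simp only: le0)
    qed
  qed
  also have "1 + (\<Sum>x\<in>Fix - {0}. order (f x) (P 0)) \<le> (\<Sum>x\<in>Fix. order (f x) (P 0))"
  proof -
    have "poly (P 0) (f 0) = 0" using P(4)[of 0] G0 by simp
    then have "order (f 0) (P 0) \<ge> 1" using P0 by (simp add: order_root)
    then show ?thesis using sum.remove[OF \<open>finite Fix\<close> zeroFix, of "\<lambda>x. order (f x) (P 0)"] by simp
  qed
  also have "\<dots> = (\<Sum>t\<in>f ` Fix. count (proots (P 0)) t)"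
    using P0 by (simp add: sum.reindex[OF fFix])
  also have "\<dots> \<le> size (proots (P 0))"
  proof -
    have "(\<Sum>t\<in>f ` Fix. count (proots (P 0)) t) = (\<Sum>t\<in>f ` Fix \<inter> set_mset (proots (P 0)). count (proots (P 0)) t)"
      using \<open>finite Fix\<close> by (intro sum.mono_neutral_right) (auto simp: not_in_iff)
    also have "\<dots> \<le> (\<Sum>t\<in>set_mset (proots (P 0)). count (proots (P 0)) t)"
      by (rule sum_mono2) auto
    finally show ?thesis by (simp add: size_multiset_overloaded_eq)
  qed
  also have "\<dots> \<le> r" using size_proots_le[of "P 0"] P(1)[of 0] by simp
  finally show ?thesis by (simp add: m_def r_def)
qed

section \<open>Polynomials, their gradients and symplectic forms\<close>

lemma poly_eval_superset:
  assumes "finite S" "Poly_Mapping.keys F \<subseteq> S"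
  shows "poly_eval F x = (\<Sum>\<alpha>\<in>S. Poly_Mapping.lookup F \<alpha> * monom_fun (Poly_Mapping.lookup \<alpha>) x)"
  unfolding poly_eval_def monom_fun_def
  by (rule sum.mono_neutral_left) (use assms in \<open>auto simp: in_keys_iff\<close>)

lemma poly_eval_monom_fun:
  "poly_eval F x = (\<Sum>\<alpha>\<in>Poly_Mapping.keys F. Poly_Mapping.lookup F \<alpha> * monom_fun (Poly_Mapping.lookup \<alpha>) x)"
  by (rule poly_eval_superset) auto

lemma poly_eval_zero [simp]: "poly_eval 0 x = 0"
  by (simp add: poly_eval_def)

lemma poly_eval_add: "poly_eval (F + G) x = poly_eval F x + poly_eval G x"
proof -
  let ?S = "Poly_Mapping.keys F \<union> Poly_Mapping.keys G"
  have "Poly_Mapping.keys (F + G) \<subseteq> ?S" by (rule Poly_Mapping.keys_add)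
  then show ?thesis
    using poly_eval_superset[of ?S "F + G" x] poly_eval_superset[of ?S F x] poly_eval_superset[of ?S G x]
    by (simp add: lookup_add ring_distribs sum.distrib)
qed

lemma poly_eval_sum: "poly_eval (\<Sum>i\<in>I. F i) x = (\<Sum>i\<in>I. poly_eval (F i) x)"
  by (induction I rule: infinite_finite_induct) (simp_all add: poly_eval_add)

lemma poly_eval_single: "poly_eval (Poly_Mapping.single \<alpha> c) x = c * monom_fun (Poly_Mapping.lookup \<alpha>) x"
  by (subst poly_eval_superset[of "{\<alpha>}"]) (auto simp: lookup_single)

lemma polyfun_poly_eval [polyfun_intros]: "polyfun (poly_eval F)"
  unfolding poly_eval_monom_fun by (intro polyfun_intros)

lemma poly_eval_partial_deriv:
  "poly_eval (partial_deriv i F) x = (\<Sum>\<alpha>\<in>Poly_Mapping.keys F. Poly_Mapping.lookup F \<alpha> *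
     (of_nat (Poly_Mapping.lookup \<alpha> i) * monom_fun (Poly_Mapping.lookup (\<alpha> - Poly_Mapping.single i 1)) x))"
  unfolding partial_deriv_def poly_eval_sum poly_eval_single by (intro sum.cong) (auto simp: mult_ac)

lemma poly_eval_has_derivative:
  "(poly_eval F has_derivative (\<lambda>h. \<Sum>i\<in>UNIV. h $ i * poly_eval (partial_deriv i F) x)) (at x)"
proof -
  have nth: "((\<lambda>x. x $ i) has_derivative (\<lambda>h. h $ i)) (at x)" for i and x :: "complex ^ 'a"
    by (rule bounded_linear.has_derivative[OF bounded_linear_vec_nth]) simp
  have mono: "(monom_fun \<alpha> has_derivative
      (\<lambda>h. \<Sum>i\<in>UNIV. h $ i * (of_nat (\<alpha> i) * (x $ i) ^ (\<alpha> i - 1)) * (\<Prod>j\<in>UNIV - {i}. (x $ j) ^ \<alpha> j))) (at x)"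
    for \<alpha> :: "'a \<Rightarrow> nat"
    unfolding monom_fun_def[abs_def]
    by (rule has_derivative_eq_rhs[OF has_derivative_prod[where f' = "\<lambda>i h. h $ i * (of_nat (\<alpha> i) * (x $ i) ^ (\<alpha> i - 1))"]])
       (auto intro!: derivative_eq_intros nth simp: mult_ac)
  have red: "of_nat (Poly_Mapping.lookup \<alpha> i) * monom_fun (Poly_Mapping.lookup (\<alpha> - Poly_Mapping.single i 1)) x =
      of_nat (Poly_Mapping.lookup \<alpha> i) * (x $ i) ^ (Poly_Mapping.lookup \<alpha> i - 1) * (\<Prod>j\<in>UNIV - {i}. (x $ j) ^ Poly_Mapping.lookup \<alpha> j)"
    for \<alpha> i
  proof -
    have "monom_fun (Poly_Mapping.lookup (\<alpha> - Poly_Mapping.single i 1)) x =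
       (x $ i) ^ (Poly_Mapping.lookup \<alpha> i - 1) * (\<Prod>j\<in>UNIV - {i}. (x $ j) ^ Poly_Mapping.lookup (\<alpha> - Poly_Mapping.single i 1) j)"
      unfolding monom_fun_def by (subst prod.remove[of UNIV i]) (simp_all add: lookup_minus lookup_single)
    also have "(\<Prod>j\<in>UNIV - {i}. (x $ j) ^ Poly_Mapping.lookup (\<alpha> - Poly_Mapping.single i 1) j)
        = (\<Prod>j\<in>UNIV - {i}. (x $ j) ^ Poly_Mapping.lookup \<alpha> j)"
      by (intro prod.cong) (auto simp: lookup_minus lookup_single when_def)
    finally show ?thesis by simp
  qed
  have "((\<lambda>x. \<Sum>\<alpha>\<in>Poly_Mapping.keys F. Poly_Mapping.lookup F \<alpha> * monom_fun (Poly_Mapping.lookup \<alpha>) x) has_derivative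
     (\<lambda>h. \<Sum>\<alpha>\<in>Poly_Mapping.keys F. Poly_Mapping.lookup F \<alpha> * (\<Sum>i\<in>UNIV. h $ i * (of_nat (Poly_Mapping.lookup \<alpha> i) * (x $ i) ^ (Poly_Mapping.lookup \<alpha> i - 1)) * (\<Prod>j\<in>UNIV - {i}. (x $ j) ^ Poly_Mapping.lookup \<alpha> j)))) (at x)"
    by (intro has_derivative_sum has_derivative_mult_right mono)
  moreover have "(\<Sum>\<alpha>\<in>Poly_Mapping.keys F. Poly_Mapping.lookup F \<alpha> * (\<Sum>i\<in>UNIV. h $ i * (of_nat (Poly_Mapping.lookup \<alpha> i) * (x $ i) ^ (Poly_Mapping.lookup \<alpha> i - 1)) * (\<Prod>j\<in>UNIV - {i}. (x $ j) ^ Poly_Mapping.lookup \<alpha> j)))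
      = (\<Sum>i\<in>UNIV. h $ i * poly_eval (partial_deriv i F) x)" for h :: "complex ^ 'a"
  proof -
    have "(\<Sum>i\<in>UNIV. h $ i * poly_eval (partial_deriv i F) x) = (\<Sum>i\<in>UNIV. \<Sum>\<alpha>\<in>Poly_Mapping.keys F.
        Poly_Mapping.lookup F \<alpha> * (h $ i * (of_nat (Poly_Mapping.lookup \<alpha> i) * (x $ i) ^ (Poly_Mapping.lookup \<alpha> i - 1)) * (\<Prod>j\<in>UNIV - {i}. (x $ j) ^ Poly_Mapping.lookup \<alpha> j)))"
      unfolding poly_eval_partial_deriv red sum_distrib_left by (intro sum.cong refl) (simp add: mult_ac)
    then show ?thesis by (subst (asm) sum.swap) (simp add: sum_distrib_left)
  qed
  moreover have "poly_eval F = (\<lambda>x. \<Sum>\<alpha>\<in>Poly_Mapping.keys F. Poly_Mapping.lookup F \<alpha> * monom_fun (Poly_Mapping.lookup \<alpha>) x)"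
    by (rule ext) (rule poly_eval_monom_fun)
  ultimately show ?thesis by simp
qed

lemma poly_eval_homogeneous:
  assumes "homogeneous d F"
  shows "poly_eval F (t *s x) = t ^ d * poly_eval F x"
  unfolding poly_eval_monom_fun monom_fun_smult sum_distrib_left
  using assms by (intro sum.cong) (auto simp: homogeneous_def)

lemma partial_deriv_homogeneous:
  assumes "homogeneous d F"
  shows "poly_eval (partial_deriv i F) (t *s x) = t ^ (d - 1) * poly_eval (partial_deriv i F) x"
  unfolding poly_eval_partial_deriv monom_fun_smult sum_distrib_left
proof (rule sum.cong[OF refl])
  fix \<alpha> assume \<alpha>: "\<alpha> \<in> Poly_Mapping.keys F"
  have "(\<Sum>j\<in>UNIV. Poly_Mapping.lookup (\<alpha> - Poly_Mapping.single i 1) j) = d - 1" if "Poly_Mapping.lookup \<alpha> i \<noteq> 0"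
  proof -
    have "(\<Sum>j\<in>UNIV. Poly_Mapping.lookup (\<alpha> - Poly_Mapping.single i 1) j) + (\<Sum>j\<in>UNIV. if j = i then 1 else 0)
       = (\<Sum>j\<in>UNIV. Poly_Mapping.lookup \<alpha> j)"
      unfolding sum.distrib[symmetric] using that
      by (intro sum.cong) (auto simp: lookup_minus lookup_single when_def)
    then show ?thesis using assms \<alpha> by (simp add: homogeneous_def)
  qed
  then show "Poly_Mapping.lookup F \<alpha> * (of_nat (Poly_Mapping.lookup \<alpha> i) *
        (t ^ (\<Sum>j\<in>UNIV. Poly_Mapping.lookup (\<alpha> - Poly_Mapping.single i 1) j) *
         monom_fun (Poly_Mapping.lookup (\<alpha> - Poly_Mapping.single i 1)) x)) =
      t ^ (d - 1) * (Poly_Mapping.lookup F \<alpha> * (of_nat (Poly_Mapping.lookup \<alpha> i) *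
         monom_fun (Poly_Mapping.lookup (\<alpha> - Poly_Mapping.single i 1)) x))"
    by (cases "Poly_Mapping.lookup \<alpha> i = 0") (simp_all add: mult_ac)
qed

text \<open>The formal gradient is determined by the derivatives along lines.\<close>
lemma directional_derivative:
  assumes "((\<lambda>t. poly_eval F (x + t *s v)) has_derivative (\<lambda>\<tau>. \<tau> * r)) (at 0)"
  shows "(\<Sum>i\<in>UNIV. v $ i * poly_eval (partial_deriv i F) x) = r"
proof -
  have "(poly_eval F has_derivative (\<lambda>h. \<Sum>i\<in>UNIV. h $ i * poly_eval (partial_deriv i F) x)) (at (x + 0 *s v))"
    using poly_eval_has_derivative[of F x] by simp
  from has_derivative_compose[OF line_has_derivative this]
  have "((\<lambda>t. poly_eval F (x + t *s v)) has_derivative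
      (\<lambda>\<tau>. \<Sum>i\<in>UNIV. (\<tau> *s v) $ i * poly_eval (partial_deriv i F) x)) (at 0)" .
  from has_derivative_unique[OF this assms]
  have "(\<lambda>\<tau>. \<Sum>i\<in>UNIV. (\<tau> *s v) $ i * poly_eval (partial_deriv i F) x) = (\<lambda>\<tau>. \<tau> * r)" .
  from fun_cong[OF this, of 1] show ?thesis by simp
qed

lemma euler_identity:
  assumes "homogeneous d F"
  shows "(\<Sum>i\<in>UNIV. x $ i * poly_eval (partial_deriv i F) x) = of_nat d * poly_eval F x"
proof (rule directional_derivative)
  have "x + t *s x = (1 + t) *s x" for t by (simp add: vec.scale_left_distrib)
  then have "(\<lambda>t. poly_eval F (x + t *s x)) = (\<lambda>t. (1 + t) ^ d * poly_eval F x)"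
    by (simp only: poly_eval_homogeneous[OF assms])
  moreover have "((\<lambda>t::complex. (1 + t) ^ d * poly_eval F x) has_derivative (\<lambda>\<tau>. \<tau> * (of_nat d * poly_eval F x))) (at 0)"
    by (auto intro!: derivative_eq_intros)
  ultimately show "((\<lambda>t. poly_eval F (x + t *s x)) has_derivative (\<lambda>\<tau>. \<tau> * (of_nat d * poly_eval F x))) (at 0)"
    by (simp only:)
qed

lemma span_in_Proj:
  assumes "vec.subspace W" "x \<in> W" "x \<noteq> 0"
  shows "vec.span {x} \<in> Proj W"
  using assms by (simp add: Proj_def vec.span_minimal)

lemma Union_Proj:
  assumes "vec.subspace W" "vec.dim W \<noteq> 0"
  shows "\<Union>(Proj W) = W"
proof (intro equalityI subsetI)
  fix x assume x: "x \<in> W"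
  obtain y where y: "y \<in> W" "y \<noteq> 0" using assms(2) by (auto simp: vec.dim_eq_0)
  show "x \<in> \<Union>(Proj W)"
  proof (cases "x = 0")
    case True
    then show ?thesis using span_in_Proj[OF assms(1) y] vec.span_zero by blast
  next
    case False
    then show ?thesis using span_in_Proj[OF assms(1) x] vec.span_base by blast
  qed
qed (auto simp: Proj_def)

lemma two_form_add_left: "two_form lam (u + u') v = two_form lam u v + two_form lam u' v"
  and two_form_scale_left: "two_form lam (t *s u) v = t * two_form lam u v"
  and two_form_swap: "two_form lam u v = - two_form lam v u"
proof -
  show "two_form lam (u + u') v = two_form lam u v + two_form lam u' v"
    by (simp add: two_form_def sum.distrib[symmetric] algebra_simps)
  show "two_form lam (t *s u) v = t * two_form lam u v"
    by (simp add: two_form_def sum_distrib_left algebra_simps)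
  show "two_form lam u v = - two_form lam v u"
    by (simp add: two_form_def sum_negf[symmetric] algebra_simps)
qed

lemma two_form_self: "two_form lam u u = 0"
  by (simp add: two_form_def mult.commute)

lemma two_form_add_right: "two_form lam u (v + v') = two_form lam u v + two_form lam u v'"
  by (metis (no_types) two_form_add_left two_form_swap add.inverse_distrib_swap add.commute)

lemma two_form_scale_right: "two_form lam u (t *s v) = t * two_form lam u v"
  by (metis two_form_scale_left two_form_swap mult_minus_right)

lemma two_form_zero: "two_form lam 0 v = 0" "two_form lam u 0 = 0"
  using two_form_scale_left[of lam 0 0 v] two_form_scale_right[of lam u 0 0] by simp_all

lemma two_form_sum_left: "two_form lam (\<Sum>i\<in>I. g i) v = (\<Sum>i\<in>I. two_form lam (g i) v)"
  by (induction I rule: infinite_finite_induct) (simp_all add: two_form_zero two_form_add_left)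

text \<open>The matrix \<open>B\<close> inverts the isomorphism with the dual space given by the form.\<close>
lemma two_form_dual:
  assumes "symplectic lam"
  shows "\<exists>B. \<forall>w v. two_form lam (B *v w) v = (\<Sum>j\<in>UNIV. w $ j * v $ j)"
proof -
  define M where "M = (\<chi> j i. lam $ i $ j - lam $ j $ i)"
  have M: "two_form lam u v = (\<Sum>j\<in>UNIV. (M *v u) $ j * v $ j)" for u v
  proof -
    have "two_form lam u v = (\<Sum>i\<in>UNIV. \<Sum>j\<in>UNIV. lam $ i $ j * u $ i * v $ j)
        - (\<Sum>i\<in>UNIV. \<Sum>j\<in>UNIV. lam $ i $ j * u $ j * v $ i)"
      by (simp add: two_form_def right_diff_distrib sum_subtractf mult.assoc)
    also have "(\<Sum>i\<in>UNIV. \<Sum>j\<in>UNIV. lam $ i $ j * u $ i * v $ j)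
        = (\<Sum>j\<in>UNIV. \<Sum>i\<in>UNIV. lam $ i $ j * u $ i * v $ j)" by (rule sum.swap)
    finally show ?thesis
      by (simp add: M_def matrix_vector_mult_def sum_distrib_right left_diff_distrib sum_subtractf)
  qed
  have "u = 0" if "M *v u = 0" for u
  proof (rule ccontr)
    assume "u \<noteq> 0"
    then obtain v where "two_form lam u v \<noteq> 0" using assms by (auto simp: symplectic_def)
    then show False by (simp add: M that)
  qed
  then have "det M \<noteq> 0" by (simp add: invertible_iff_ker)
  then obtain B where "M ** B = mat 1" by (meson invertible_det_nz invertible_right_inverse)
  then have "M *v (B *v w) = w" for w by (simp add: matrix_vector_mul_assoc)
  then show ?thesis by (intro exI[of _ B]) (simp add: M)
qed

text \<open>Otherwise \<open>W\<close> and \<open>u\<close> span an isotropic space of more than half the dimension. A basis of it has more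
elements than it needs to be completed to a basis of the whole space, so a nontrivial combination is
orthogonal to all completing vectors, hence to everything.\<close>
lemma lagrangian_maximal:
  fixes lam :: "complex ^ 'n ^ 'n::finite"
  assumes lam: "symplectic lam" and dim: "CARD('n) = 2 * vec.dim W"
    and W: "vec.subspace W" "\<And>x y. x \<in> W \<Longrightarrow> y \<in> W \<Longrightarrow> two_form lam x y = 0"
    and u: "\<And>w. w \<in> W \<Longrightarrow> two_form lam u w = 0"
  shows "u \<in> W"
proof (rule ccontr)
  assume "u \<notin> W"
  obtain B where B: "B \<subseteq> W" "vec.independent B" "W \<subseteq> vec.span B" "card B = vec.dim W"
    using vec.basis_exists[of W] by metis
  have span: "vec.span B = W" using B W(1) vec.span_minimal by blast
  define B' where "B' = insert u B"
  have indB': "vec.independent B'" unfolding B'_def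
    by (rule vec.independent_insertI) (use \<open>u \<notin> W\<close> span B(2) in auto)
  have finB: "finite B" using B(2) vec.finiteI_independent by blast
  have cardB': "card B' = vec.dim W + 1"
    unfolding B'_def using \<open>u \<notin> W\<close> B(1,4) finB by (subst card_insert_disjoint) auto
  have isoB': "two_form lam x y = 0" if "x \<in> B'" "y \<in> B'" for x y
    using that B(1) W(2)[of x y] u[of x] u[of y] two_form_self[of lam u] two_form_swap[of lam x u]
    unfolding B'_def by auto
  obtain E where E: "B' \<subseteq> E" "vec.independent E" "UNIV \<subseteq> vec.span E"
    by (rule vec.maximal_independent_subset_extend[OF subset_UNIV indB']) blast
  have finE: "finite E" using E(2) vec.finiteI_independent by blast
  have "card E = CARD('n)" using vec.basis_card_eq_dim[OF subset_UNIV E(3,2)] vec_dim_card by simp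
  then have "card (E - B') < card B'"
    using E(1) finE cardB' dim by (simp add: card_Diff_subset finite_subset)
  moreover have "finite (E - B')" "finite B'" using finE E(1) finite_subset by auto
  ultimately obtain y where y: "\<exists>b\<in>B'. y b \<noteq> 0" "\<And>v. v \<in> E - B' \<Longrightarrow> (\<Sum>b\<in>B'. y b * two_form lam b v) = 0"
    using underdetermined_system[of "E - B'" B' "two_form lam"] by blast
  define z where "z = (\<Sum>b\<in>B'. y b *s b)"
  have zE: "two_form lam z v = 0" if "v \<in> E" for v
  proof (cases "v \<in> B'")
    case True
    then show ?thesis using isoB' by (simp add: z_def two_form_sum_left two_form_scale_left)
  next
    case False
    then show ?thesis using y(2)[of v] that by (simp add: z_def two_form_sum_left two_form_scale_left)
  qed
  have "two_form lam z v = 0" for v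
  proof -
    have "v \<in> vec.span E" using E(3) by blast
    then show ?thesis
      by (induction rule: vec.span_induct_alt) (simp_all add: two_form_zero two_form_add_right two_form_scale_right zE)
  qed
  then have "z = 0" using lam by (auto simp: symplectic_def)
  then show False using y(1) indB' \<open>finite B'\<close>
    unfolding z_def by (auto simp: vec.dependent_finite)
qed

section \<open>The upper bound\<close>

text \<open>By the Euler identity, a common zero of all partial derivatives is a zero of \<open>F\<close>; this is where
smoothness enters.\<close>
lemma hamiltonian_field:
  assumes lam: "symplectic lam" and F: "homogeneous d F" and d: "d \<ge> 2"
    and smooth: "\<And>x. x \<noteq> 0 \<Longrightarrow> poly_eval F x = 0 \<Longrightarrow> \<exists>i. poly_eval (partial_deriv i F) x \<noteq> 0"
  obtains H where "nondegenerate_homogeneous (d - 1) H"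
    "\<And>x v. two_form lam (H x) v = (\<Sum>i\<in>UNIV. v $ i * poly_eval (partial_deriv i F) x)"
proof -
  obtain B where B: "\<And>w v. two_form lam (B *v w) v = (\<Sum>j\<in>UNIV. w $ j * v $ j)"
    using two_form_dual[OF lam] by blast
  define H where "H = (\<lambda>x. B *v (\<chi> i. poly_eval (partial_deriv i F) x))"
  have H: "two_form lam (H x) v = (\<Sum>i\<in>UNIV. v $ i * poly_eval (partial_deriv i F) x)" for x v
    by (simp add: H_def B mult.commute)
  have "nondegenerate_homogeneous (d - 1) H"
    unfolding nondegenerate_homogeneous_def
  proof (intro conjI allI impI)
    fix i show "polyfun (\<lambda>x. H x $ i)"
      unfolding H_def matrix_vector_mult_def by (simp, intro polyfun_intros)
  next
    fix t x
    have "(\<chi> i. poly_eval (partial_deriv i F) (t *s x)) = t ^ (d - 1) *s (\<chi> i. poly_eval (partial_deriv i F) x)"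
      by (simp add: vec_eq_iff partial_deriv_homogeneous[OF F])
    then show "H (t *s x) = t ^ (d - 1) *s H x" by (simp add: H_def vector_scalar_commute)
  next
    fix x assume "H x = 0"
    then have grad: "poly_eval (partial_deriv i F) x = 0" for i
      using H[of x "axis i 1"] by (simp add: two_form_zero axis_def if_distrib[of "\<lambda>z. z * _"] cong: if_cong)
    then have "of_nat d * poly_eval F x = 0" using euler_identity[OF F, of x] by simp
    then have "poly_eval F x = 0" using d by simp
    then show "x = 0" using smooth[of x] grad by blast
  qed
  then show thesis using H by (rule that)
qed

text \<open>With \<open>q = (d - 1) ^ n\<close>, the bound for invariant subspaces reads \<open>1 + card I * (q - 1) \<le> q\<^sup>2\<close>; divide by
\<open>q - 1\<close>.\<close>
lemma disjoint_lagrangian_bound: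
  fixes lam :: "complex ^ 'n ^ 'n::finite"
  assumes card: "CARD('n) = 2 * n" and n: "n \<ge> 1" and lam: "symplectic lam" and d: "d \<ge> 3" and F: "homogeneous d F"
    and smooth: "\<And>x. x \<noteq> 0 \<Longrightarrow> poly_eval F x = 0 \<Longrightarrow> \<exists>i. poly_eval (partial_deriv i F) x \<noteq> 0"
    and I: "finite I" "\<And>L. L \<in> I \<Longrightarrow> vec.subspace L" "\<And>L. L \<in> I \<Longrightarrow> vec.dim L = n"
    and iso: "\<And>L x y. L \<in> I \<Longrightarrow> x \<in> L \<Longrightarrow> y \<in> L \<Longrightarrow> two_form lam x y = 0"
    and F0: "\<And>L x. L \<in> I \<Longrightarrow> x \<in> L \<Longrightarrow> poly_eval F x = 0"
    and disj: "\<And>L L'. L \<in> I \<Longrightarrow> L' \<in> I \<Longrightarrow> L \<noteq> L' \<Longrightarrow> L \<inter> L' \<subseteq> {0}"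
  shows "card I \<le> (d - 1) ^ n + 1"
proof -
  have "d \<ge> 2" using d by simp
  then obtain H where H: "nondegenerate_homogeneous (d - 1) H"
    "\<And>x v. two_form lam (H x) v = (\<Sum>i\<in>UNIV. v $ i * poly_eval (partial_deriv i F) x)"
    using hamiltonian_field[OF lam F _ smooth] by blast
  have inv: "H x \<in> L" if L: "L \<in> I" and x: "x \<in> L" for L x
  proof (rule lagrangian_maximal[OF lam])
    show "CARD('n) = 2 * vec.dim L" using card I(3)[OF L] by simp
    fix w assume w: "w \<in> L"
    \<comment> \<open>\<open>F\<close> vanishes on the line through \<open>x\<close> in the direction \<open>w\<close>, which lies in \<open>L\<close>\<close>
    have "poly_eval F (x + t *s w) = 0" for t
      using F0[OF L] x w I(2)[OF L] by (simp add: vec.subspace_add vec.subspace_scale)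
    then have "((\<lambda>t. poly_eval F (x + t *s w)) has_derivative (\<lambda>\<tau>. \<tau> * 0)) (at 0)" by simp
    then show "two_form lam (H x) w = 0" unfolding H(2) by (rule directional_derivative)
  qed (use iso[OF L] I(2)[OF L] in auto)
  define q where "q = (d - 1) ^ n"
  have "1 + card I * (q - 1) \<le> (d - 1) ^ CARD('n)"
    unfolding q_def by (rule invariant_subspaces_bound[OF H(1) _ I inv disj]) (use d in auto)
  also have "\<dots> = q * q" by (simp add: card q_def mult_2 power_add)
  finally have le: "1 + card I * (q - 1) \<le> q * q" .
  have "q \<ge> 2 ^ n" unfolding q_def using d by (intro power_mono) auto
  moreover have "(2::nat) ^ n \<ge> 2 ^ 1" using n by (intro power_increasing) auto
  ultimately have q2: "q \<ge> 2" by simp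
  then obtain s where s: "q = Suc s" "s \<ge> 1" by (cases q) auto
  have "card I * s \<le> (s + 2) * s" using le by (simp add: s(1) algebra_simps)
  then have "card I \<le> s + 2" by (rule mult_right_le_imp_le) (use s(2) in simp)
  then show ?thesis using s(1) by (simp add: q_def)
qed

lemma involutive_planes_bound:
  fixes lam :: "complex ^ 'n ^ 'n::finite"
  assumes card: "CARD('n) = 2 * m + 2" and lam: "symplectic lam" and d: "d \<ge> 3"
    and X: "smooth_hypersurface d X" and S: "disjoint_involutive_planes lam m X S"
  shows "finite S \<and> card S \<le> (d - 1) ^ (m + 1) + 1"
proof (rule finite_if_finite_subsets_card_bdd)
  fix S' assume S': "S' \<subseteq> S" "finite S'"
  obtain F where F: "homogeneous d F" "X = zero_locus F"
    "\<forall>p\<in>X. \<forall>x\<in>p. x \<noteq> 0 \<longrightarrow> (\<exists>i. poly_eval (partial_deriv i F) x \<noteq> 0)"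
    using X by (auto simp: smooth_hypersurface_def)
  have smooth: "\<exists>i. poly_eval (partial_deriv i F) x \<noteq> 0" if x: "x \<noteq> 0" "poly_eval F x = 0" for x
  proof -
    have "vec.span {x} \<in> X"
      using span_in_Proj[OF vec.subspace_UNIV UNIV_I x(1)] x(2) d
      by (auto simp: F(2) zero_locus_def vec.span_singleton poly_eval_homogeneous[OF F(1)])
    then show ?thesis using F(3) x(1) vec.span_base by blast
  qed
  have plane: "\<exists>W. vec.subspace W \<and> vec.dim W = m + 1 \<and> \<Lambda> = Proj W" if "\<Lambda> \<in> S'" for \<Lambda>
    using S S' that by (auto simp: disjoint_involutive_planes_def m_plane_def)
  then obtain W where W: "\<And>\<Lambda>. \<Lambda> \<in> S' \<Longrightarrow> vec.subspace (W \<Lambda>)" "\<And>\<Lambda>. \<Lambda> \<in> S' \<Longrightarrow> vec.dim (W \<Lambda>) = m + 1"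
    "\<And>\<Lambda>. \<Lambda> \<in> S' \<Longrightarrow> \<Lambda> = Proj (W \<Lambda>)" by metis
  have cone: "\<Union>\<Lambda> = W \<Lambda>" if "\<Lambda> \<in> S'" for \<Lambda>
    using Union_Proj[OF W(1)[OF that]] W(2)[OF that] W(3)[OF that] by simp
  have disj: "W \<Lambda> \<inter> W \<Lambda>' \<subseteq> {0}" if "\<Lambda> \<in> S'" "\<Lambda>' \<in> S'" "\<Lambda> \<noteq> \<Lambda>'" for \<Lambda> \<Lambda>'
  proof
    fix x assume x: "x \<in> W \<Lambda> \<inter> W \<Lambda>'"
    have "pairwise disjnt S" using S by (simp add: disjoint_involutive_planes_def)
    then have "disjnt \<Lambda> \<Lambda>'" using S'(1) that by (blast dest: pairwiseD)
    then have "\<not> (vec.span {x} \<in> Proj (W \<Lambda>) \<and> vec.span {x} \<in> Proj (W \<Lambda>'))"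
      using W(3)[OF that(1)] W(3)[OF that(2)] by (auto simp: disjnt_iff)
    then show "x \<in> {0}" using x span_in_Proj[OF W(1)] that by blast
  qed
  have inj: "inj_on W S'" using W(3) by (metis inj_onI)
  have "card (W ` S') \<le> (d - 1) ^ (m + 1) + 1"
  proof (rule disjoint_lagrangian_bound[OF _ _ lam d F(1) smooth])
    show "CARD('n) = 2 * (m + 1)" using card by simp
    show "finite (W ` S')" using S'(2) by simp
    fix L assume "L \<in> W ` S'"
    then obtain \<Lambda> where \<Lambda>: "\<Lambda> \<in> S'" "L = W \<Lambda>" by blast
    show "vec.subspace L" "vec.dim L = m + 1" using W(1,2) \<Lambda> by auto
    fix x assume x: "x \<in> L"
    show "poly_eval F x = 0"
    proof -
      have "x \<in> \<Union>\<Lambda>" using x cone \<Lambda> by blast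
      then obtain p where "p \<in> \<Lambda>" "x \<in> p" by blast
      moreover have "\<Lambda> \<subseteq> X" using S S' \<Lambda>(1) by (auto simp: disjoint_involutive_planes_def)
      ultimately show ?thesis by (auto simp: F(2) zero_locus_def)
    qed
    fix y assume y: "y \<in> L"
    have "involutive lam \<Lambda>" using S S' \<Lambda>(1) by (auto simp: disjoint_involutive_planes_def)
    then show "two_form lam x y = 0"
      using x y cone[OF \<Lambda>(1)] \<Lambda>(2) by (simp add: involutive_def contact_form_def radial_field_def)
  next
    fix L L' assume "L \<in> W ` S'" "L' \<in> W ` S'" "L \<noteq> L'"
    then show "L \<inter> L' \<subseteq> {0}" using disj by blast
  qed simp_all
  then show "card S' \<le> (d - 1) ^ (m + 1) + 1" by (simp add: card_image[OF inj])
qed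

section \<open>A surface with many skew involutive lines\<close>

lemma homogeneous_polynomial_exists:
  fixes f :: "complex ^ 'n::finite \<Rightarrow> complex"
  assumes "polyfun f" "\<And>t x. f (t *s x) = t ^ d * f x"
  obtains F where "homogeneous d F" "\<And>x. poly_eval F x = f x"
proof -
  obtain a where a: "\<And>x. f x = (\<Sum>\<alpha>\<in>deg_exps d. a \<alpha> * monom_fun \<alpha> x)"
    using homogeneous_expansion[OF assms] by blast
  have look: "Poly_Mapping.lookup (Abs_poly_mapping \<alpha>) = \<alpha>" for \<alpha> :: "'n \<Rightarrow> nat"
    by (simp add: Abs_poly_mapping_inverse)
  define F where "F = (\<Sum>\<alpha>\<in>deg_exps d. Poly_Mapping.single (Abs_poly_mapping \<alpha>) (a \<alpha>))"
  have "poly_eval F x = f x" for x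
    by (simp add: F_def poly_eval_sum poly_eval_single look a)
  moreover have "homogeneous d F"
    unfolding homogeneous_def
  proof
    fix \<beta> assume "\<beta> \<in> Poly_Mapping.keys F"
    then have "(\<Sum>\<alpha>\<in>deg_exps d. Poly_Mapping.lookup (Poly_Mapping.single (Abs_poly_mapping \<alpha>) (a \<alpha>)) \<beta>) \<noteq> 0"
      by (simp add: in_keys_iff F_def lookup_sum)
    then obtain \<alpha> where "\<alpha> \<in> deg_exps d" "Poly_Mapping.lookup (Poly_Mapping.single (Abs_poly_mapping \<alpha>) (a \<alpha>)) \<beta> \<noteq> 0"
      by (meson sum.neutral)
    then have "\<alpha> \<in> deg_exps d" "\<beta> = Abs_poly_mapping \<alpha>" by (auto simp: lookup_single when_def split: if_splits)
    then show "(\<Sum>i\<in>UNIV. Poly_Mapping.lookup \<beta> i) = d" by (simp add: look deg_exps_def)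
  qed
  ultimately show thesis by (intro that)
qed

lemma darboux_basis:
  fixes lam :: "complex ^ 'n ^ 'n::finite"
  assumes lam: "symplectic lam" and card: "CARD('n) = 4"
  obtains a b c e :: "complex ^ 'n" where
    "two_form lam a c = 1" "two_form lam b e = 1"
    "two_form lam a b = 0" "two_form lam a e = 0" "two_form lam b c = 0" "two_form lam c e = 0"
    "\<And>x. two_form lam x a = 0 \<Longrightarrow> two_form lam x b = 0 \<Longrightarrow> two_form lam x c = 0 \<Longrightarrow>
       two_form lam x e = 0 \<Longrightarrow> x = 0"
proof -
  let ?s = "two_form lam"
  note bil = two_form_add_left two_form_add_right two_form_scale_left two_form_scale_right
  define a :: "complex ^ 'n" where "a = axis undefined 1"
  have "a \<noteq> 0" by (simp add: a_def axis_eq_0_iff)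
  then obtain b' where b': "?s a b' \<noteq> 0" using lam by (auto simp: symplectic_def)
  define c where "c = inverse (?s a b') *s b'"
  have ac: "?s a c = 1" "?s c a = - 1" using b' two_form_swap[of lam c a] by (auto simp: c_def bil)
  obtain y :: "'n \<Rightarrow> complex" where y: "\<exists>i\<in>UNIV. y i \<noteq> 0"
    "\<And>w. w \<in> {a, c} \<Longrightarrow> (\<Sum>i\<in>UNIV. y i * ?s (axis i 1) w) = 0"
  proof -
    have "card {a, c} < CARD('n)" using card by (simp add: card_insert_if)
    from underdetermined_system[OF _ finite this, of "\<lambda>i w. ?s (axis i 1) w"] show thesis using that by auto
  qed
  define b where "b = (\<chi> i. y i)"
  have "b = (\<Sum>i\<in>UNIV. y i *s axis i 1)" using basis_expansion[of b] by (simp add: b_def)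
  then have bw: "?s b w = 0" if "w \<in> {a, c}" for w
    using y(2)[OF that] by (simp add: two_form_sum_left two_form_scale_left)
  have ba: "?s b a = 0" "?s a b = 0" and bc: "?s b c = 0" "?s c b = 0"
    using bw two_form_swap[of lam a b] two_form_swap[of lam c b] by auto
  have "b \<noteq> 0" using y(1) by (auto simp: b_def vec_eq_iff)
  then obtain v where v: "?s b v \<noteq> 0" using lam by (auto simp: symplectic_def)
  \<comment> \<open>the component of \<open>v\<close> orthogonal to \<open>a\<close> and \<open>c\<close>\<close>
  define v' where "v' = v + (- ?s v c) *s a + ?s v a *s c"
  have v'a: "?s v' a = 0" "?s v' c = 0" "?s b v' = ?s b v"
    unfolding v'_def bil by (simp_all add: ac two_form_self ba bc)
  define e where "e = inverse (?s b v) *s v'"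
  have e: "?s e a = 0" "?s a e = 0" "?s e c = 0" "?s c e = 0" "?s b e = 1" "?s e b = - 1"
    using v v'a two_form_swap[of lam a v'] two_form_swap[of lam c v'] two_form_swap[of lam v' b]
    by (simp_all add: e_def bil)
  have nondeg: "x = 0" if xs: "?s x a = 0" "?s x b = 0" "?s x c = 0" "?s x e = 0" for x
  proof -
    \<comment> \<open>five vectors in a space of dimension four\<close>
    define w where "w = (\<lambda>k::nat. if k = 0 then a else if k = 1 then b else if k = 2 then c else if k = 3 then e else x)"
    have "card (UNIV :: 'n set) < card {..<5::nat}" using card by simp
    from underdetermined_system[OF finite finite_lessThan this, of "\<lambda>k i. w k $ i"]
    obtain z where z: "\<exists>k<5. z k \<noteq> 0" "\<And>i. (\<Sum>k<5. z k * w k $ i) = 0" by auto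
    have "(\<Sum>k<5. z k *s w k) = 0" using z(2) by (simp add: vec_eq_iff)
    then have rel: "z 0 *s a + z 1 *s b + z 2 *s c + z 3 *s e + z 4 *s x = 0"
      by (simp add: eval_nat_numeral w_def)
    have "?s (z 0 *s a + z 1 *s b + z 2 *s c + z 3 *s e + z 4 *s x) t = 0" for t
      by (simp only: rel two_form_zero)
    then have "z 0 * ?s a t + z 1 * ?s b t + z 2 * ?s c t + z 3 * ?s e t + z 4 * ?s x t = 0" for t
      by (simp add: bil)
    from this[of a] this[of b] this[of c] this[of e]
    have z0: "z 0 = 0" "z 1 = 0" "z 2 = 0" "z 3 = 0"
      by (simp_all add: two_form_self ac ba bc e xs)
    then have "z 4 *s x = 0" using rel by simp
    moreover have "z 4 \<noteq> 0"
    proof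
      assume "z 4 = 0"
      then have "z k = 0" if "k < 5" for k
        using that z0 by (auto simp: less_Suc_eq eval_nat_numeral)
      then show False using z(1) by blast
    qed
    ultimately show ?thesis by simp
  qed
  show thesis
    by (rule that[OF ac(1) e(5) ba(2) e(2) bc(1) e(4) nondeg])
qed

text \<open>Multiplying the first equation by \<open>a\<close>, the second by \<open>b\<close>, and so on, gives a linear relation between
the four monomials \<open>a\<^sup>e b\<close>, \<open>b\<^sup>e c\<close>, \<open>c\<^sup>e d\<close>, \<open>d\<^sup>e a\<close>: going round the cycle multiplies each by \<open>e\<close> to the
power 4. So they all vanish. By symmetry the conclusion holds for the other three variables as well.\<close>
lemma cyclic_gradient_zero:
  fixes a b c d :: complex
  assumes e: "e \<ge> 2"
    and eq: "of_nat e * a ^ (e - 1) * b + d ^ e = 0" "of_nat e * b ^ (e - 1) * c + a ^ e = 0"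
      "of_nat e * c ^ (e - 1) * d + b ^ e = 0" "of_nat e * d ^ (e - 1) * a + c ^ e = 0"
  shows "a = 0"
proof (rule ccontr)
  assume a: "a \<noteq> 0"
  define E where "E = (of_nat e :: complex)"
  have pow: "z * z ^ (e - 1) = z ^ e" for z :: complex using e by (simp add: power_eq_if)
  have "a * (E * a ^ (e - 1) * b + d ^ e) = 0" "b * (E * b ^ (e - 1) * c + a ^ e) = 0"
    "c * (E * c ^ (e - 1) * d + b ^ e) = 0" "d * (E * d ^ (e - 1) * a + c ^ e) = 0"
    using eq by (simp_all add: E_def)
  then have "E * (a * a ^ (e - 1)) * b + d ^ e * a = 0" "E * (b * b ^ (e - 1)) * c + a ^ e * b = 0"
    "E * (c * c ^ (e - 1)) * d + b ^ e * c = 0" "E * (d * d ^ (e - 1)) * a + c ^ e * d = 0"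
    by (simp_all only: ring_distribs mult_ac)
  then have m: "d ^ e * a = - E * (a ^ e * b)" "a ^ e * b = - E * (b ^ e * c)"
    "b ^ e * c = - E * (c ^ e * d)" "c ^ e * d = - E * (d ^ e * a)"
    unfolding pow by (simp_all add: add_eq_0_iff mult_ac)
  then have "a ^ e * b = E ^ 4 * (a ^ e * b)" by (simp add: eval_nat_numeral mult.assoc)
  moreover have "E ^ 4 \<noteq> 1"
  proof
    assume "E ^ 4 = 1"
    then have "of_nat (e ^ 4) = (of_nat 1 :: complex)" by (simp add: E_def)
    then have "e ^ 4 = 1" using of_nat_eq_iff by blast
    then show False using e by simp
  qed
  ultimately have "a ^ e * b = 0" by (metis mult_cancel_right1 mult.commute)
  then have "b = 0" using a by simp
  then have "a ^ e = 0" using eq(2) e by (simp add: power_0_left)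
  then show False using a by simp
qed

text \<open>The points of the line \<open>W \<alpha>\<close> satisfy \<open>C = \<alpha> A\<close> and \<open>D = \<beta> \<alpha> B\<close>, and on it the equation becomes
\<open>A\<^sup>e B (1 + \<alpha>\<^sup>e \<beta>) + A B\<^sup>e (\<alpha> + \<beta>\<^sup>e)\<close>. The conditions on \<open>\<alpha>\<close> say that both brackets vanish. Two lines are skew
because both \<open>\<alpha>\<close> and \<open>\<beta>\<close> differ.\<close>
lemma skew_involutive_lines_exist:
  fixes lam :: "complex ^ 'n ^ 'n::finite"
  assumes lam: "symplectic lam" and card: "CARD('n) = 4" and d: "d \<ge> 3"
  shows "\<exists>X S. smooth_hypersurface d X \<and> disjoint_involutive_planes lam 1 X S \<and>
           finite S \<and> card S = (d - 1) ^ 2 + 1"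
proof -
  let ?s = "two_form lam"
  note bil = two_form_add_left two_form_add_right two_form_scale_left two_form_scale_right
  obtain ua ub uc ud where u02: "?s ua uc = 1" and u13: "?s ub ud = 1"
    and u0: "?s ua ub = 0" "?s ua ud = 0" "?s ub uc = 0" "?s uc ud = 0"
    and nondeg: "\<And>x. ?s x ua = 0 \<Longrightarrow> ?s x ub = 0 \<Longrightarrow> ?s x uc = 0 \<Longrightarrow> ?s x ud = 0 \<Longrightarrow> x = 0"
    by (rule darboux_basis[OF lam card]) blast
  have uu: "?s uc ua = - 1" "?s ud ub = - 1" "?s ub ua = 0" "?s ud ua = 0"
    "?s uc ub = 0" "?s ud uc = 0"
    using two_form_swap[of lam uc ua] two_form_swap[of lam ud ub] two_form_swap[of lam ub ua]
      two_form_swap[of lam ud ua] two_form_swap[of lam uc ub] two_form_swap[of lam ud uc]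
      u02 u13 u0 by simp_all
  note us = u02 u13 u0 uu two_form_self
  \<comment> \<open>coordinates in the symplectic basis\<close>
  define A B C D where "A = (\<lambda>x. ?s x uc)" and "B = (\<lambda>x. ?s x ud)"
    and "C = (\<lambda>x. - ?s x ua)" and "D = (\<lambda>x. - ?s x ub)"
  note coords = A_def B_def C_def D_def
  have lin: "polyfun A" "polyfun B" "polyfun C" "polyfun D"
    unfolding coords by (rule polyfun_linear; simp add: bil)+
  have scale: "A (t *s x) = t * A x" "B (t *s x) = t * B x" "C (t *s x) = t * C x" "D (t *s x) = t * D x" for t x
    by (simp_all add: coords bil)
  have add: "A (x + y) = A x + A y" "B (x + y) = B x + B y" "C (x + y) = C x + C y" "D (x + y) = D x + D y" for x y
    by (simp_all add: coords bil)
  have zero: "x = 0" if "A x = 0" "B x = 0" "C x = 0" "D x = 0" for x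
    by (rule nondeg) (use that in \<open>simp_all add: coords\<close>)
  define e where "e = d - 1"
  have e: "e \<ge> 2" "d = Suc e" using d by (auto simp: e_def)
  define f where "f = (\<lambda>x. A x ^ e * B x + B x ^ e * C x + C x ^ e * D x + D x ^ e * A x)"
  have "polyfun f" unfolding f_def by (intro polyfun_intros lin)
  moreover have "f (t *s x) = t ^ d * f x" for t x
    unfolding f_def scale e(2) by (simp add: power_mult_distrib algebra_simps)
  ultimately obtain F where F: "homogeneous d F" "\<And>x. poly_eval F x = f x"
    by (rule homogeneous_polynomial_exists) blast
  have Fnz: "F \<noteq> 0"
  proof
    assume "F = 0"
    then have "f (ua + ub) = 0" using F(2)[of "ua + ub"] by simp
    moreover have "f (ua + ub) = 1" using e by (simp add: f_def add) (simp add: coords us power_0_left)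
    ultimately show False by simp
  qed
  have grad: "(\<Sum>i\<in>UNIV. v $ i * poly_eval (partial_deriv i F) x) =
      of_nat e * A x ^ (e - 1) * A v * B x + A x ^ e * B v + (of_nat e * B x ^ (e - 1) * B v * C x + B x ^ e * C v) +
      (of_nat e * C x ^ (e - 1) * C v * D x + C x ^ e * D v) + (of_nat e * D x ^ (e - 1) * D v * A x + D x ^ e * A v)"
    (is "_ = ?r") for x v
  proof (rule directional_derivative)
    have "((\<lambda>t. (A x + t * A v) ^ e * (B x + t * B v) + (B x + t * B v) ^ e * (C x + t * C v)
         + (C x + t * C v) ^ e * (D x + t * D v) + (D x + t * D v) ^ e * (A x + t * A v)) has_derivative (\<lambda>\<tau>. \<tau> * ?r)) (at 0)"
      by (auto intro!: derivative_eq_intros simp: fun_eq_iff algebra_simps)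
    then show "((\<lambda>t. poly_eval F (x + t *s v)) has_derivative (\<lambda>\<tau>. \<tau> * ?r)) (at 0)"
      by (simp add: F(2) f_def add scale)
  qed
  define X where "X = zero_locus F"
  have smooth: "\<exists>i. poly_eval (partial_deriv i F) x \<noteq> 0" if "x \<noteq> 0" for x
  proof (rule ccontr)
    assume "\<nexists>i. poly_eval (partial_deriv i F) x \<noteq> 0"
    then have g: "(\<Sum>i\<in>UNIV. v $ i * poly_eval (partial_deriv i F) x) = 0" for v by simp
    have eqs: "of_nat e * A x ^ (e - 1) * B x + D x ^ e = 0" "of_nat e * B x ^ (e - 1) * C x + A x ^ e = 0"
      "of_nat e * C x ^ (e - 1) * D x + B x ^ e = 0" "of_nat e * D x ^ (e - 1) * A x + C x ^ e = 0"
    proof -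
      have cu: "A ua = 1" "A ub = 0" "A uc = 0" "A ud = 0" "B ua = 0" "B ub = 1" "B uc = 0"
        "B ud = 0" "C ua = 0" "C ub = 0" "C uc = 1" "C ud = 0" "D ua = 0" "D ub = 0"
        "D uc = 0" "D ud = 1" by (simp_all add: coords us)
      show "of_nat e * A x ^ (e - 1) * B x + D x ^ e = 0" using g[of ua] unfolding grad cu by simp
      show "of_nat e * B x ^ (e - 1) * C x + A x ^ e = 0" using g[of ub] unfolding grad cu by (simp add: add.commute)
      show "of_nat e * C x ^ (e - 1) * D x + B x ^ e = 0" using g[of uc] unfolding grad cu by (simp add: add.commute)
      show "of_nat e * D x ^ (e - 1) * A x + C x ^ e = 0" using g[of ud] unfolding grad cu by (simp add: add.commute)
    qed
    have "x = 0"
      by (rule zero) (rule cyclic_gradient_zero[OF e(1) eqs] cyclic_gradient_zero[OF e(1) eqs(2,3,4,1)]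
        cyclic_gradient_zero[OF e(1) eqs(3,4,1,2)] cyclic_gradient_zero[OF e(1) eqs(4,1,2,3)])+
    then show False using that by blast
  qed
  have X: "smooth_hypersurface d X"
    unfolding smooth_hypersurface_def
    by (intro exI[of _ F] conjI ballI impI smooth Fnz F(1)) (simp add: X_def)
  define R where "R = {\<alpha>::complex. \<alpha> ^ (e ^ 2 + 1) = (- 1) ^ d}"
  have cardR: "card R = e ^ 2 + 1" unfolding R_def by (rule card_nth_roots) simp_all
  have R0: "\<alpha> \<noteq> 0" if "\<alpha> \<in> R" for \<alpha> using that by (auto simp: R_def)
  define \<beta> where "\<beta> = (\<lambda>\<alpha>::complex. - inverse (\<alpha> ^ e))"
  have \<beta>1: "1 + \<alpha> ^ e * \<beta> \<alpha> = 0" if "\<alpha> \<in> R" for \<alpha> using R0[OF that] by (simp add: \<beta>_def)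
  have \<beta>2: "\<alpha> + \<beta> \<alpha> ^ e = 0" if "\<alpha> \<in> R" for \<alpha>
  proof -
    have ee: "\<alpha> ^ e ^ 2 = (\<alpha> ^ e) ^ e" by (simp add: power2_eq_square power_mult)
    have "\<alpha> ^ e ^ 2 * (\<alpha> + \<beta> \<alpha> ^ e) = \<alpha> ^ (e ^ 2 + 1) + (\<alpha> ^ e * \<beta> \<alpha>) ^ e"
      by (simp add: ring_distribs ee power_mult_distrib)
    also have "\<alpha> ^ e * \<beta> \<alpha> = - 1" using \<beta>1[OF that] by (simp add: add_eq_0_iff)
    also have "\<alpha> ^ (e ^ 2 + 1) + (- 1) ^ e = 0" using that by (simp add: R_def e(2))
    finally show ?thesis using R0[OF that] by simp
  qed
  have \<beta>inj: "\<alpha> = \<alpha>'" if "\<alpha> \<in> R" "\<alpha>' \<in> R" "\<beta> \<alpha> = \<beta> \<alpha>'" for \<alpha> \<alpha>'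
    using \<beta>2[OF that(1)] \<beta>2[OF that(2)] that(3) by (metis add_right_cancel)
  define p q where "p = (\<lambda>\<alpha>. ua + \<alpha> *s uc)" and "q = (\<lambda>\<alpha>. ub + \<beta> \<alpha> *s ud)"
  define W where "W = (\<lambda>\<alpha>. vec.span {p \<alpha>, q \<alpha>})"
  have cp: "A (p \<alpha>) = 1" "B (p \<alpha>) = 0" "C (p \<alpha>) = \<alpha>" "D (p \<alpha>) = 0"
    and cq: "A (q \<alpha>) = 0" "B (q \<alpha>) = 1" "C (q \<alpha>) = 0" "D (q \<alpha>) = \<beta> \<alpha>" for \<alpha>
    by (simp_all add: p_def q_def add scale) (simp_all add: coords us)
  have memW: "\<exists>a b. x = a *s p \<alpha> + b *s q \<alpha>" if x: "x \<in> W \<alpha>" for x \<alpha>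
  proof -
    obtain k where "x - k *s p \<alpha> \<in> vec.span {q \<alpha>}"
      using x unfolding W_def vec.span_breakdown_eq by blast
    then obtain l where "x - k *s p \<alpha> = l *s q \<alpha>" by (auto simp: vec.span_singleton)
    then have "x = k *s p \<alpha> + l *s q \<alpha>" by (simp add: algebra_simps)
    then show ?thesis by blast
  qed
  have subW: "vec.subspace (W \<alpha>)" for \<alpha> by (simp add: W_def vec.subspace_span)
  have dimW: "vec.dim (W \<alpha>) = 2" for \<alpha>
  proof -
    have "q \<alpha> \<noteq> 0" using cq(2)[of \<alpha>] scale(2)[of 0 0] by auto
    moreover have "p \<alpha> \<notin> vec.span {q \<alpha>}"
    proof
      assume "p \<alpha> \<in> vec.span {q \<alpha>}"
      then obtain l where "p \<alpha> = l *s q \<alpha>" by (auto simp: vec.span_singleton)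
      then have "A (p \<alpha>) = l * A (q \<alpha>)" by (simp add: scale)
      then show False by (simp add: cp cq)
    qed
    ultimately show ?thesis unfolding W_def vec.dim_span by (simp add: vec.dim_insert)
  qed
  have coordW: "C x = \<alpha> * A x" "D x = \<beta> \<alpha> * B x" if "x \<in> W \<alpha>" for x \<alpha>
    using memW[OF that] by (auto simp: add scale cp cq)
  have FW: "f x = 0" if \<alpha>: "\<alpha> \<in> R" and x: "x \<in> W \<alpha>" for \<alpha> x
  proof -
    have "f x = A x ^ e * B x * (1 + \<alpha> ^ e * \<beta> \<alpha>) + B x ^ e * A x * (\<alpha> + \<beta> \<alpha> ^ e)"
      unfolding f_def coordW[OF x] by (simp add: power_mult_distrib algebra_simps)
    then show ?thesis by (simp add: \<beta>1[OF \<alpha>] \<beta>2[OF \<alpha>])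
  qed
  have isoW: "?s x y = 0" if "x \<in> W \<alpha>" "y \<in> W \<alpha>" for x y \<alpha>
  proof -
    have "?s (p \<alpha>) (q \<alpha>) = 0" "?s (q \<alpha>) (p \<alpha>) = 0" by (simp_all add: p_def q_def bil us)
    then show ?thesis using memW[OF that(1)] memW[OF that(2)] by (auto simp: bil two_form_self)
  qed
  have disjW: "x = 0" if "\<alpha> \<in> R" "\<alpha>' \<in> R" "\<alpha> \<noteq> \<alpha>'" "x \<in> W \<alpha>" "x \<in> W \<alpha>'" for x \<alpha> \<alpha>'
  proof -
    have "\<alpha> * A x = \<alpha>' * A x" "\<beta> \<alpha> * B x = \<beta> \<alpha>' * B x"
      using coordW[OF that(4)] coordW[OF that(5)] by metis+
    moreover have "\<beta> \<alpha> \<noteq> \<beta> \<alpha>'" using \<beta>inj that by blast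
    ultimately have "A x = 0" "B x = 0" using that(3) by auto
    then show ?thesis using zero coordW[OF that(4)] by simp
  qed
  define S where "S = (\<lambda>\<alpha>. Proj (W \<alpha>)) ` R"
  have cone: "\<Union>(Proj (W \<alpha>)) = W \<alpha>" for \<alpha> by (rule Union_Proj[OF subW]) (simp add: dimW)
  have disjProj: "disjnt (Proj (W \<alpha>)) (Proj (W \<alpha>'))" if "\<alpha> \<in> R" "\<alpha>' \<in> R" "\<alpha> \<noteq> \<alpha>'" for \<alpha> \<alpha>'
    unfolding disjnt_iff
  proof (intro allI notI)
    fix l assume l: "l \<in> Proj (W \<alpha>) \<and> l \<in> Proj (W \<alpha>')"
    then have "l \<subseteq> {0}" using disjW[OF that] by (auto simp: Proj_def)
    then have "vec.dim l = 0" by (simp only: vec.dim_eq_0)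
    moreover have "vec.dim l = 1" using l by (simp add: Proj_def)
    ultimately show False by simp
  qed
  have "inj_on (\<lambda>\<alpha>. Proj (W \<alpha>)) R"
  proof (rule inj_onI, rule ccontr)
    fix \<alpha> \<alpha>' assume \<alpha>: "\<alpha> \<in> R" "\<alpha>' \<in> R" "Proj (W \<alpha>) = Proj (W \<alpha>')" "\<alpha> \<noteq> \<alpha>'"
    then have "Proj (W \<alpha>) = {}" using disjProj[OF \<alpha>(1,2,4)] by (simp add: disjnt_def)
    then have "W \<alpha> = {}" using cone[of \<alpha>] by simp
    then show False using vec.subspace_0[OF subW[of \<alpha>]] by simp
  qed
  then have "card S = e ^ 2 + 1" by (simp add: S_def card_image cardR)
  moreover then have "finite S" by (intro card_ge_0_finite) simp
  moreover have "disjoint_involutive_planes lam 1 X S"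
    unfolding disjoint_involutive_planes_def
  proof (intro conjI ballI)
    fix \<Lambda> assume "\<Lambda> \<in> S"
    then obtain \<alpha> where \<alpha>: "\<alpha> \<in> R" "\<Lambda> = Proj (W \<alpha>)" by (auto simp: S_def)
    show "m_plane 1 \<Lambda>" unfolding m_plane_def
      by (intro exI[of _ "W \<alpha>"]) (simp add: subW dimW \<alpha>)
    show "involutive lam \<Lambda>"
      unfolding involutive_def \<alpha>(2) cone by (simp add: contact_form_def radial_field_def isoW)
    show "\<Lambda> \<subseteq> X" using FW[OF \<alpha>(1)] by (auto simp: \<alpha>(2) X_def zero_locus_def Proj_def F(2))
  next
    show "pairwise disjnt S" unfolding S_def pairwise_def using disjProj by auto
  qed
  ultimately show ?thesis using X unfolding e_def by blast
qed

theorem theorem3: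
  fixes lam :: "complex ^ 'n ^ 'n::finite" and m d :: nat
  assumes "m \<ge> 1" and "CARD('n) = 2 * m + 2" and "symplectic lam" and "d \<ge> 3"
  shows "(\<forall>X S. smooth_hypersurface d X \<and> disjoint_involutive_planes lam m X S
            \<longrightarrow> finite S \<and> card S \<le> (d - 1) ^ (m + 1) + 1)
       \<and> (m = 1 \<and> d \<ge> 6 \<longrightarrow>
            (\<exists>X S. smooth_hypersurface d X \<and> disjoint_involutive_planes lam m X S
                   \<and> finite S \<and> card S = (d - 1) ^ 2 + 1))"
proof (intro conjI allI impI)
  fix X S
  assume "smooth_hypersurface d X \<and> disjoint_involutive_planes lam m X S"
  then have "finite S \<and> card S \<le> (d - 1) ^ (m + 1) + 1"
    using involutive_planes_bound[OF assms(2-4)] by blast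
  then show "finite S" "card S \<le> (d - 1) ^ (m + 1) + 1" by auto
next
  assume "m = 1 \<and> d \<ge> 6"
  then show "\<exists>X S. smooth_hypersurface d X \<and> disjoint_involutive_planes lam m X S
                   \<and> finite S \<and> card S = (d - 1) ^ 2 + 1"
    using skew_involutive_lines_exist[OF assms(3) _ assms(4)] assms(2) by simp
qed

end
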